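(* Let $r,s\in\mathrm{ri}(\Delta_N)$ and assume the optimal transport coupling $\pi^\star$ between $r$ and $s$ is unique. Let $\hat r_n,\hat s_m$ be the empirical measures of independent i.i.d. samples $X_1,\dots,X_n\sim r$ and $Y_1,\dots,Y_m\sim s$ on $\{1,\dots,N\}$, let $\hat\pi_{n,m}$ be any measurable choice of optimal solution of $(\mathrm{P}_{\mathrm{OT}})$ with marginals $(\hat r_n,\hat s_m)$, and let $n,m\to\infty$ with $m/(n+m)\to\lambda\in(0,1)$. Let $G=(\sqrt\lambda\,G^1,\sqrt{1-\lambda}\,G^2)\in\mathbb{R}^{2N-1}$ with $G^1,G^2$ independent as defined below. If the weights satisfy $(\alpha^{\mathcal K}_{n,m},G_{n,m})\xrightarrow{D}(\alpha^{\mathcal K},G)$ for every non-empty $\mathcal K$, where $G_{n,m}=\sqrt{nm/(n+m)}\,((\hat r_n)_\dagger-r_\dagger,\hat s_m-s)$, then $$\sqrt{\tfrac{nm}{n+m}}\big(\hat\pi_{n,m}-\pi^\star\big)\xrightarrow{D}\sum_{\emptyset\ne\mathcal K\subseteq[K]}\mathbb 1\Big\{G\in H_{\mathcal K}\setminus\bigcup_{k\notin\mathcal K}H_k\Big\}\,\alpha^{\mathcal K}\otimes\pi(I_{\mathcal K},G).$$ If moreover (A3) holds for $(\mathrm{P}_{\mathrm{OT}})$, then (without any condition on weights) $$\sqrt{\tfrac{nm}{n+m}}\big(\hat\pi_{n,m}-\pi^\star\big)\xrightarrow{D}\sum_{k=1}^K\mathbb 1\Big\{G\in H_k\setminus\b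igcup_{j<k}H_j\Big\}\,\pi(I_k,G).$$
   Context: $\Delta_N=\{r\in\mathbb{R}^N:r_i\ge0,\sum r_i=1\}$, $\mathrm{ri}(\Delta_N)$ those with all $r_i>0$. Reduced OT problem $(\mathrm{P}_{\mathrm{OT}})$ with marginals $(r,s)$: vectorize $\pi,c\in\mathbb{R}^{N^2}$ via index $(i-1)N+j$; $A_\dagger\in\mathbb{R}^{(2N-1)\times N^2}$ with $(A_\dagger\pi)_i=\sum_j\pi_{ij}$ ($i\le N-1$), $(A_\dagger\pi)_{N-1+j}=\sum_i\pi_{ij}$; $r_\dagger=(r_1,\dots,r_{N-1})$; $\min c^T\pi$ s.t. $A_\dagger\pi=(r_\dagger,s)$, $\pi\ge0$. A basis is $I\subseteq[N^2]$, $|I|=2N-1$, $A_{\dagger I}$ invertible; $\pi(I,v)\in\mathbb{R}^{N^2}$ has coordinates $A_{\dagger I}^{-1}v$ on $I$ and $0$ elsewhere; $\lambda(I)=A_{\dagger I}^{-T}c_I$; $I$ dual feasible if $A_\dagger^T\lambda(I)\le c$. $I_1,\dots,I_N'$ denote all dual feasible bases, $I_1,\dots,I_K$ those with $\pi(I_k,(r_\dagger,s))\ge0$ (all inducing $\pi^\star$). (A3): $\lambda(I_j)\ne\lambda(I_k)$ for $1\le j<k\le K$. Weights: on the event that $\{k:\pi(I_k,((\hat r_n)_\dagger,\hat s_m))\ge0\}=\mathcal K$, $\hat\pi_{n,m}=\sum_{k\in\mathcal K}(\alpha^{\mathcal K}_{n,m})_k\pi(I_k,((\hat r_n)_\dagger,\hat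 s_m))$ with $\alpha^{\mathcal K}_{n,m}$ in the unit simplex $\Delta_{|\mathcal K|}$; $\alpha\otimes\pi(I_{\mathcal K},v)=\sum_{k\in\mathcal K}\alpha_k\pi(I_k,v)$. Cones: $\mathrm{Pos}=\{i:\pi^\star_i>0\}$; for $I_k=\{i_1^k<\dots<i^k_{2N-1}\}$, $J_k=\{j:i^k_j\notin\mathrm{Pos}\}$, $H_k=\{v\in\mathbb{R}^{2N-1}:[A_{\dagger I_k}^{-1}v]_j\ge0\ \forall j\in J_k\}$, $H_{\mathcal K}=\bigcap_{k\in\mathcal K}H_k$. Gaussian limits: for $v\in\Delta_N$, $\Sigma(v)$ is the $N\times N$ matrix with diagonal entries $v_i(1-v_i)$ and off-diagonal entries $-v_iv_j$; $G^1$ is centred Gaussian on $\mathbb{R}^{N-1}$ with covariance the upper-left $(N-1)\times(N-1)$ block of $\Sigma(r)$, and $G^2$ is centred Gaussian on $\mathbb{R}^N$ with covariance $\Sigma(s)$. *)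

theory Defs
  imports "HOL-Probability.Probability"
begin

text \<open>Conventions (0-based). Vectors are functions nat => real.
  A coupling pi in R^(N^2) is stored with pi(i*N+j) for i,j < N (paper: index (i-1)N+j).
  A vector in R^d is a function vanishing at indices >= d.\<close>

definition vec_space :: "nat \<Rightarrow> (nat \<Rightarrow> real) set" where
  "vec_space d = {x. \<forall>i\<ge>d. x i = 0}"

definition rel_int_simplex :: "nat \<Rightarrow> (nat \<Rightarrow> real) \<Rightarrow> bool" where
  "rel_int_simplex N r \<longleftrightarrow> (\<forall>i<N. 0 < r i) \<and> (\<Sum>i<N. r i) = 1"

text \<open>Entries of the reduced constraint matrix A_dagger, of size (2N-1) x N^2.
  Row a < N-1: row sum of row a; row N-1+l: column sum of column l.\<close>
definition Adag_entry :: "nat \<Rightarrow> nat \<Rightarrow> nat \<Rightarrow> real" where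
  "Adag_entry N a j =
     (if a < N - 1 then (if j div N = a then 1 else 0)
      else if a < 2 * N - 1 then (if j mod N = a - (N - 1) then 1 else 0)
      else 0)"

definition Adag_app :: "nat \<Rightarrow> (nat \<Rightarrow> real) \<Rightarrow> nat \<Rightarrow> real" where
  "Adag_app N p a = (\<Sum>j<N^2. Adag_entry N a j * p j)"

definition ot_marg :: "nat \<Rightarrow> (nat \<Rightarrow> real) \<Rightarrow> (nat \<Rightarrow> real) \<Rightarrow> nat \<Rightarrow> real" where
  "ot_marg N r s a = (if a < N - 1 then r a else if a < 2 * N - 1 then s (a - (N - 1)) else 0)"

definition ot_feasible :: "nat \<Rightarrow> (nat \<Rightarrow> real) \<Rightarrow> (nat \<Rightarrow> real) \<Rightarrow> (nat \<Rightarrow> real) \<Rightarrow> bool" where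
  "ot_feasible N r s p \<longleftrightarrow> p \<in> vec_space (N^2) \<and> (\<forall>i<N^2. 0 \<le> p i) \<and>
     (\<forall>a<2 * N - 1. Adag_app N p a = ot_marg N r s a)"

definition ot_optimal ::
  "nat \<Rightarrow> (nat \<Rightarrow> real) \<Rightarrow> (nat \<Rightarrow> real) \<Rightarrow> (nat \<Rightarrow> real) \<Rightarrow> (nat \<Rightarrow> real) \<Rightarrow> bool" where
  "ot_optimal N c r s p \<longleftrightarrow> ot_feasible N r s p \<and>
     (\<forall>q. ot_feasible N r s q \<longrightarrow> (\<Sum>i<N^2. c i * p i) \<le> (\<Sum>i<N^2. c i * q i))"

text \<open>The unique optimal coupling pi-star (meaningful when it is unique).\<close>
definition pistar :: "nat \<Rightarrow> (nat \<Rightarrow> real) \<Rightarrow> (nat \<Rightarrow> real) \<Rightarrow> (nat \<Rightarrow> real) \<Rightarrow> nat \<Rightarrow> real" where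
  "pistar N c r s = (THE p. ot_optimal N c r s p)"

definition ot_enum :: "nat set \<Rightarrow> nat \<Rightarrow> nat" where
  "ot_enum I b = sorted_list_of_set I ! b"

definition ot_idx :: "nat set \<Rightarrow> nat \<Rightarrow> nat" where
  "ot_idx I i = card {j\<in>I. j < i}"

definition ot_Asub :: "nat \<Rightarrow> nat set \<Rightarrow> nat \<Rightarrow> nat \<Rightarrow> real" where
  "ot_Asub N I a b = Adag_entry N a (ot_enum I b)"

definition ot_is_inverse :: "nat \<Rightarrow> (nat \<Rightarrow> nat \<Rightarrow> real) \<Rightarrow> (nat \<Rightarrow> nat \<Rightarrow> real) \<Rightarrow> bool" where
  "ot_is_inverse d A B \<longleftrightarrow>
     (\<forall>a<d. \<forall>b<d. (\<Sum>k<d. A a k * B k b) = (if a = b then 1 else 0)) \<and>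
     (\<forall>a<d. \<forall>b<d. (\<Sum>k<d. B a k * A k b) = (if a = b then 1 else 0))"

definition ot_is_basis :: "nat \<Rightarrow> nat set \<Rightarrow> bool" where
  "ot_is_basis N I \<longleftrightarrow> I \<subseteq> {..<N^2} \<and> card I = 2 * N - 1 \<and>
     (\<exists>B. ot_is_inverse (2 * N - 1) (ot_Asub N I) B)"

definition ot_Binv :: "nat \<Rightarrow> nat set \<Rightarrow> nat \<Rightarrow> nat \<Rightarrow> real" where
  "ot_Binv N I = (SOME B. ot_is_inverse (2 * N - 1) (ot_Asub N I) B)"

definition basic_sol :: "nat \<Rightarrow> nat set \<Rightarrow> (nat \<Rightarrow> real) \<Rightarrow> nat \<Rightarrow> real" where
  "basic_sol N I v i =
     (if i \<in> I then (\<Sum>a<2 * N - 1. ot_Binv N I (ot_idx I i) a * v a) else 0)"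

definition dual_sol :: "nat \<Rightarrow> (nat \<Rightarrow> real) \<Rightarrow> nat set \<Rightarrow> nat \<Rightarrow> real" where
  "dual_sol N c I a =
     (if a < 2 * N - 1 then (\<Sum>b<2 * N - 1. ot_Binv N I b a * c (ot_enum I b)) else 0)"

definition dual_feasible :: "nat \<Rightarrow> (nat \<Rightarrow> real) \<Rightarrow> nat set \<Rightarrow> bool" where
  "dual_feasible N c I \<longleftrightarrow> ot_is_basis N I \<and>
     (\<forall>j<N^2. (\<Sum>a<2 * N - 1. Adag_entry N a j * dual_sol N c I a) \<le> c j)"

definition ot_Hcone :: "nat \<Rightarrow> (nat \<Rightarrow> real) \<Rightarrow> nat set \<Rightarrow> (nat \<Rightarrow> real) set" where
  "ot_Hcone N ps I = {v. \<forall>i\<in>I. \<not> (ps i > 0) \<longrightarrow> 0 \<le> basic_sol N I v i}"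

definition ot_empirical :: "(nat \<Rightarrow> 'a \<Rightarrow> nat) \<Rightarrow> nat \<Rightarrow> 'a \<Rightarrow> nat \<Rightarrow> real" where
  "ot_empirical X n \<omega> a = real (card {i. i < n \<and> X i \<omega> = a}) / real n"

definition ot_Sig :: "(nat \<Rightarrow> real) \<Rightarrow> nat \<Rightarrow> nat \<Rightarrow> real" where
  "ot_Sig v i j = (if i = j then v i * (1 - v i) else - v i * v j)"

text \<open>Centred Gaussian random vector in R^d with covariance C (Cramer-Wold definition:
  every linear combination is centred normal with variance u^T C u, point mass if 0).\<close>
definition centred_gaussian ::
  "'b measure \<Rightarrow> nat \<Rightarrow> (nat \<Rightarrow> nat \<Rightarrow> real) \<Rightarrow> ('b \<Rightarrow> nat \<Rightarrow> real) \<Rightarrow> bool" where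
  "centred_gaussian P d C Z \<longleftrightarrow> Z \<in> borel_measurable P \<and> (\<forall>\<omega>\<in>space P. Z \<omega> \<in> vec_space d) \<and>
     (\<forall>u::nat \<Rightarrow> real. let v = (\<Sum>i<d. \<Sum>j<d. u i * C i j * u j) in
        (v > 0 \<longrightarrow> distributed P lborel (\<lambda>\<omega>. \<Sum>i<d. u i * Z \<omega> i)
                      (\<lambda>x. ennreal (normal_density 0 (sqrt v) x))) \<and>
        (v = 0 \<longrightarrow> (AE \<omega> in P. (\<Sum>i<d. u i * Z \<omega> i) = 0)))"

definition conv_distr ::
  "'a measure \<Rightarrow> (nat \<Rightarrow> 'a \<Rightarrow> 'c::topological_space) \<Rightarrow> 'b measure \<Rightarrow> ('b \<Rightarrow> 'c) \<Rightarrow> bool" where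
  "conv_distr M Xs P X \<longleftrightarrow>
     (\<forall>f::'c \<Rightarrow> real. continuous_on UNIV f \<longrightarrow> bounded (range f) \<longrightarrow>
        (\<lambda>t. \<integral>\<omega>. f (Xs t \<omega>) \<partial>M) \<longlonglongrightarrow> (\<integral>\<omega>. f (X \<omega>) \<partial>P))"


definition simplex_on :: "nat set \<Rightarrow> (nat \<Rightarrow> real) \<Rightarrow> bool" where
  "simplex_on S w \<longleftrightarrow> (\<forall>k\<in>S. 0 \<le> w k) \<and> (\<forall>k. k \<notin> S \<longrightarrow> w k = 0) \<and> (\<Sum>k\<in>S. w k) = 1"

definition ot_scale :: "nat \<Rightarrow> nat \<Rightarrow> real" where
  "ot_scale n m = sqrt (real n * real m / (real n + real m))"

definition ot_Gvec :: "nat \<Rightarrow> real \<Rightarrow> ('b \<Rightarrow> nat \<Rightarrow> real) \<Rightarrow> ('b \<Rightarrow> nat \<Rightarrow> real) \<Rightarrow> 'b \<Rightarrow> nat \<Rightarrow> real" where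
  "ot_Gvec N lam G1 G2 \<omega> a =
     (if a < N - 1 then sqrt lam * G1 \<omega> a
      else if a < 2 * N - 1 then sqrt (1 - lam) * G2 \<omega> (a - (N - 1)) else 0)"

definition feas_set :: "nat \<Rightarrow> nat \<Rightarrow> (nat \<Rightarrow> nat set) \<Rightarrow> (nat \<Rightarrow> real) \<Rightarrow> nat set" where
  "feas_set N Nprime Ib v = {k. k < Nprime \<and> (\<forall>i. 0 \<le> basic_sol N (Ib k) v i)}"

end

theory Submission
  imports Defs
begin

text \<open>The fluctuations \<open>G\<^sub>n\<^sub>m\<close> of the marginals converge to \<open>G\<close> by the multivariate central limit theorem.
  With probability tending to one the dual feasible bases that are primal feasible for the empirical
  marginals are exactly the \<open>I\<^sub>k\<close> with \<open>k < K\<close> and \<open>G\<^sub>n\<^sub>m \<in> H\<^sub>k\<close>, and there is at least one of them;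
  on this event the rescaled error of the plan is a function of the weights and of \<open>G\<^sub>n\<^sub>m\<close>, which is linear in
  \<open>G\<^sub>n\<^sub>m\<close> as long as the set of these \<open>k\<close> does not change. It is discontinuous only on the hyperplanes bounding the
  cones. For \<open>N \<ge> 2\<close> each of them is null for \<open>G\<close>: the only functionals that degenerate on the support of \<open>G\<close> are the multiples of the
  total mass, and no row of \<open>A\<^sub>I\<close>-inverse is one of those, so the continuous mapping theorem applies.
  Under (A3) the dual solutions \<open>\<lambda>(I\<^sub>k)\<close> are strictly feasible off \<open>I\<^sub>k\<close>, since a tight constraint could be pivoted
  into the basis without changing the dual solution. By complementary slackness every optimal plan is then the basic solution of
  any feasible basis, which is the weighted case with all the weight on the smallest index.\<close>

section \<open>Bases and the simplex pivot\<close>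

text \<open>The empirical problem may be degenerate, so a basis that is primal and dual feasible is
  not simply read off from an optimal plan. It is found after perturbing the right-hand side so that
  every pivot makes progress; dual feasibility does not involve the right-hand side and survives the
  removal of the perturbation. All bases feasible at the true marginals induce the same vertex.
  Where this vertex is positive, feasibility is automatic for small fluctuations; at its zeros
  inside the basis it is decided by the sign of a linear functional of the fluctuation. This is the
  origin of the cones. Joint convergence is given for one pair of weights and fluctuation at a time,
  never for all weights together. Since exactly one pattern of active cones occurs at each point, a
  test function of the limit splits into a sum over patterns, each term of which involves one pair
  only. Multivariate convergence is reduced to characteristic functions; the tightness it needs is
  extracted from the one-dimensional convergence of the coordinates.\<close>

lemma bij_betw_ot_enum:
  assumes "finite I" shows "bij_betw (ot_enum I) {..<card I} I"
  using bij_betw_nth[of "sorted_list_of_set I" "{..<card I}" I] assms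
  by (simp add: ot_enum_def[abs_def] )

lemma ot_idx_ot_enum:
  assumes "finite I" "b < card I" shows "ot_idx I (ot_enum I b) = b"
proof -
  let ?xs = "sorted_list_of_set I"
  have len: "length ?xs = card I" using assms by simp
  have st: "sorted_wrt (<) ?xs" by simp
  have "{j\<in>I. j < ?xs ! b} = (!) ?xs ` {..<b}"
  proof safe
    fix j assume "j \<in> I" "j < ?xs ! b"
    then obtain k where k: "k < card I" "j = ?xs ! k"
      using assms len by (metis in_set_conv_nth set_sorted_list_of_set)
    then have "k < b"
      using st \<open>j < ?xs ! b\<close> len assms
      by (metis linorder_less_linear nat_less_le order.asym sorted_wrt_nth_less)
    then show "j \<in> (!) ?xs ` {..<b}" using k by auto
  next
    fix k assume "k < b"
    then show "?xs ! k \<in> I" using assms len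
      by (metis nth_mem order.strict_trans set_sorted_list_of_set)
    show "?xs ! k < ?xs ! b" using st \<open>k < b\<close> len assms by (simp add: sorted_wrt_nth_less)
  qed
  moreover have "inj_on ((!) ?xs) {..<b}"
    using assms len by (intro inj_on_nth) auto
  ultimately show ?thesis by (simp add: ot_idx_def ot_enum_def card_image)
qed

lemma ot_enum_ot_idx:
  assumes "finite I" "i \<in> I" shows "ot_enum I (ot_idx I i) = i" "ot_idx I i < card I"
proof -
  obtain b where "b < card I" "i = ot_enum I b"
    using bij_betw_ot_enum[OF assms(1)] assms(2) unfolding bij_betw_def by auto
  then show "ot_enum I (ot_idx I i) = i" "ot_idx I i < card I"
    using ot_idx_ot_enum[OF assms(1)] by auto
qed

lemma ot_is_basisD:
  assumes "ot_is_basis N I"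
  shows "finite I" "I \<subseteq> {..<N^2}" "card I = 2 * N - 1"
    and "ot_is_inverse (2 * N - 1) (ot_Asub N I) (ot_Binv N I)"
proof -
  show "I \<subseteq> {..<N^2}" "card I = 2 * N - 1" using assms by (auto simp: ot_is_basis_def)
  then show "finite I" using finite_subset by blast
  show "ot_is_inverse (2 * N - 1) (ot_Asub N I) (ot_Binv N I)"
    using assms someI_ex[of "ot_is_inverse (2 * N - 1) (ot_Asub N I)"]
    unfolding ot_is_basis_def ot_Binv_def by blast
qed

lemma sum_ot_enum:
  assumes "finite I" "card I = d"
  shows "(\<Sum>b<d. f (ot_enum I b)) = (\<Sum>i\<in>I. f i)"
  using sum.reindex_bij_betw[OF bij_betw_ot_enum[OF assms(1)], of f] assms(2) by simp

section \<open>The constraint map, basic solutions and dual solutions\<close>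

lemma Adag_app_support:
  assumes "I \<subseteq> {..<N^2}" "\<And>i. i \<notin> I \<Longrightarrow> p i = 0"
  shows "Adag_app N p a = (\<Sum>i\<in>I. Adag_entry N a i * p i)"
  unfolding Adag_app_def using assms by (intro sum.mono_neutral_right) auto

lemma Adag_app_add: "Adag_app N (\<lambda>i. p i + q i) a = Adag_app N p a + Adag_app N q a"
  by (simp add: Adag_app_def distrib_left sum.distrib)

lemma Adag_app_scale: "Adag_app N (\<lambda>i. x * p i) a = x * Adag_app N p a"
  by (simp add: Adag_app_def sum_distrib_left mult_ac)

lemma Adag_app_diff: "Adag_app N (\<lambda>i. p i - q i) a = Adag_app N p a - Adag_app N q a"
  by (simp add: Adag_app_def right_diff_distrib sum_subtractf)

lemma Adag_app_sum: "Adag_app N (\<lambda>i. \<Sum>k\<in>S. f k i) a = (\<Sum>k\<in>S. Adag_app N (f k) a)"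
  by (simp add: Adag_app_def sum_distrib_left sum.swap[of _ S])

lemma Adag_app_indicator:
  assumes "j < N^2" shows "Adag_app N (\<lambda>i. if i = j then 1 else 0) a = Adag_entry N a j"
  using assms by (simp add: Adag_app_def if_distrib[where f="\<lambda>x. _ * x"] sum.delta cong: if_cong)

lemma basic_sol_off: "i \<notin> I \<Longrightarrow> basic_sol N I v i = 0"
  by (simp add: basic_sol_def)

lemma basic_sol_add: "basic_sol N I (\<lambda>a. v a + w a) i = basic_sol N I v i + basic_sol N I w i"
  by (simp add: basic_sol_def distrib_left sum.distrib)

lemma basic_sol_scale: "basic_sol N I (\<lambda>a. x * v a) i = x * basic_sol N I v i"
  by (simp add: basic_sol_def sum_distrib_left mult_ac)

lemma basic_sol_diff: "basic_sol N I (\<lambda>a. v a - w a) i = basic_sol N I v i - basic_sol N I w i"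
  by (simp add: basic_sol_def right_diff_distrib sum_subtractf)

lemma basic_sol_sum: "basic_sol N I (\<lambda>a. \<Sum>k\<in>S. f k a) i = (\<Sum>k\<in>S. basic_sol N I (f k) i)"
  by (simp add: basic_sol_def sum_distrib_left sum.swap[of _ S])

lemma Adag_app_basic_sol:
  assumes I: "ot_is_basis N I" and a: "a < 2 * N - 1"
  shows "Adag_app N (basic_sol N I v) a = v a"
proof -
  let ?d = "2 * N - 1"
  note D = ot_is_basisD[OF I]
  have "Adag_app N (basic_sol N I v) a = (\<Sum>i\<in>I. Adag_entry N a i * basic_sol N I v i)"
    by (rule Adag_app_support[OF D(2)]) (rule basic_sol_off)
  also have "\<dots> = (\<Sum>b<?d. Adag_entry N a (ot_enum I b) * basic_sol N I v (ot_enum I b))"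
    by (rule sum_ot_enum[OF D(1,3), symmetric])
  also have "\<dots> = (\<Sum>b<?d. ot_Asub N I a b * (\<Sum>e<?d. ot_Binv N I b e * v e))"
    using D bij_betw_ot_enum[OF D(1)]
    by (intro sum.cong) (auto simp: basic_sol_def ot_Asub_def ot_idx_ot_enum bij_betw_def)
  also have "\<dots> = (\<Sum>e<?d. (\<Sum>b<?d. ot_Asub N I a b * ot_Binv N I b e) * v e)"
    by (simp add: sum_distrib_left sum_distrib_right mult_ac) (rule sum.swap)
  also have "\<dots> = (\<Sum>e<?d. (if a = e then 1 else 0) * v e)"
    using D(4) a by (intro sum.cong) (auto simp: ot_is_inverse_def)
  also have "\<dots> = v a" using a by (simp add: if_distrib[where f="\<lambda>x. x * _"] cong: if_cong)
  finally show ?thesis .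
qed

text \<open>The injective half of invertibility. Together with \<open>Adag_app_basic_sol\<close> it
  characterises a basic solution by its support and its marginals, so that pivoted solutions and
  optimal plans are identified without touching the inverse matrix.\<close>

lemma basic_sol_unique:
  assumes I: "ot_is_basis N I" and off: "\<And>i. i \<notin> I \<Longrightarrow> p i = 0"
    and sol: "\<And>a. a < 2 * N - 1 \<Longrightarrow> Adag_app N p a = v a"
  shows "p = basic_sol N I v"
proof
  fix i
  let ?d = "2 * N - 1"
  note D = ot_is_basisD[OF I]
  show "p i = basic_sol N I v i"
  proof (cases "i \<in> I")
    case True
    let ?b = "ot_idx I i"
    have b: "?b < ?d" "ot_enum I ?b = i" using ot_enum_ot_idx[OF D(1) True] D(3) by auto
    have "basic_sol N I v i = (\<Sum>a<?d. ot_Binv N I ?b a * Adag_app N p a)"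
      using True sol by (simp add: basic_sol_def)
    also have "\<dots> = (\<Sum>a<?d. ot_Binv N I ?b a * (\<Sum>e<?d. ot_Asub N I a e * p (ot_enum I e)))"
      unfolding ot_Asub_def sum_ot_enum[OF D(1,3), of "\<lambda>i. Adag_entry N _ i * p i"]
      by (simp add: Adag_app_support[OF D(2) off])
    also have "\<dots> = (\<Sum>e<?d. (\<Sum>a<?d. ot_Binv N I ?b a * ot_Asub N I a e) * p (ot_enum I e))"
      by (simp add: sum_distrib_left sum_distrib_right mult_ac) (rule sum.swap)
    also have "\<dots> = (\<Sum>e<?d. (if ?b = e then 1 else 0) * p (ot_enum I e))"
      using D(4) b(1) by (intro sum.cong) (auto simp: ot_is_inverse_def)
    also have "\<dots> = p i" using b by (simp add: if_distrib[where f="\<lambda>x. x * _"] cong: if_cong)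
    finally show ?thesis ..
  qed (simp add: off basic_sol_off)
qed

lemma basic_sol_column:
  assumes I: "ot_is_basis N I" and i: "i \<in> I"
  shows "basic_sol N I (\<lambda>a. Adag_entry N a i) = (\<lambda>j. if j = i then 1 else 0)"
  using ot_is_basisD(2)[OF I] i
  by (intro basic_sol_unique[OF I, symmetric]) (auto simp: Adag_app_indicator)

text \<open>Takes the place of rank or determinant arguments: the solutions for the unit right-hand
  sides are the columns of a right inverse, and injectivity makes it a left inverse too.\<close>

lemma ot_is_basisI:
  assumes sub: "I \<subseteq> {..<N^2}" and card: "card I = 2 * N - 1"
    and surj: "\<And>e. e < 2 * N - 1 \<Longrightarrow> \<exists>p. (\<forall>i. i \<notin> I \<longrightarrow> p i = 0) \<and>
         (\<forall>a<2 * N - 1. Adag_app N p a = (if a = e then 1 else 0))"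
    and inj: "\<And>p. (\<forall>i. i \<notin> I \<longrightarrow> p i = 0) \<Longrightarrow> (\<forall>a<2 * N - 1. Adag_app N p a = 0) \<Longrightarrow> \<forall>i. p i = 0"
  shows "ot_is_basis N I"
proof -
  let ?d = "2 * N - 1"
  have fin: "finite I" using sub finite_subset by blast
  define Q where "Q e q \<longleftrightarrow> (\<forall>i. i \<notin> I \<longrightarrow> q i = 0) \<and>
    (\<forall>a<?d. Adag_app N q a = (if a = e then 1 else 0))" for e q
  define p where "p e = (SOME q. Q e q)" for e
  have Qp: "Q e (p e)" if "e < ?d" for e
    unfolding p_def using surj[OF that] by (intro someI_ex[of "Q e"]) (simp only: Q_def)
  have p0: "p e i = 0" if "e < ?d" "i \<notin> I" for e i using Qp[OF that(1), unfolded Q_def] that(2) by blast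
  have pA: "Adag_app N (p e) a = (if a = e then 1 else 0)" if "e < ?d" "a < ?d" for e a
    using Qp[OF that(1), unfolded Q_def] that(2) by blast
  define B where "B k b = p b (ot_enum I k)" for k b
  have app: "Adag_app N q a = (\<Sum>k<?d. ot_Asub N I a k * q (ot_enum I k))"
    if "\<And>i. i \<notin> I \<Longrightarrow> q i = 0" for q a
    using Adag_app_support[OF sub that] sum_ot_enum[OF fin card, of "\<lambda>i. Adag_entry N a i * q i"]
    by (simp add: ot_Asub_def)
  have AB: "(\<Sum>k<?d. ot_Asub N I a k * B k b) = (if a = b then 1 else 0)" if "a < ?d" "b < ?d" for a b
    unfolding B_def using app[of "p b" a, symmetric] p0 pA that by auto
  have BA: "(\<Sum>k<?d. B a k * ot_Asub N I k b) = (if a = b then 1 else 0)" if a: "a < ?d" and b: "b < ?d" for a b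
  proof -
    let ?i = "ot_enum I b"
    have iI: "?i \<in> I" using bij_betw_ot_enum[OF fin] b card unfolding bij_betw_def by auto
    \<comment> \<open>The combination of the solutions \<open>p k\<close> with the entries of column
      \<open>b\<close> as coefficients, minus the unit vector at that column. It lies in the kernel,
      and its entries on \<open>I\<close> are those of column \<open>b\<close> of \<open>B\<close>
      times the matrix, minus the identity.\<close>
    define q where "q i = (\<Sum>k<?d. ot_Asub N I k b * p k i) - (if i = ?i then 1 else 0)" for i
    have "\<forall>i. q i = 0"
    proof (rule inj; intro allI impI)
      fix i assume "i \<notin> I" then show "q i = 0" using p0 iI by (auto simp: q_def)
    next
      fix e assume e: "e < ?d"
      have "Adag_app N q e = (\<Sum>k<?d. ot_Asub N I k b * Adag_app N (p k) e) - Adag_entry N e ?i"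
        unfolding q_def Adag_app_diff Adag_app_sum Adag_app_scale
        using Adag_app_indicator[of ?i N e] iI sub by auto
      also have "(\<Sum>k<?d. ot_Asub N I k b * Adag_app N (p k) e) = (\<Sum>k<?d. ot_Asub N I k b * (if e = k then 1 else 0))"
        using pA e by (intro sum.cong) auto
      also have "\<dots> = Adag_entry N e ?i"
        using e by (simp add: ot_Asub_def if_distrib[where f="\<lambda>x. _ * x"] cong: if_cong)
      finally show "Adag_app N q e = 0" by simp
    qed
    then have "q (ot_enum I a) = 0" by blast
    moreover have "ot_enum I a = ?i \<longleftrightarrow> a = b"
      using bij_betw_ot_enum[OF fin] a b card unfolding bij_betw_def inj_on_def by auto
    ultimately show ?thesis by (simp add: q_def B_def mult.commute)
  qed
  show ?thesis unfolding ot_is_basis_def ot_is_inverse_def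
    using sub card AB BA by blast
qed

lemma dual_sol_tight:
  assumes I: "ot_is_basis N I" and i: "i \<in> I"
  shows "(\<Sum>a<2 * N - 1. Adag_entry N a i * dual_sol N c I a) = c i"
proof -
  let ?d = "2 * N - 1"
  note D = ot_is_basisD[OF I]
  let ?b = "ot_idx I i"
  have b: "?b < ?d" "ot_enum I ?b = i" using ot_enum_ot_idx[OF D(1) i] D(3) by auto
  have "(\<Sum>a<?d. Adag_entry N a i * dual_sol N c I a)
      = (\<Sum>a<?d. ot_Asub N I a ?b * (\<Sum>e<?d. ot_Binv N I e a * c (ot_enum I e)))"
    using b by (simp add: dual_sol_def ot_Asub_def)
  also have "\<dots> = (\<Sum>e<?d. (\<Sum>a<?d. ot_Binv N I e a * ot_Asub N I a ?b) * c (ot_enum I e))"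
    by (simp add: sum_distrib_left sum_distrib_right mult_ac) (rule sum.swap)
  also have "\<dots> = (\<Sum>e<?d. (if e = ?b then 1 else 0) * c (ot_enum I e))"
    using D(4) b(1) by (intro sum.cong) (auto simp: ot_is_inverse_def)
  also have "\<dots> = c i" using b by (simp add: if_distrib[where f="\<lambda>x. x * _"] cong: if_cong)
  finally show ?thesis .
qed

lemma Adag_app_dual:
  "(\<Sum>a<d. l a * Adag_app N p a) = (\<Sum>j<N^2. (\<Sum>a<d. Adag_entry N a j * l a) * p j)"
  by (simp add: Adag_app_def sum_distrib_left sum_distrib_right mult_ac) (rule sum.swap)

text \<open>Pairing \<open>l\<close> with the basic solution for the \<open>e\<close>-th unit vector
  expresses \<open>l e\<close> through the costs on \<open>I\<close> alone.\<close>

lemma dual_sol_unique: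
  assumes I: "ot_is_basis N I"
    and l: "\<And>i. i \<in> I \<Longrightarrow> (\<Sum>a<2 * N - 1. Adag_entry N a i * l a) = c i" and off: "\<And>a. a \<ge> 2 * N - 1 \<Longrightarrow> l a = 0"
  shows "l = dual_sol N c I"
proof
  fix e
  let ?d = "2 * N - 1"
  note D = ot_is_basisD[OF I]
  show "l e = dual_sol N c I e"
  proof (cases "e < ?d")
    case True
    define p where "p = basic_sol N I (\<lambda>a. if a = e then 1 else 0)"
    have *: "m e = (\<Sum>j\<in>I. c j * p j)" if m: "\<And>i. i \<in> I \<Longrightarrow> (\<Sum>a<?d. Adag_entry N a i * m a) = c i" for m
    proof -
      have "m e = (\<Sum>a<?d. m a * Adag_app N p a)"
        using True by (simp add: p_def Adag_app_basic_sol[OF I] if_distrib[where f="\<lambda>x. _ * x"] cong: if_cong)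
      also have "\<dots> = (\<Sum>j\<in>I. (\<Sum>a<?d. Adag_entry N a j * m a) * p j)"
        unfolding Adag_app_dual using D(2)
        by (intro sum.mono_neutral_right) (auto simp: p_def basic_sol_off)
      finally show ?thesis using m by simp
    qed
    show ?thesis using *[of l] *[of "dual_sol N c I"] l dual_sol_tight[OF I] by simp
  qed (auto simp: off dual_sol_def)
qed

text \<open>Weak duality with its gap made explicit. A nonnegative gap gives optimality of basic
  solutions; a vanishing gap gives complementary slackness.\<close>

lemma cost_eq_dual_plus_slack:
  assumes "\<And>a. a < 2 * N - 1 \<Longrightarrow> Adag_app N p a = v a"
  shows "(\<Sum>j<N^2. c j * p j) = (\<Sum>a<2 * N - 1. l a * v a)
     + (\<Sum>j<N^2. (c j - (\<Sum>a<2 * N - 1. Adag_entry N a j * l a)) * p j)"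
proof -
  have "(\<Sum>a<2 * N - 1. l a * v a) = (\<Sum>a<2 * N - 1. l a * Adag_app N p a)"
    using assms by simp
  then show ?thesis unfolding Adag_app_dual
    by (simp add: left_diff_distrib sum_subtractf)
qed

lemma cost_basic_sol:
  assumes I: "ot_is_basis N I"
  shows "(\<Sum>j<N^2. c j * basic_sol N I v j) = (\<Sum>a<2 * N - 1. dual_sol N c I a * v a)"
proof -
  have "(c j - (\<Sum>a<2 * N - 1. Adag_entry N a j * dual_sol N c I a)) * basic_sol N I v j = 0" for j
    using dual_sol_tight[OF I, of j c] basic_sol_off[of j I N v] by (cases "j \<in> I") auto
  then have "(\<Sum>j<N^2. (c j - (\<Sum>a<2 * N - 1. Adag_entry N a j * dual_sol N c I a)) * basic_sol N I v j) = 0"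
    by (intro sum.neutral) blast
  then show ?thesis
    using cost_eq_dual_plus_slack[of N "basic_sol N I v" v c "dual_sol N c I"] Adag_app_basic_sol[OF I] by simp
qed

text \<open>The unit vector at \<open>j\<close> minus \<open>?y\<close> spans the kernel of the
  constraint map on the cells of \<open>I\<close> and \<open>j\<close>. As its entry at
  \<open>i\<close> is nonzero, a multiple of it trades coordinate \<open>i\<close> for coordinate
  \<open>j\<close>.\<close>

lemma basis_exchange:
  assumes I: "ot_is_basis N I" and i: "i \<in> I" and j: "j \<notin> I" "j < N^2"
    and y: "basic_sol N I (\<lambda>a. Adag_entry N a j) i \<noteq> 0"
  shows "ot_is_basis N (insert j (I - {i}))" (is "ot_is_basis N ?J")
proof (rule ot_is_basisI)
  let ?d = "2 * N - 1"
  let ?y = "basic_sol N I (\<lambda>a. Adag_entry N a j)"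
  note D = ot_is_basisD[OF I]
  show "?J \<subseteq> {..<N^2}" using D(2) j by auto
  have "card I > 0" using i D(1) by (auto simp: card_gt_0_iff)
  then show "card ?J = ?d" using D(1,3) i j by (auto simp: card_insert_if)
  have ke: "Adag_app N (\<lambda>k. (if k = j then 1 else 0) - ?y k) a = 0" if "a < ?d" for a
    using that by (simp add: Adag_app_diff Adag_app_indicator[OF j(2)] Adag_app_basic_sol[OF I])
  show "\<exists>p. (\<forall>k. k \<notin> ?J \<longrightarrow> p k = 0) \<and> (\<forall>a<?d. Adag_app N p a = (if a = e then 1 else 0))" if "e < ?d" for e
  proof -
    define z where "z = basic_sol N I (\<lambda>a. if a = e then 1 else 0)"
    \<comment> \<open>The factor \<open>z i / ?y i\<close> is the one that cancels coordinate
      \<open>i\<close>.\<close>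
    define p where "p = (\<lambda>k. z k + z i / ?y i * ((if k = j then 1 else 0) - ?y k))"
    have "p k = 0" if "k \<notin> ?J" for k
      using that y j i by (cases "k = i") (auto simp: p_def z_def basic_sol_off)
    moreover have "Adag_app N p a = (if a = e then 1 else 0)" if "a < ?d" for a
      using that unfolding p_def Adag_app_add Adag_app_scale by (simp add: ke z_def Adag_app_basic_sol[OF I])
    ultimately show ?thesis by blast
  qed
  fix p assume off: "\<forall>k. k \<notin> ?J \<longrightarrow> p k = 0" and ker: "\<forall>a<?d. Adag_app N p a = 0"
  \<comment> \<open>Subtracting \<open>p j\<close> times the kernel vector removes coordinate
    \<open>j\<close> and brings the support back into \<open>I\<close>, where injectivity is
    known.\<close>
  define q where "q = (\<lambda>k. p k - p j * ((if k = j then 1 else 0) - ?y k))"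
  have "q = basic_sol N I (\<lambda>a. 0)"
  proof (rule basic_sol_unique[OF I])
    show "q k = 0" if "k \<notin> I" for k using that off by (cases "k = j") (auto simp: q_def basic_sol_off)
    show "Adag_app N q a = 0" if "a < ?d" for a
      using that ker unfolding q_def Adag_app_diff[of _ p] Adag_app_scale by (simp add: ke)
  qed
  then have q0: "q k = 0" for k by (simp add: basic_sol_def)
  have "p i = 0" using off i j by auto
  moreover have "i \<noteq> j" using i j by auto
  ultimately have "p j = 0" using q0[of i] y by (simp add: q_def)
  then show "\<forall>k. p k = 0" using q0 by (simp add: q_def)
qed

section \<open>Rows, columns and total mass of a plan, and a first basis\<close>

lemma sum_square_index: "(\<Sum>j<N^2. f j) = (\<Sum>i<N. \<Sum>l<N. f (i * N + l))" for f :: "nat \<Rightarrow> 'b::comm_monoid_add"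
proof -
  have "(\<Sum>j<N^2. f j) = (\<Sum>i<N. sum f {i * N ..< i * N + N})"
    by (simp add: sum.nat_group power2_eq_square)
  moreover have "sum f {i * N ..< i * N + N} = (\<Sum>l<N. f (i * N + l))" for i
    using sum.shift_bounds_nat_ivl[of f 0 "i * N" N] by (simp add: add.commute lessThan_atLeast0)
  ultimately show ?thesis by simp
qed

lemma Adag_app_row:
  assumes "a < N - 1" shows "Adag_app N p a = (\<Sum>l<N. p (a * N + l))"
proof -
  have "Adag_app N p a = (\<Sum>i<N. \<Sum>l<N. if i = a then p (i * N + l) else 0)"
    unfolding Adag_app_def sum_square_index using assms
    by (intro sum.cong) (auto simp: Adag_entry_def)
  also have "\<dots> = (\<Sum>i<N. if i = a then (\<Sum>l<N. p (i * N + l)) else 0)"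
    by (intro sum.cong) auto
  finally show ?thesis using assms by simp
qed

lemma Adag_entry_col:
  assumes "b < N" shows "Adag_entry N (N - 1 + b) j = (if j mod N = b then 1 else 0)"
proof -
  have "\<not> N - 1 + b < N - 1" "N - 1 + b < 2 * N - 1" "N - 1 + b - (N - 1) = b" using assms by auto
  then show ?thesis by (simp only: Adag_entry_def if_True if_False)
qed

lemma Adag_app_col:
  assumes "b < N" shows "Adag_app N p (N - 1 + b) = (\<Sum>i<N. p (i * N + b))"
proof -
  have "Adag_app N p (N - 1 + b) = (\<Sum>i<N. \<Sum>l<N. if l = b then p (i * N + l) else 0)"
    unfolding Adag_app_def sum_square_index Adag_entry_col[OF assms]
    by (intro sum.cong) auto
  then show ?thesis using assms by simp
qed

text \<open>Adding up the column-marginal constraints reads off the total mass. This provides a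
  positive entry in every pivot direction, and up to a factor it is the functional on which the
  limit Gaussian degenerates.\<close>

lemma Adag_column_mass:
  assumes "j < N^2"
  shows "(\<Sum>a<2 * N - 1. Adag_entry N a j * (if a < N - 1 then 0 else 1)) = 1"
proof -
  have "N > 0" using assms by (cases N) auto
  have "(\<Sum>a<2 * N - 1. Adag_entry N a j * (if a < N - 1 then 0 else 1))
     = (\<Sum>a<2 * N - 1. if a = N - 1 + j mod N then 1 else 0)"
  proof (rule sum.cong[OF refl])
    fix a assume a: "a \<in> {..<2 * N - 1}"
    show "Adag_entry N a j * (if a < N - 1 then 0 else 1) = (if a = N - 1 + j mod N then 1 else 0)"
    proof (cases "a < N - 1")
      case False
      then have "a = N - 1 + (a - (N - 1))" "a - (N - 1) < N" using a by auto
      then show ?thesis using False Adag_entry_col[of "a - (N - 1)" N j] by auto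
    qed simp
  qed
  moreover have "N - 1 + j mod N < 2 * N - 1"
    using mod_less_divisor[OF \<open>N > 0\<close>, of j] by linarith
  ultimately show ?thesis by simp
qed

lemma sum_eq_Adag_app:
  "(\<Sum>j<N^2. p j) = (\<Sum>a<2 * N - 1. (if a < N - 1 then 0 else 1) * Adag_app N p a)"
proof -
  have "(\<Sum>j<N^2. p j) = (\<Sum>j<N^2. (\<Sum>a<2 * N - 1. Adag_entry N a j * (if a < N - 1 then 0 else 1)) * p j)"
    by (rule sum.cong) (simp_all only: lessThan_iff Adag_column_mass mult_1_left)
  then show ?thesis by (simp only: Adag_app_dual)
qed

text \<open>The witness consists of the cells of the last row and of the first column, a spanning
  tree of the complete bipartite graph. The constraint of the last row is the dropped one, so the
  system on these cells is triangular: each remaining row and each column except the first meets the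
  tree in a single cell.\<close>

lemma basis_exists:
  assumes N: "N \<ge> 1"
  shows "\<exists>I. ot_is_basis N I"
proof
  define I where "I = (\<lambda>l. (N - 1) * N + l) ` {..<N} \<union> (\<lambda>i. i * N) ` {..<N - 1}"
  have mem: "i * N + l \<in> I \<longleftrightarrow> i = N - 1 \<or> l = 0" if "i < N" "l < N" for i l
  proof -
    have "i = N - 1 \<or> l = 0" if "i * N + l \<in> I"
    proof -
      from that consider l' where "i * N + l = (N - 1) * N + l'" "l' < N" | i' where "i * N + l = i' * N"
        by (auto simp: I_def)
      then show ?thesis
      proof cases
        case 1
        then have "(i * N + l) div N = ((N - 1) * N + l') div N" by simp
        then show ?thesis using 1(2) \<open>l < N\<close> N by auto
      next
        case 2
        then have "(i * N + l) mod N = (i' * N) mod N" by simp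
        then show ?thesis using \<open>l < N\<close> by auto
      qed
    qed
    moreover have "i * N + l \<in> I" if "i = N - 1 \<or> l = 0"
      using that \<open>i < N\<close> \<open>l < N\<close> unfolding I_def by (cases "i = N - 1") auto
    ultimately show ?thesis by blast
  qed
  have sub: "I \<subseteq> {..<N^2}"
  proof
    fix k assume "k \<in> I"
    then consider l where "k = (N - 1) * N + l" "l < N" | i where "k = i * N" "i < N - 1"
      by (auto simp: I_def)
    then obtain i l where k: "k = i * N + l" "i < N" "l < N"
      using N by cases (auto intro: that[of "N - 1"] that[of _ 0])
    then have "i * N \<le> (N - 1) * N" by (intro mult_le_mono1) auto
    then have "i * N + l < (N - 1) * N + N" using k(3) by (rule add_le_less_mono)
    moreover have "(N - 1) * N + N = N^2" using N by (cases N) (auto simp: power2_eq_square)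
    ultimately show "k \<in> {..<N^2}" using k(1) by simp
  qed
  have row: "Adag_app N p a = p (a * N)" if "\<forall>i. i \<notin> I \<longrightarrow> p i = 0" "a < N - 1" for p a
  proof -
    have "Adag_app N p a = (\<Sum>l<N. if l = 0 then p (a * N) else 0)"
      unfolding Adag_app_row[OF that(2)]
    proof (rule sum.cong)
      fix l assume "l \<in> {..<N}"
      then show "p (a * N + l) = (if l = 0 then p (a * N) else 0)" using that mem[of a l] by auto
    qed simp
    then show ?thesis using N by simp
  qed
  have col: "Adag_app N p (N - 1 + b) = p ((N - 1) * N + b)"
    if "\<forall>i. i \<notin> I \<longrightarrow> p i = 0" "b < N" "b > 0" for p b
  proof -
    have "Adag_app N p (N - 1 + b) = (\<Sum>i<N. if i = N - 1 then p ((N - 1) * N + b) else 0)"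
      unfolding Adag_app_col[OF that(2)]
    proof (rule sum.cong)
      fix i assume "i \<in> {..<N}"
      then show "p (i * N + b) = (if i = N - 1 then p ((N - 1) * N + b) else 0)"
        using that mem[of i b] by auto
    qed simp
    then show ?thesis using N by simp
  qed
  have col0: "Adag_app N p (N - 1) = p ((N - 1) * N) + (\<Sum>i<N - 1. p (i * N))" for p
  proof -
    have "{..<N} = insert (N - 1) {..<N - 1}" using N by auto
    then show ?thesis using Adag_app_col[of 0 N p] N by simp
  qed
  show "ot_is_basis N I"
  proof (rule ot_is_basisI[OF sub])
    have "(N - 1) * N + l \<noteq> i * N" if "l < N" "i < N - 1" for l i
    proof -
      have "i * N < (N - 1) * N" using that by (intro mult_strict_right_mono) auto
      then show ?thesis by linarith
    qed
    then have "(\<lambda>l. (N - 1) * N + l) ` {..<N} \<inter> (\<lambda>i. i * N) ` {..<N - 1} = {}" by blast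
    then show "card I = 2 * N - 1" unfolding I_def using N
      by (subst card_Un_disjoint) (auto simp: card_image inj_on_def)
  next
    fix e assume e: "e < 2 * N - 1"
    let ?v = "\<lambda>a. if a = e then 1 else 0 :: real"
    define p where "p k = (if k \<notin> I then 0 else if k div N < N - 1 then ?v (k div N)
       else if k mod N = 0 then ?v (N - 1) - (\<Sum>a<N - 1. ?v a) else ?v (N - 1 + k mod N))" for k
    have off: "\<forall>i. i \<notin> I \<longrightarrow> p i = 0" by (simp add: p_def)
    have pr: "p (a * N) = ?v a" if "a < N - 1" for a
      using mem[of a 0] that N by (simp add: p_def)
    have "Adag_app N p a = ?v a" if a: "a < 2 * N - 1" for a
    proof -
      consider "a < N - 1" | "a = N - 1" | b where "a = N - 1 + b" "b > 0" "b < N"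
      proof -
        assume *: thesis if "a < N - 1"
        assume **: thesis if "a = N - 1"
        assume ***: "\<And>b. a = N - 1 + b \<Longrightarrow> 0 < b \<Longrightarrow> b < N \<Longrightarrow> thesis"
        consider "a < N - 1" | "a = N - 1" | "a > N - 1" by linarith
        then show thesis
          by cases (use * ** ***[of "a - (N - 1)"] a in auto)
      qed
      then show ?thesis
      proof cases
        case 1 then show ?thesis using row[OF off] pr by simp
      next
        case 2
        have "(\<Sum>i<N - 1. p (i * N)) = (\<Sum>i<N - 1. ?v i)" using pr by (intro sum.cong) auto
        moreover have "p ((N - 1) * N) = ?v (N - 1) - (\<Sum>a<N - 1. ?v a)"
          using mem[of "N - 1" 0] N by (simp add: p_def)
        ultimately show ?thesis unfolding 2 col0 by simp
      next
        case 3
        then have "Adag_app N p a = p ((N - 1) * N + b)" using col[OF off, of b] by simp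
        also have "\<dots> = ?v (N - 1 + b)" using mem[of "N - 1" b] N 3 by (simp add: p_def)
        finally show ?thesis using 3 by simp
      qed
    qed
    with off show "\<exists>p. (\<forall>i. i \<notin> I \<longrightarrow> p i = 0) \<and> (\<forall>a<2 * N - 1. Adag_app N p a = ?v a)" by blast
  next
    fix p :: "nat \<Rightarrow> real" assume off: "\<forall>i. i \<notin> I \<longrightarrow> p i = 0" and ker: "\<forall>a<2 * N - 1. Adag_app N p a = 0"
    have r0: "p (i * N) = 0" if "i < N - 1" for i using row[OF off that] ker that by auto
    have c0: "p ((N - 1) * N + l) = 0" if "l < N" for l
    proof (cases "l = 0")
      case True
      have "N - 1 < 2 * N - 1" using N by simp
      then show ?thesis using True col0[of p] ker r0 by simp
    next
      case False
      then show ?thesis using col[OF off, of l] ker that by auto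
    qed
    show "\<forall>i. p i = 0"
    proof
      fix i show "p i = 0" using off r0 c0 by (cases "i \<in> I") (auto simp: I_def)
    qed
  qed
qed

section \<open>Pivoting, crossover and existence of optimal bases\<close>

text \<open>A pivot never runs along an unbounded ray: \<open>y\<close> has the same marginals as a
  unit mass at cell \<open>j\<close>, hence total mass 1, hence a positive entry. The explicit form
  of the new solution is what allows costs to be compared.\<close>

lemma ratio_test:
  assumes I: "ot_is_basis N I" and j: "j \<notin> I" "j < N^2"
    and feas: "\<And>k. 0 \<le> basic_sol N I v k"
  defines "y \<equiv> basic_sol N I (\<lambda>a. Adag_entry N a j)"
  obtains i where "i \<in> I" "y i > 0" "ot_is_basis N (insert j (I - {i}))"
    and "basic_sol N (insert j (I - {i})) v
          = (\<lambda>k. basic_sol N I v k + basic_sol N I v i / y i * ((if k = j then 1 else 0) - y k))"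
    and "\<And>k. 0 \<le> basic_sol N (insert j (I - {i})) v k"
proof -
  note D = ot_is_basisD[OF I]
  let ?x = "basic_sol N I v"
  have yA: "Adag_app N y a = Adag_entry N a j" if "a < 2 * N - 1" for a
    using that by (simp add: y_def Adag_app_basic_sol[OF I])
  have y0: "y k = 0" if "k \<notin> I" for k using that by (simp add: y_def basic_sol_off)
  have "(\<Sum>k<N^2. y k) = 1"
    unfolding sum_eq_Adag_app using Adag_column_mass[OF j(2)] yA by (simp add: mult.commute)
  then have "\<exists>k\<in>{..<N^2}. y k > 0"
    by (metis not_one_le_zero sum_nonpos linorder_not_less)
  then obtain k0 where k0: "k0 \<in> I" "y k0 > 0" using y0 by force
  let ?C = "{k\<in>I. y k > 0}"
  have C: "finite ?C" "?C \<noteq> {}" using D(1) k0 by auto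
  obtain i where i: "i \<in> ?C" "\<And>k. k \<in> ?C \<Longrightarrow> ?x i / y i \<le> ?x k / y k"
  proof -
    have "Min ((\<lambda>k. ?x k / y k) ` ?C) \<in> (\<lambda>k. ?x k / y k) ` ?C" using C by (intro Min_in) auto
    then obtain i where "i \<in> ?C" "Min ((\<lambda>k. ?x k / y k) ` ?C) = ?x i / y i" by auto
    then show ?thesis using C by (intro that[of i]) (auto intro: Min_le simp flip: \<open>Min _ = _\<close>)
  qed
  define t where "t = ?x i / y i"
  let ?J = "insert j (I - {i})"
  let ?z = "\<lambda>k. ?x k + t * ((if k = j then 1 else 0) - y k)"
  have J: "ot_is_basis N ?J" using basis_exchange[OF I _ j, of i] i(1) by (simp add: y_def)
  have eq: "?z = basic_sol N ?J v"
  proof (rule basic_sol_unique[OF J])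
    show "?z k = 0" if "k \<notin> ?J" for k
      using that i(1) y0 j by (cases "k = i") (auto simp: t_def basic_sol_off)
    show "Adag_app N ?z a = v a" if "a < 2 * N - 1" for a
      unfolding Adag_app_add Adag_app_scale Adag_app_diff Adag_app_indicator[OF j(2)]
      using that by (simp add: yA Adag_app_basic_sol[OF I])
  qed
  have t0: "t \<ge> 0" using feas i(1) by (simp add: t_def)
  have "?z k \<ge> 0" for k
  proof (cases "y k > 0")
    case True
    then have "k \<in> I" using y0[of k] by auto
    then have "t * y k \<le> ?x k" using i(2)[of k] True by (simp add: t_def pos_le_divide_eq)
    then show ?thesis using j \<open>k \<in> I\<close> by auto
  next
    case False
    then show ?thesis using feas[of k] t0 by (intro add_nonneg_nonneg mult_nonneg_nonneg) auto
  qed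
  then show ?thesis using that[of i] i(1) J eq unfolding t_def by simp
qed

text \<open>The crossover induction pushes the mass of a feasible point into the basis, one index at a time.\<close>
lemma feasible_basis_exists_aux:
  assumes "ot_is_basis N I" "\<And>k. 0 \<le> p k" "\<And>k. k \<ge> N^2 \<Longrightarrow> p k = 0"
    and "\<And>a. a < 2 * N - 1 \<Longrightarrow> Adag_app N p a = v a"
  shows "\<exists>I. ot_is_basis N I \<and> (\<forall>k. 0 \<le> basic_sol N I v k)"
  using assms
proof (induction "card {k. p k \<noteq> 0 \<and> k \<notin> I}" arbitrary: p I rule: less_induct)
  case less
  note I = less.prems(1) and p_ge = less.prems(2) and p_off = less.prems(3) and p_sol = less.prems(4)
  let ?S = "\<lambda>p I. {k. p k \<noteq> (0::real) \<and> k \<notin> I}"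
  have sub: "?S p I \<subseteq> {..<N^2}" using p_off by (force simp: not_le[symmetric])
  then have finS: "finite (?S p I)" by (rule finite_subset) auto
  show ?case
  proof (cases "?S p I = {}")
    case True
    then have "p = basic_sol N I v" using p_sol by (intro basic_sol_unique[OF I]) auto
    then show ?thesis using I p_ge by metis
  next
    case False
    then obtain j where j: "p j \<noteq> 0" "j \<notin> I" by auto
    then have jN: "j < N^2" using p_off leI by blast
    note D = ot_is_basisD[OF I]
    define y where "y = basic_sol N I (\<lambda>a. Adag_entry N a j)"
    have y0: "y k = 0" if "k \<notin> I" for k using that by (simp add: y_def basic_sol_off)
    \<comment> \<open>\<open>q t\<close> moves mass \<open>t\<close> from cell \<open>j\<close> into
      the basis cells. The marginals do not change, because \<open>y\<close> has those of a unit
      mass at \<open>j\<close>.\<close>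
    define q where "q t k = p k - t * ((if k = j then 1 else 0) - y k)" for t k
    have qA: "Adag_app N (q t) a = v a" if "a < 2 * N - 1" for a t
      unfolding q_def Adag_app_diff Adag_app_scale Adag_app_indicator[OF jN]
      using that by (simp add: y_def Adag_app_basic_sol[OF I] p_sol)
    have q_off: "q t k = 0" if "k \<ge> N^2" for k t
    proof -
      have "k \<notin> I" "k \<noteq> j" using that D(2) jN by auto
      then show ?thesis using that p_off y0 by (simp add: q_def)
    qed
    have q_out: "q t k = p k" if "k \<notin> I" "k \<noteq> j" for t k using that y0 by (simp add: q_def)
    let ?C = "{k\<in>I. y k < 0}"
    have finC: "finite ?C" using D(1) by auto
    have step: ?thesis if t: "0 \<le> t" "t \<le> p j" and tC: "\<And>k. k \<in> ?C \<Longrightarrow> t * (- y k) \<le> p k"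
      and J: "ot_is_basis N J" and less: "?S (q t) J \<subset> ?S p I" for t J
    proof (rule less.hyps[OF _ J])
      show "card (?S (q t) J) < card (?S p I)" using less finS by (rule psubset_card_mono[rotated])
      show "0 \<le> q t k" for k
      proof (cases "k = j")
        case True then show ?thesis using t y0 j by (simp add: q_def)
      next
        case False
        show ?thesis
        proof (cases "y k < 0")
          case True
          then have "k \<in> ?C" using y0 by force
          then show ?thesis using tC[of k] False by (simp add: q_def)
        qed (use False p_ge[of k] t in \<open>auto simp: q_def\<close>)
      qed
    qed (use q_off qA in auto)
    show ?thesis
    \<comment> \<open>If cell \<open>j\<close> is emptied before any basis cell with negative
      \<open>y\<close>, all of \<open>p j\<close> is moved and \<open>I\<close> is kept. Otherwise
      the first basis cell to be exhausted leaves the basis in favour of \<open>j\<close>. In both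
      cases \<open>j\<close> drops out of the counted set and nothing enters it.\<close>
    proof (cases "\<exists>k\<in>?C. p k / (- y k) < p j")
      case False
      have "?S (q (p j)) I \<subset> ?S p I"
      proof
        show "?S (q (p j)) I \<subseteq> ?S p I"
        proof
          fix k assume k: "k \<in> ?S (q (p j)) I"
          then have "k \<noteq> j" using y0 j by (auto simp: q_def)
          then show "k \<in> ?S p I" using k q_out by auto
        qed
        have "j \<notin> ?S (q (p j)) I" using y0 j by (auto simp: q_def)
        then show "?S (q (p j)) I \<noteq> ?S p I" using j by blast
      qed
      then show ?thesis
      proof (intro step[OF _ _ _ I])
        fix k assume k: "k \<in> ?C"
        then have "p j \<le> p k / (- y k)" using False by force
        moreover have "- y k > 0" using k by simp
        ultimately show "p j * (- y k) \<le> p k" by (simp only: pos_le_divide_eq)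
      qed (use p_ge in auto)
    next
      case True
      then have Cne: "?C \<noteq> {}" by blast
      let ?f = "\<lambda>k. p k / (- y k)"
      have "Min (?f ` ?C) \<in> ?f ` ?C" using finC Cne by (intro Min_in) auto
      then obtain i where i: "i \<in> ?C" "Min (?f ` ?C) = ?f i" by auto
      have imin: "?f i \<le> ?f k" if "k \<in> ?C" for k
        unfolding i(2)[symmetric] using finC that by (intro Min_le) auto
      have i': "i \<in> I" "i \<noteq> j" "y i < 0" using i(1) j by auto
      let ?J = "insert j (I - {i})"
      have J: "ot_is_basis N ?J" using i' j jN by (intro basis_exchange[OF I]) (auto simp: y_def)
      have qi: "q (?f i) i = 0" using i' by (simp add: q_def)
      have "?S (q (?f i)) ?J \<subset> ?S p I"
      proof
        show "?S (q (?f i)) ?J \<subseteq> ?S p I"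
        proof
          fix k assume k: "k \<in> ?S (q (?f i)) ?J"
          then have "k \<noteq> i" "k \<noteq> j" using qi by auto
          then show "k \<in> ?S p I" using k q_out by auto
        qed
        have "j \<notin> ?S (q (?f i)) ?J" by simp
        then show "?S (q (?f i)) ?J \<noteq> ?S p I" using j by blast
      qed
      then show ?thesis
      proof (intro step[OF _ _ _ J])
        show "0 \<le> ?f i" using p_ge i' by (intro divide_nonneg_nonneg) auto
        show "?f i \<le> p j" using True imin by force
        fix k assume k: "k \<in> ?C"
        then have "?f i \<le> p k / (- y k)" by (rule imin)
        moreover have "- y k > 0" using k by simp
        ultimately show "?f i * (- y k) \<le> p k" by (simp only: pos_le_divide_eq)
      qed
    qed
  qed
qed

lemma feasible_basis_exists:
  assumes "N \<ge> 1" "\<And>k. 0 \<le> p k" "\<And>k. k \<ge> N^2 \<Longrightarrow> p k = 0"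
    and "\<And>a. a < 2 * N - 1 \<Longrightarrow> Adag_app N p a = v a"
  shows "\<exists>I. ot_is_basis N I \<and> (\<forall>k. 0 \<le> basic_sol N I v k)"
  using feasible_basis_exists_aux[OF _ assms(2-4)] basis_exists[OF assms(1)] by blast

lemma finite_bases: "finite {I. ot_is_basis N I}"
  by (rule finite_subset[of _ "Pow {..<N^2}"]) (auto dest: ot_is_basisD(2))

text \<open>No rule against cycling is involved: a cheapest feasible basis exists because there are
  finitely many. Nondegeneracy makes the step length of every pivot positive, so a negative reduced
  cost would lead to a cheaper feasible basis.\<close>

lemma optimal_basis_nondegenerate:
  assumes ex: "\<exists>I. ot_is_basis N I \<and> (\<forall>k. 0 \<le> basic_sol N I v k)"
    and nondeg: "\<And>I i. ot_is_basis N I \<Longrightarrow> i \<in> I \<Longrightarrow> basic_sol N I v i \<noteq> 0"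
  shows "\<exists>I. dual_feasible N c I \<and> (\<forall>k. 0 \<le> basic_sol N I v k)"
proof -
  define F where "F = {I. ot_is_basis N I \<and> (\<forall>k. 0 \<le> basic_sol N I v k)}"
  define cost where "cost I = (\<Sum>j<N^2. c j * basic_sol N I v j)" for I
  have F: "finite F" "F \<noteq> {}" using ex finite_subset[OF _ finite_bases[of N], of F] by (auto simp: F_def)
  have "Min (cost ` F) \<in> cost ` F" using F by (intro Min_in) auto
  then obtain I where I: "I \<in> F" "Min (cost ` F) = cost I" by auto
  have min: "cost I \<le> cost J" if "J \<in> F" for J
    unfolding I(2)[symmetric] using F that by (intro Min_le) auto
  have bas: "ot_is_basis N I" and feas: "\<And>k. 0 \<le> basic_sol N I v k" using I(1) by (auto simp: F_def)
  have "(\<Sum>a<2 * N - 1. Adag_entry N a j * dual_sol N c I a) \<le> c j" if jN: "j < N^2" for j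
  proof (cases "j \<in> I")
    case True
    then show ?thesis using dual_sol_tight[OF bas True] by simp
  next
    case False
    define y where "y = basic_sol N I (\<lambda>a. Adag_entry N a j)"
    obtain i where i: "i \<in> I" "y i > 0" and J: "ot_is_basis N (insert j (I - {i}))"
      and eq: "basic_sol N (insert j (I - {i})) v
          = (\<lambda>k. basic_sol N I v k + basic_sol N I v i / y i * ((if k = j then 1 else 0) - y k))"
      and Jf: "\<And>k. 0 \<le> basic_sol N (insert j (I - {i})) v k"
      using ratio_test[OF bas False jN feas] unfolding y_def by blast
    define t where "t = basic_sol N I v i / y i"
    have t: "t > 0" using feas[of i] nondeg[OF bas i(1)] i(2) by (simp add: t_def)
    \<comment> \<open>The coefficient of \<open>t\<close> is the reduced cost of cell
      \<open>j\<close>: by \<open>cost_basic_sol\<close> the cost of \<open>y\<close> is the value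
      that the dual solution assigns to column \<open>j\<close>.\<close>
    have "cost (insert j (I - {i})) = cost I + t * (c j - (\<Sum>k<N^2. c k * y k))"
      unfolding cost_def eq t_def[symmetric]
    proof -
      have "c k * (basic_sol N I v k + t * ((if k = j then 1 else 0) - y k))
        = c k * basic_sol N I v k + t * (c k * (if k = j then 1 else 0)) - t * (c k * y k)" for k
        by (simp add: algebra_simps)
      then have "(\<Sum>k<N^2. c k * (basic_sol N I v k + t * ((if k = j then 1 else 0) - y k)))
        = (\<Sum>k<N^2. c k * basic_sol N I v k) + t * (\<Sum>k<N^2. c k * (if k = j then 1 else 0)) - t * (\<Sum>k<N^2. c k * y k)"
        by (simp only: sum.distrib sum_subtractf sum_distrib_left)
      also have "(\<Sum>k<N^2. c k * (if k = j then 1 else 0)) = c j"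
        using jN by (simp add: if_distrib[where f="\<lambda>x. _ * x"] cong: if_cong)
      finally show "(\<Sum>k<N^2. c k * (basic_sol N I v k + t * ((if k = j then 1 else 0) - y k)))
        = (\<Sum>k<N^2. c k * basic_sol N I v k) + t * (c j - (\<Sum>k<N^2. c k * y k))" by (simp add: algebra_simps)
    qed
    moreover have "cost I \<le> cost (insert j (I - {i}))" using J Jf by (intro min) (simp add: F_def)
    ultimately have "0 \<le> c j - (\<Sum>k<N^2. c k * y k)" using t by (simp add: zero_le_mult_iff)
    then show ?thesis unfolding y_def cost_basic_sol[OF bas] by (simp add: mult.commute)
  qed
  then show ?thesis using bas feas by (auto simp: dual_feasible_def)
qed

lemma eventually_polynomial_nonzero:
  fixes a :: "nat \<Rightarrow> real"
  assumes "k \<le> n" "a k \<noteq> 0"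
  shows "eventually (\<lambda>x. (\<Sum>i\<le>n. a i * x ^ i) \<noteq> 0) (at_right 0)"
proof -
  have "finite {x. (\<Sum>i\<le>n. a i * x ^ i) = 0}" using polyfun_finite_roots[of a n] assms by blast
  then have "finite ({x. (\<Sum>i\<le>n. a i * x ^ i) = 0} - {0})" by simp
  then have "open (- ({x. (\<Sum>i\<le>n. a i * x ^ i) = 0} - {0}))" by (intro open_Compl finite_imp_closed)
  then have "eventually (\<lambda>x. x \<in> - ({x. (\<Sum>i\<le>n. a i * x ^ i) = 0} - {0})) (nhds 0)"
    by (intro eventually_nhds_in_open) auto
  then show ?thesis unfolding eventually_at_filter by eventually_elim auto
qed

text \<open>Adding \<open>\<epsilon> ^ (j + 1)\<close> times the \<open>j\<close>-th column for every \<open>j\<close> makes all bases nondegenerate for small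
  \<open>\<epsilon> > 0\<close>: the \<open>i\<close>-th coordinate of a basic solution becomes a polynomial in \<open>\<epsilon>\<close> in which
  \<open>\<epsilon> ^ (i + 1)\<close> has coefficient 1.\<close>
lemma optimal_basis_exists:
  assumes N: "N \<ge> 1" and p: "\<And>k. 0 \<le> p k" "\<And>k. k \<ge> N^2 \<Longrightarrow> p k = 0"
    and sol: "\<And>a. a < 2 * N - 1 \<Longrightarrow> Adag_app N p a = v a"
  shows "\<exists>I. dual_feasible N c I \<and> (\<forall>k. 0 \<le> basic_sol N I v k)"
proof -
  define w where "w e a = v a + (\<Sum>j<N^2. e ^ Suc j * Adag_entry N a j)" for e a
  define co where "co I i k = (if k = 0 then basic_sol N I v i else
      basic_sol N I (\<lambda>a. Adag_entry N a (k - 1)) i)" for I i k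
  have w: "basic_sol N I (w e) i = (\<Sum>k\<le>N^2. co I i k * e ^ k)" for I e i
  proof -
    have "basic_sol N I (w e) i = basic_sol N I v i + (\<Sum>j<N^2. e ^ Suc j * basic_sol N I (\<lambda>a. Adag_entry N a j) i)"
      unfolding w_def basic_sol_add basic_sol_sum basic_sol_scale ..
    also have "\<dots> = (\<Sum>k\<le>N^2. co I i k * e ^ k)"
      by (simp add: sum.atMost_shift co_def mult.commute)
    finally show ?thesis .
  qed
  have "eventually (\<lambda>e. \<forall>I\<in>{I. ot_is_basis N I}. \<forall>i\<in>{..<N^2}. i \<in> I \<longrightarrow> basic_sol N I (w e) i \<noteq> 0) (at_right 0)"
  proof (intro eventually_ball_finite finite_bases ballI)
    fix I i assume "I \<in> {I. ot_is_basis N I}" and iN: "i \<in> {..<N^2}"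
    then have I: "ot_is_basis N I" by simp
    show "eventually (\<lambda>e. i \<in> I \<longrightarrow> basic_sol N I (w e) i \<noteq> 0) (at_right 0)"
    proof (cases "i \<in> I")
      case True
      have "co I i (Suc i) \<noteq> 0" using basic_sol_column[OF I True] by (simp add: co_def)
      then show ?thesis unfolding w using True iN
        by (intro eventually_mono[OF eventually_polynomial_nonzero[of "Suc i" "N^2" "co I i"]]) auto
    qed simp
  qed auto
  \<comment> \<open>A negative coordinate at \<open>v\<close> stays negative for small
    \<open>e\<close>. Read backwards, a basis that is feasible for \<open>w e\<close> is feasible
    for \<open>v\<close>.\<close>
  moreover have "eventually (\<lambda>e. \<forall>I\<in>{I. ot_is_basis N I}. \<forall>i\<in>{..<N^2}.
       basic_sol N I v i < 0 \<longrightarrow> basic_sol N I (w e) i < 0) (at_right 0)"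
  proof (intro eventually_ball_finite finite_bases ballI)
    fix I i assume "I \<in> {I. ot_is_basis N I}" and iN: "i \<in> {..<N^2}"
    have "((\<lambda>e. basic_sol N I (w e) i) \<longlongrightarrow> (\<Sum>k\<le>N^2. co I i k * 0 ^ k)) (at_right 0)"
      unfolding w by (intro tendsto_intros)
    also have "(\<Sum>k\<le>N^2. co I i k * 0 ^ k) = basic_sol N I v i"
      by (simp add: sum.atMost_shift co_def)
    finally show "eventually (\<lambda>e. basic_sol N I v i < 0 \<longrightarrow> basic_sol N I (w e) i < 0) (at_right 0)"
      by (cases "basic_sol N I v i < 0") (auto dest: order_tendstoD(2))
  qed auto
  moreover have "eventually (\<lambda>e::real. e > 0) (at_right 0)" by (rule eventually_at_right_less)
  ultimately have "eventually (\<lambda>e. (\<forall>I\<in>{I. ot_is_basis N I}. \<forall>i\<in>{..<N^2}. i \<in> I \<longrightarrow> basic_sol N I (w e) i \<noteq> 0)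
     \<and> (\<forall>I\<in>{I. ot_is_basis N I}. \<forall>i\<in>{..<N^2}. basic_sol N I v i < 0 \<longrightarrow> basic_sol N I (w e) i < 0) \<and> e > 0) (at_right 0)"
    by eventually_elim blast
  from eventually_happens'[OF trivial_limit_at_right_real this]
  obtain e where nd': "\<forall>I\<in>{I. ot_is_basis N I}. \<forall>i\<in>{..<N^2}. i \<in> I \<longrightarrow> basic_sol N I (w e) i \<noteq> 0"
    and neg': "\<forall>I\<in>{I. ot_is_basis N I}. \<forall>i\<in>{..<N^2}. basic_sol N I v i < 0 \<longrightarrow> basic_sol N I (w e) i < 0"
    and e: "e > 0"
    by (elim exE conjE)
  have nd: "basic_sol N I (w e) i \<noteq> 0" if "ot_is_basis N I" "i < N^2" "i \<in> I" for I i
    using nd' that by blast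
  have neg: "basic_sol N I (w e) i < 0" if "ot_is_basis N I" "i < N^2" "basic_sol N I v i < 0" for I i
    using neg' that by blast
  have "\<exists>I. ot_is_basis N I \<and> (\<forall>k. 0 \<le> basic_sol N I (w e) k)"
  proof (rule feasible_basis_exists[OF N])
    let ?p = "\<lambda>k. p k + (if k < N^2 then e ^ Suc k else 0)"
    show "0 \<le> ?p k" for k using p(1)[of k] e by auto
    show "?p k = 0" if "k \<ge> N^2" for k using p(2)[OF that] that by simp
    show "Adag_app N ?p a = w e a" if "a < 2 * N - 1" for a
      unfolding Adag_app_add sol[OF that] w_def by (simp add: Adag_app_def mult.commute)
  qed
  moreover have "basic_sol N I (w e) i \<noteq> 0" if "ot_is_basis N I" "i \<in> I" for I i
    using nd[OF that(1) _ that(2)] ot_is_basisD(2)[OF that(1)] that(2) by auto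
  ultimately obtain I where I: "dual_feasible N c I" "\<And>k. 0 \<le> basic_sol N I (w e) k"
    using optimal_basis_nondegenerate by metis
  have bas: "ot_is_basis N I" using I(1) by (simp add: dual_feasible_def)
  have "0 \<le> basic_sol N I v k" for k
  proof (cases "k < N^2")
    case True
    then show ?thesis using neg[OF bas True] I(2)[of k] by linarith
  next
    case False
    then have "k \<notin> I" using ot_is_basisD(2)[OF bas] by auto
    then show ?thesis by (simp add: basic_sol_off)
  qed
  then show ?thesis using I(1) by blast
qed

section \<open>Optimality and uniqueness through duality\<close>

lemma dual_feasible_basic_sol_optimal:
  assumes I: "dual_feasible N c I" and feas: "\<And>k. 0 \<le> basic_sol N I (ot_marg N r s) k"
  shows "ot_optimal N c r s (basic_sol N I (ot_marg N r s))"
proof -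
  have bas: "ot_is_basis N I" using I by (simp add: dual_feasible_def)
  let ?x = "basic_sol N I (ot_marg N r s)" and ?l = "dual_sol N c I"
  have "?x \<in> vec_space (N^2)"
    using ot_is_basisD(2)[OF bas] by (auto simp: vec_space_def intro!: basic_sol_off)
  then have "ot_feasible N r s ?x" using feas by (simp add: ot_feasible_def Adag_app_basic_sol[OF bas])
  moreover have "(\<Sum>i<N^2. c i * ?x i) \<le> (\<Sum>i<N^2. c i * q i)" if "ot_feasible N r s q" for q
  proof -
    have "(\<Sum>i<N^2. c i * q i) = (\<Sum>a<2 * N - 1. ?l a * ot_marg N r s a)
     + (\<Sum>j<N^2. (c j - (\<Sum>a<2 * N - 1. Adag_entry N a j * ?l a)) * q j)"
      using that by (intro cost_eq_dual_plus_slack) (simp add: ot_feasible_def)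
    moreover have "0 \<le> (\<Sum>j<N^2. (c j - (\<Sum>a<2 * N - 1. Adag_entry N a j * ?l a)) * q j)"
      using that I by (intro sum_nonneg mult_nonneg_nonneg) (auto simp: ot_feasible_def dual_feasible_def)
    ultimately show ?thesis by (simp add: cost_basic_sol[OF bas])
  qed
  ultimately show ?thesis by (simp add: ot_optimal_def)
qed

text \<open>A tight constraint outside the basis could enter it by a ratio test without changing the dual solution.\<close>
lemma dual_strict_of_unique_dual_sol:
  assumes I: "dual_feasible N c I" and feas: "\<And>k. 0 \<le> basic_sol N I v k"
    and uniq: "\<And>J. dual_feasible N c J \<Longrightarrow> (\<And>k. 0 \<le> basic_sol N J v k) \<Longrightarrow> dual_sol N c J = dual_sol N c I \<Longrightarrow> J = I"
    and j: "j < N^2" "j \<notin> I"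
  shows "(\<Sum>a<2 * N - 1. Adag_entry N a j * dual_sol N c I a) < c j"
proof (rule ccontr)
  let ?l = "dual_sol N c I"
  assume "\<not> ?thesis"
  then have tight: "(\<Sum>a<2 * N - 1. Adag_entry N a j * ?l a) = c j"
    using I j by (force simp: dual_feasible_def)
  have bas: "ot_is_basis N I" using I by (simp add: dual_feasible_def)
  obtain i where i: "i \<in> I" and J: "ot_is_basis N (insert j (I - {i}))"
    and Jf: "\<And>k. 0 \<le> basic_sol N (insert j (I - {i})) v k"
  proof (rule ratio_test[OF bas j(2,1) feas])
    fix i assume "i \<in> I" "ot_is_basis N (insert j (I - {i}))" "\<And>k. 0 \<le> basic_sol N (insert j (I - {i})) v k"
    then show thesis by (rule that)
  qed
  have "?l = dual_sol N c (insert j (I - {i}))"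
  proof (rule dual_sol_unique[OF J])
    show "(\<Sum>a<2 * N - 1. Adag_entry N a k * ?l a) = c k" if "k \<in> insert j (I - {i})" for k
      using that tight dual_sol_tight[OF bas, of k c] by blast
    show "?l a = 0" if "a \<ge> 2 * N - 1" for a using that by (simp only: dual_sol_def not_less[symmetric] if_False)
  qed
  moreover from this have "dual_feasible N c (insert j (I - {i}))"
    using J I by (simp add: dual_feasible_def)
  ultimately have "insert j (I - {i}) = I" using uniq Jf by metis
  then show False using j by blast
qed

text \<open>The hypothesis \<open>strict\<close> depends on the cost and the basis but not on the
  marginals, so it can be established at the true marginals and used at the empirical ones.\<close>

lemma optimal_eq_basic_sol:
  assumes I: "dual_feasible N c I" and feas: "\<And>k. 0 \<le> basic_sol N I (ot_marg N r s) k"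
    and strict: "\<And>j. j < N^2 \<Longrightarrow> j \<notin> I \<Longrightarrow> (\<Sum>a<2 * N - 1. Adag_entry N a j * dual_sol N c I a) < c j"
    and p: "ot_optimal N c r s p"
  shows "p = basic_sol N I (ot_marg N r s)"
proof -
  have bas: "ot_is_basis N I" using I by (simp add: dual_feasible_def)
  let ?x = "basic_sol N I (ot_marg N r s)" and ?l = "dual_sol N c I"
  let ?g = "\<lambda>j. (c j - (\<Sum>a<2 * N - 1. Adag_entry N a j * ?l a)) * p j"
  have pf: "ot_feasible N r s p" using p by (simp add: ot_optimal_def)
  have "(\<Sum>i<N^2. c i * p i) = (\<Sum>a<2 * N - 1. ?l a * ot_marg N r s a) + (\<Sum>j<N^2. ?g j)"
    using pf by (intro cost_eq_dual_plus_slack) (simp add: ot_feasible_def)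
  moreover have "(\<Sum>i<N^2. c i * p i) \<le> (\<Sum>i<N^2. c i * ?x i)"
    using p dual_feasible_basic_sol_optimal[OF I feas] by (simp add: ot_optimal_def)
  ultimately have le: "(\<Sum>j<N^2. ?g j) \<le> 0" by (simp add: cost_basic_sol[OF bas])
  have nn: "0 \<le> ?g j" if "j \<in> {..<N^2}" for j
    using that pf I by (intro mult_nonneg_nonneg) (auto simp: ot_feasible_def dual_feasible_def)
  have "(\<Sum>j<N^2. ?g j) = 0" by (intro antisym le sum_nonneg nn)
  then have g0: "?g j = 0" if "j < N^2" for j
    using sum_nonneg_eq_0_iff[of "{..<N^2}" ?g] nn that by blast
  show ?thesis
  proof (rule basic_sol_unique[OF bas])
    show "p i = 0" if "i \<notin> I" for i
    proof (cases "i < N^2")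
      case True
      then show ?thesis using g0[OF True] strict[OF True that] by auto
    next
      case False
      then show ?thesis using pf by (simp add: ot_feasible_def vec_space_def)
    qed
    show "Adag_app N p a = ot_marg N r s a" if "a < 2 * N - 1" for a
      using pf that by (simp add: ot_feasible_def)
  qed
qed

section \<open>Convergence in distribution\<close>

text \<open>The three-epsilon argument shared by the continuous mapping theorem, the continuity
  theorem for vectors and the mixture theorem. The errors are bounded pointwise by functions whose
  expectations converge as well, so smallness has to be checked only for the limit
  \<open>w\<close>.\<close>

lemma integral_tendsto_approx:
  fixes fs :: "nat \<Rightarrow> 'a \<Rightarrow> real" and f :: "'b \<Rightarrow> real"
  assumes fs: "eventually (\<lambda>t. integrable M (fs t)) sequentially" and f: "integrable P f"
    and approx: "\<And>e. e > 0 \<Longrightarrow> \<exists>hs h ws w.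
        eventually (\<lambda>t. integrable M (hs t) \<and> integrable M (ws t) \<and>
            (\<forall>\<omega>\<in>space M. \<bar>fs t \<omega> - hs t \<omega>\<bar> \<le> ws t \<omega>)) sequentially \<and>
        integrable P h \<and> integrable P w \<and> (\<forall>\<omega>\<in>space P. \<bar>f \<omega> - h \<omega>\<bar> \<le> w \<omega>) \<and>
        (\<lambda>t. integral\<^sup>L M (hs t)) \<longlonglongrightarrow> integral\<^sup>L P h \<and>
        (\<lambda>t. integral\<^sup>L M (ws t)) \<longlonglongrightarrow> integral\<^sup>L P w \<and> integral\<^sup>L P w < e"
  shows "(\<lambda>t. integral\<^sup>L M (fs t)) \<longlonglongrightarrow> integral\<^sup>L P f"
proof (rule tendstoI)
  have bound: "\<bar>integral\<^sup>L Q a - integral\<^sup>L Q b\<bar> \<le> integral\<^sup>L Q w"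
    if "integrable Q a" "integrable Q b" "integrable Q w" "\<forall>x\<in>space Q. \<bar>a x - b x\<bar> \<le> w x"
    for Q :: "'c measure" and a b w :: "'c \<Rightarrow> real"
  proof -
    have "\<bar>integral\<^sup>L Q a - integral\<^sup>L Q b\<bar> = \<bar>\<integral>x. a x - b x \<partial>Q\<bar>" using that by simp
    also have "\<dots> \<le> (\<integral>x. \<bar>a x - b x\<bar> \<partial>Q)" by (rule integral_abs_bound)
    also have "\<dots> \<le> integral\<^sup>L Q w" using that by (intro integral_mono) auto
    finally show ?thesis .
  qed
  fix e :: real assume e: "e > 0"
  obtain hs h ws w where
      ev: "eventually (\<lambda>t. integrable M (hs t) \<and> integrable M (ws t) \<and>
            (\<forall>\<omega>\<in>space M. \<bar>fs t \<omega> - hs t \<omega>\<bar> \<le> ws t \<omega>)) sequentially"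
    and hw: "integrable P h" "integrable P w" "\<forall>\<omega>\<in>space P. \<bar>f \<omega> - h \<omega>\<bar> \<le> w \<omega>"
    and lim: "(\<lambda>t. integral\<^sup>L M (hs t)) \<longlonglongrightarrow> integral\<^sup>L P h"
       "(\<lambda>t. integral\<^sup>L M (ws t)) \<longlonglongrightarrow> integral\<^sup>L P w"
    and we: "integral\<^sup>L P w < e / 3"
    using approx[of "e / 3"] e by auto
  have "eventually (\<lambda>t. dist (integral\<^sup>L M (hs t)) (integral\<^sup>L P h) < e / 3) sequentially"
    using lim(1) e by (intro tendstoD) auto
  moreover have "eventually (\<lambda>t. integral\<^sup>L M (ws t) < e / 3) sequentially"
    using lim(2) we by (rule order_tendstoD)
  ultimately show "eventually (\<lambda>t. dist (integral\<^sup>L M (fs t)) (integral\<^sup>L P f) < e) sequentially"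
    using ev fs
  proof eventually_elim
    case (elim t)
    have "\<bar>integral\<^sup>L M (fs t) - integral\<^sup>L M (hs t)\<bar> \<le> integral\<^sup>L M (ws t)"
      using elim by (intro bound) auto
    moreover have "\<bar>integral\<^sup>L P f - integral\<^sup>L P h\<bar> \<le> integral\<^sup>L P w"
      using hw f by (intro bound) auto
    ultimately show ?case using elim(1,2) we unfolding dist_real_def by linarith
  qed
qed

lemma (in prob_space) integrable_bounded:
  fixes f :: "'a \<Rightarrow> real"
  assumes "f \<in> borel_measurable M" "\<And>x. x \<in> space M \<Longrightarrow> \<bar>f x\<bar> \<le> B"
  shows "integrable M f"
  using assms by (intro integrable_const_bound[of f B]) auto

lemma conv_distr_continuous:
  fixes f :: "'c::topological_space \<Rightarrow> real"
  assumes "conv_distr M Xs P X" "continuous_on UNIV f" "\<And>x. \<bar>f x\<bar> \<le> B"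
  shows "(\<lambda>t. \<integral>\<omega>. f (Xs t \<omega>) \<partial>M) \<longlonglongrightarrow> (\<integral>\<omega>. f (X \<omega>) \<partial>P)"
proof -
  have "bounded (range f)" using assms(3) by (intro boundedI[of _ B]) auto
  then show ?thesis using assms by (auto simp: conv_distr_def)
qed

text \<open>The function \<open>q\<close> witnesses the continuity points of \<open>g\<close>, so that
  \<open>g * min 1 (k * q)\<close> is continuous and increases to \<open>g\<close> almost surely.\<close>
lemma conv_distr_AE_continuous:
  fixes g q :: "'c::t2_space \<Rightarrow> real"
  assumes "prob_space M" "prob_space P" and conv: "conv_distr M Xs P X"
    and Xs: "eventually (\<lambda>t. Xs t \<in> borel_measurable M) sequentially" and X: "X \<in> borel_measurable P"
    and g: "g \<in> borel_measurable borel" "\<And>x. \<bar>g x\<bar> \<le> B"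
    and q: "continuous_on UNIV q" "\<And>x. 0 \<le> q x" and gq: "\<And>x. q x > 0 \<Longrightarrow> isCont g x"
    and pos: "AE \<omega> in P. q (X \<omega>) > 0"
  shows "(\<lambda>t. \<integral>\<omega>. g (Xs t \<omega>) \<partial>M) \<longlonglongrightarrow> (\<integral>\<omega>. g (X \<omega>) \<partial>P)"
proof (rule integral_tendsto_approx)
  interpret M: prob_space M by fact
  interpret P: prob_space P by fact
  note X[measurable] g(1)[measurable]
  have [measurable]: "q \<in> borel_measurable borel" using q(1) by (rule borel_measurable_continuous_onI)
  have B: "B \<ge> 0" using g(2)[of undefined] by linarith
  show "eventually (\<lambda>t. integrable M (\<lambda>\<omega>. g (Xs t \<omega>))) sequentially"
    using Xs by eventually_elim (rule M.integrable_bounded[of _ B], simp_all add: g)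
  show "integrable P (\<lambda>\<omega>. g (X \<omega>))" by (rule P.integrable_bounded[of _ B], simp_all add: g)
  fix e :: real assume e: "e > 0"
  define c where "c k x = min 1 (real k * q x)" for k x
  have c: "0 \<le> c k x" "c k x \<le> 1" for k x using q(2)[of x] by (auto simp: c_def)
  have c_cont: "continuous_on UNIV (c k)" for k unfolding c_def by (intro continuous_intros q(1))
  then have c_iso: "isCont (c k) x" for k x by (simp add: continuous_on_eq_continuous_at)
  have [measurable]: "c k \<in> borel_measurable borel" for k using c_cont by (rule borel_measurable_continuous_onI)
  have "(\<lambda>k. \<integral>\<omega>. B * (1 - c k (X \<omega>)) \<partial>P) \<longlonglongrightarrow> (\<integral>\<omega>. 0 \<partial>P)"
  proof (rule integral_dominated_convergence[where w="\<lambda>_. B"])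
    show "AE \<omega> in P. (\<lambda>k. B * (1 - c k (X \<omega>))) \<longlonglongrightarrow> 0"
      using pos
    proof eventually_elim
      case (elim \<omega>)
      have "eventually (\<lambda>k. real k \<ge> 1 / q (X \<omega>)) sequentially"
        using filterlim_real_sequentially unfolding filterlim_at_top by blast
      then have "eventually (\<lambda>k. B * (1 - c k (X \<omega>)) = 0) sequentially"
        by eventually_elim (use elim in \<open>auto simp: c_def field_simps min_def\<close>)
      then show ?case by (rule tendsto_eventually)
    qed
    show "AE \<omega> in P. norm (B * (1 - c k (X \<omega>))) \<le> B" for k
      using c[of k] B by (auto intro!: AE_I2 mult_left_le simp: abs_mult)
  qed auto
  then have "eventually (\<lambda>k. (\<integral>\<omega>. B * (1 - c k (X \<omega>)) \<partial>P) < e) sequentially"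
    using e by (auto dest: order_tendstoD)
  then obtain k where k: "(\<integral>\<omega>. B * (1 - c k (X \<omega>)) \<partial>P) < e" by (auto simp: eventually_sequentially)
  have bnd: "\<bar>B * (1 - c k x)\<bar> \<le> B" for x using c[of k x] B by (simp add: abs_mult mult_left_le)
  have bnd': "\<bar>g x * c k x\<bar> \<le> B" for x
    using mult_mono[OF g(2)[of x] c(2)[of k x]] c(1)[of k x] B by (simp add: abs_mult)
  have diff: "\<bar>g x - g x * c k x\<bar> \<le> B * (1 - c k x)" for x
  proof -
    have "\<bar>g x - g x * c k x\<bar> = \<bar>g x\<bar> * (1 - c k x)"
      using c(2)[of k x] by (simp add: abs_mult flip: right_diff_distrib[of "g x" 1, simplified])
    then show ?thesis using mult_right_mono[OF g(2)[of x], of "1 - c k x"] c(2)[of k x] by simp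
  qed
  have "isCont (\<lambda>x. g x * c k x) x" for x
  proof (cases "q x > 0")
    case True then show ?thesis by (intro isCont_mult gq c_iso)
  next
    case False
    then have cx: "c k x = 0" using q(2)[of x] by (simp add: c_def)
    \<comment> \<open>At a zero of \<open>q\<close> nothing is known about \<open>g\<close> except
      its bound; the cut-off factor squeezes the product to 0.\<close>
    have "((\<lambda>y. B * c k y) \<longlongrightarrow> 0) (at x)" using c_iso[of x k] cx
      by (auto simp: isCont_def intro!: tendsto_mult_right_zero)
    then have "((\<lambda>y. g y * c k y) \<longlongrightarrow> 0) (at x)"
      by (rule Lim_null_comparison[rotated])
         (use g(2) c(1)[of k] in \<open>auto intro!: always_eventually mult_right_mono simp: abs_mult\<close>)
    then show ?thesis using cx by (simp add: isCont_def)
  qed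
  then have gc: "continuous_on UNIV (\<lambda>x. g x * c k x)" by (simp add: continuous_on_eq_continuous_at)
  show "\<exists>hs h ws w.
        eventually (\<lambda>t. integrable M (hs t) \<and> integrable M (ws t) \<and>
            (\<forall>\<omega>\<in>space M. \<bar>g (Xs t \<omega>) - hs t \<omega>\<bar> \<le> ws t \<omega>)) sequentially \<and>
        integrable P h \<and> integrable P w \<and> (\<forall>\<omega>\<in>space P. \<bar>g (X \<omega>) - h \<omega>\<bar> \<le> w \<omega>) \<and>
        (\<lambda>t. integral\<^sup>L M (hs t)) \<longlonglongrightarrow> integral\<^sup>L P h \<and>
        (\<lambda>t. integral\<^sup>L M (ws t)) \<longlonglongrightarrow> integral\<^sup>L P w \<and> integral\<^sup>L P w < e"
  proof (rule exI[of _ "\<lambda>t \<omega>. g (Xs t \<omega>) * c k (Xs t \<omega>)"], rule exI[of _ "\<lambda>\<omega>. g (X \<omega>) * c k (X \<omega>)"],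
      rule exI[of _ "\<lambda>t \<omega>. B * (1 - c k (Xs t \<omega>))"], rule exI[of _ "\<lambda>\<omega>. B * (1 - c k (X \<omega>))"],
      intro conjI ballI k diff)
    show "eventually (\<lambda>t. integrable M (\<lambda>\<omega>. g (Xs t \<omega>) * c k (Xs t \<omega>)) \<and>
        integrable M (\<lambda>\<omega>. B * (1 - c k (Xs t \<omega>))) \<and>
            (\<forall>\<omega>\<in>space M. \<bar>g (Xs t \<omega>) - g (Xs t \<omega>) * c k (Xs t \<omega>)\<bar> \<le> B * (1 - c k (Xs t \<omega>)))) sequentially"
      using Xs
    proof eventually_elim
      case (elim t)
      note elim[measurable]
      show ?case by (intro conjI ballI diff M.integrable_bounded[of _ B] bnd bnd') measurable
    qed
    show "integrable P (\<lambda>\<omega>. g (X \<omega>) * c k (X \<omega>))"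
      by (rule P.integrable_bounded[of _ B, OF _ bnd']) measurable
    show "integrable P (\<lambda>\<omega>. B * (1 - c k (X \<omega>)))"
      by (rule P.integrable_bounded[of _ B, OF _ bnd]) measurable
    show "(\<lambda>t. \<integral>\<omega>. g (Xs t \<omega>) * c k (Xs t \<omega>) \<partial>M) \<longlonglongrightarrow> (\<integral>\<omega>. g (X \<omega>) * c k (X \<omega>) \<partial>P)"
      by (rule conv_distr_continuous[OF conv gc bnd'])
    show "(\<lambda>t. \<integral>\<omega>. B * (1 - c k (Xs t \<omega>)) \<partial>M) \<longlonglongrightarrow> (\<integral>\<omega>. B * (1 - c k (X \<omega>)) \<partial>P)"
      by (rule conv_distr_continuous[OF conv _ bnd]) (intro continuous_intros c_cont)
  qed
qed

text \<open>Convergence in distribution bounds \<open>h (Xs t)\<close> in probability. As soon as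
  \<open>l t\<close> exceeds \<open>k + 1\<close>, the event is dominated by the bounded continuous
  function \<open>c k\<close>, whose limit expectation is small for large \<open>k\<close>.\<close>

lemma conv_distr_escape:
  fixes h :: "'c::topological_space \<Rightarrow> real"
  assumes "prob_space M" "prob_space P" and conv: "conv_distr M Xs P X"
    and Xs[measurable]: "\<And>t. Xs t \<in> borel_measurable M" and X[measurable]: "X \<in> borel_measurable P"
    and h: "continuous_on UNIV h" and l: "filterlim l at_top sequentially"
  shows "(\<lambda>t. measure M {\<omega>\<in>space M. l t \<le> h (Xs t \<omega>)}) \<longlonglongrightarrow> 0"
proof (rule tendstoI)
  interpret M: prob_space M by fact
  interpret P: prob_space P by fact
  have [measurable]: "h \<in> borel_measurable borel" using h by (rule borel_measurable_continuous_onI)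
  fix e :: real assume e: "e > 0"
  define c where "c k x = min 1 (\<bar>h x\<bar> * inverse (real (Suc k)))" for k x
  have c: "\<bar>c k x\<bar> \<le> 1" "0 \<le> c k x" for k x by (auto simp: c_def)
  have c_cont: "continuous_on UNIV (c k)" for k unfolding c_def by (intro continuous_intros h) auto
  have [measurable]: "c k \<in> borel_measurable borel" for k using c_cont by (rule borel_measurable_continuous_onI)
  have "(\<lambda>k. \<integral>\<omega>. c k (X \<omega>) \<partial>P) \<longlonglongrightarrow> (\<integral>\<omega>. 0 \<partial>P)"
  proof (rule integral_dominated_convergence[where w="\<lambda>_. 1"])
    show "AE \<omega> in P. (\<lambda>k. c k (X \<omega>)) \<longlonglongrightarrow> 0"
    proof (rule AE_I2)
      fix \<omega>
      have "(\<lambda>k. min 1 (\<bar>h (X \<omega>)\<bar> * inverse (real (Suc k)))) \<longlonglongrightarrow> min 1 (\<bar>h (X \<omega>)\<bar> * 0)"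
        by (intro tendsto_intros LIMSEQ_inverse_real_of_nat)
      then show "(\<lambda>k. c k (X \<omega>)) \<longlonglongrightarrow> 0" by (simp add: c_def)
    qed
  qed (use c in auto)
  then have "eventually (\<lambda>k. (\<integral>\<omega>. c k (X \<omega>) \<partial>P) < e) sequentially"
    using e by (auto dest: order_tendstoD)
  then obtain k where k: "(\<integral>\<omega>. c k (X \<omega>) \<partial>P) < e" by (auto simp: eventually_sequentially)
  have "(\<lambda>t. \<integral>\<omega>. c k (Xs t \<omega>) \<partial>M) \<longlonglongrightarrow> (\<integral>\<omega>. c k (X \<omega>) \<partial>P)"
    by (rule conv_distr_continuous[OF conv c_cont c(1)])
  then have "eventually (\<lambda>t. (\<integral>\<omega>. c k (Xs t \<omega>) \<partial>M) < e) sequentially"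
    using k by (auto dest: order_tendstoD)
  moreover have "eventually (\<lambda>t. real (Suc k) \<le> l t) sequentially"
    using l by (simp add: filterlim_at_top)
  ultimately show "eventually (\<lambda>t. dist (measure M {\<omega>\<in>space M. l t \<le> h (Xs t \<omega>)}) 0 < e) sequentially"
  proof eventually_elim
    case (elim t)
    have "measure M {\<omega>\<in>space M. l t \<le> h (Xs t \<omega>)} = (\<integral>\<omega>. indicator {\<omega>\<in>space M. l t \<le> h (Xs t \<omega>)} \<omega> \<partial>M)"
      by simp
    also have "\<dots> \<le> (\<integral>\<omega>. c k (Xs t \<omega>) \<partial>M)"
      using elim(2) c
      by (intro integral_mono M.integrable_bounded[of _ 1])
         (auto simp: c_def indicator_def field_simps)
    finally show ?case using elim(1) by simp
  qed
qed

section \<open>Trigonometric sums and the continuity theorem for vectors\<close>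

text \<open>By the product-to-sum formula these functions form an algebra, and their expectations are governed
  by characteristic functions.\<close>
inductive_set trig_sums :: "nat \<Rightarrow> ((nat \<Rightarrow> real) \<Rightarrow> real) set" for d where
  trig_cos: "(\<lambda>x. a * cos ((\<Sum>i<d. u i * x i) + b)) \<in> trig_sums d"
| trig_add: "f \<in> trig_sums d \<Longrightarrow> g \<in> trig_sums d \<Longrightarrow> (\<lambda>x. f x + g x) \<in> trig_sums d"

lemma trig_sums_const: "(\<lambda>_. a) \<in> trig_sums d"
  using trig_cos[of a "\<lambda>_. 0" d 0] by simp

lemma trig_sums_sin:
  assumes "i < d" shows "(\<lambda>x. sin (w * x i)) \<in> trig_sums d"
proof -
  have "(\<Sum>j<d. (if j = i then w else 0) * x j) = w * x i" for x :: "nat \<Rightarrow> real"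
    using assms by (simp add: if_distrib[where f="\<lambda>z. z * _"] cong: if_cong)
  then show ?thesis
    using trig_cos[of 1 "\<lambda>j. if j = i then w else 0" d "- (pi / 2)"] by (simp add: cos_diff)
qed

lemma trig_sums_mult:
  assumes f: "f \<in> trig_sums d" and g: "g \<in> trig_sums d"
  shows "(\<lambda>x. f x * g x) \<in> trig_sums d"
  using f
proof induction
  case (trig_cos a u b)
  show ?case using g
  proof induction
    case (trig_cos a' u' b')
    have "a * cos ((\<Sum>i<d. u i * x i) + b) * (a' * cos ((\<Sum>i<d. u' i * x i) + b'))
       = a * a' / 2 * cos ((\<Sum>i<d. (u i - u' i) * x i) + (b - b'))
       + a * a' / 2 * cos ((\<Sum>i<d. (u i + u' i) * x i) + (b + b'))" for x
    proof -
      let ?A = "(\<Sum>i<d. u i * x i) + b" and ?B = "(\<Sum>i<d. u' i * x i) + b'"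
      have "(\<Sum>i<d. (u i - u' i) * x i) + (b - b') = ?A - ?B"
        "(\<Sum>i<d. (u i + u' i) * x i) + (b + b') = ?A + ?B"
        by (simp_all add: algebra_simps sum.distrib sum_subtractf)
      moreover have "a * cos ?A * (a' * cos ?B) = a * a' / 2 * cos (?A - ?B) + a * a' / 2 * cos (?A + ?B)"
        using cos_times_cos[of ?A ?B] by (simp add: field_simps)
      ultimately show ?thesis by (simp only:)
    qed
    then show ?case by (simp only:) (intro trig_sums.intros)
  qed (auto simp: distrib_left intro!: trig_sums.trig_add)
qed (auto simp: distrib_right intro!: trig_sums.trig_add)

lemma trig_sums_bounded_continuous:
  assumes "f \<in> trig_sums d"
  shows "\<exists>B. \<forall>x. \<bar>f x\<bar> \<le> B" "continuous_on UNIV f"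
proof -
  show "\<exists>B. \<forall>x. \<bar>f x\<bar> \<le> B" using assms
  proof induction
    case (trig_cos a u b)
    have "\<bar>a * cos ((\<Sum>i<d. u i * x i) + b)\<bar> \<le> \<bar>a\<bar>" for x :: "nat \<Rightarrow> real"
      by (simp add: abs_mult mult_left_le)
    then show ?case by blast
  next
    case (trig_add f g)
    then obtain A B where "\<forall>x. \<bar>f x\<bar> \<le> A" "\<forall>x. \<bar>g x\<bar> \<le> B" by auto
    then have "\<bar>f x + g x\<bar> \<le> A + B" for x using abs_triangle_ineq[of "f x" "g x"] by (meson add_mono order_trans)
    then show ?case by blast
  qed
  show "continuous_on UNIV f" using assms
    by induction (intro continuous_intros continuous_on_product_coordinates | simp)+
qed

text \<open>Tychonoff: in the product topology even the infinite-dimensional cube is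
  compact.\<close>

lemma compact_cube: "compact {y :: nat \<Rightarrow> real. (\<forall>i. \<bar>y i\<bar> \<le> 1)}"
proof -
  have "compactin (product_topology (\<lambda>_. euclidean) UNIV) (PiE UNIV (\<lambda>_::nat. {-1..1::real}))"
    by (subst compactin_PiE) auto
  moreover have "PiE UNIV (\<lambda>_::nat. {-1..1::real}) = {y. \<forall>i. \<bar>y i\<bar> \<le> 1}"
    by (auto simp: PiE_def Pi_def abs_le_iff minus_le_iff)
  ultimately show ?thesis by (simp add: euclidean_product_topology compactin_euclidean_iff)
qed

text \<open>The triangle wave \<open>x \<mapsto> (2 L / pi) arcsin (sin (pi x / (2 L)))\<close> is the identity on \<open>[-L, L]\<close>; composed with it,
  \<open>f\<close> becomes a continuous function of finitely many sines, hence a uniform limit of trigonometric sums.\<close>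
lemma trig_sums_dense:
  fixes f :: "(nat \<Rightarrow> real) \<Rightarrow> real"
  assumes f: "continuous_on UNIV f" and B: "\<And>x. \<bar>f x\<bar> \<le> B" and L: "L > 0" and e: "e > 0"
  shows "\<exists>g\<in>trig_sums d. \<forall>x. (\<forall>i\<ge>d. x i = 0) \<longrightarrow> \<bar>g x\<bar> \<le> B + e \<and> ((\<forall>i<d. \<bar>x i\<bar> \<le> L) \<longrightarrow> \<bar>f x - g x\<bar> \<le> e)"
proof -
  define w where "w = pi / (2 * L)"
  have w: "w > 0" using L by (simp add: w_def)
  \<comment> \<open>With the coordinates from \<open>d\<close> on frozen at 0, the first
    \<open>d\<close> coordinate functions separate the points of \<open>S\<close>.\<close>
  define S where "S = {y :: nat \<Rightarrow> real. (\<forall>i. \<bar>y i\<bar> \<le> 1)} \<inter> {y. \<forall>i\<ge>d. y i = 0}"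
  define sn where "sn x i = (if i < d then sin (w * x i) else 0)" for x :: "nat \<Rightarrow> real" and i
  define F where "F y = f (\<lambda>i. arcsin (y i) / w)" for y :: "nat \<Rightarrow> real"
  \<comment> \<open>The ring for Stone-Weierstrass: functions on the compact set \<open>S\<close>
    that become trigonometric sums once the sines are substituted.\<close>
  define R where "R = {h. continuous_on S h \<and> (\<lambda>x. h (sn x)) \<in> trig_sums d}"
  have "closed {y :: nat \<Rightarrow> real. i \<ge> d \<longrightarrow> y i = 0}" for i
    by (cases "i \<ge> d") (simp_all add: closed_Collect_eq continuous_on_product_coordinates)
  then have "closed {y :: nat \<Rightarrow> real. \<forall>i\<ge>d. y i = 0}" by (rule closed_Collect_all)
  then have "compact S"
    unfolding S_def by (intro compact_Int_closed compact_cube)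
  have coord: "continuous_on S (\<lambda>y. y i)" for i
    by (rule continuous_on_subset[OF continuous_on_product_coordinates]) simp
  from \<open>compact S\<close> interpret function_ring_on R S
  proof unfold_locales
    fix x y assume "x \<in> S" "y \<in> S" "x \<noteq> y"
    then obtain i where i: "x i \<noteq> y i" by (auto simp: fun_eq_iff)
    have "x i = y i" if "\<not> i < d" using that \<open>x \<in> S\<close> \<open>y \<in> S\<close> by (simp add: S_def)
    then have "i < d" using i by blast
    then have "(\<lambda>y. y i) \<in> R"
      using trig_sums_sin[of i d w] coord by (simp add: R_def sn_def)
    with i show "\<exists>f\<in>R. f x \<noteq> f y" by (intro bexI[of _ "\<lambda>y. y i"])
  next
    fix f g assume "f \<in> R" "g \<in> R"
    then have *: "continuous_on S f" "continuous_on S g"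
      "(\<lambda>x. f (sn x)) \<in> trig_sums d" "(\<lambda>x. g (sn x)) \<in> trig_sums d" by (simp_all add: R_def)
    show "(\<lambda>x. f x + g x) \<in> R"
      unfolding R_def mem_Collect_eq by (intro conjI continuous_on_add trig_sums.trig_add *)
    show "(\<lambda>x. f x * g x) \<in> R"
      unfolding R_def mem_Collect_eq by (intro conjI continuous_on_mult trig_sums_mult *)
  qed (simp_all add: R_def trig_sums_const)
  have Fc: "continuous_on S F"
    unfolding F_def
  proof (rule continuous_on_compose2[OF f])
    have "continuous_on S (\<lambda>y. arcsin (y i) / w)" for i
    proof (intro continuous_intros continuous_on_arcsin)
      show "continuous_on S (\<lambda>y. y i)" by (rule coord)
      show "\<forall>x\<in>S. - 1 \<le> x i \<and> x i \<le> 1" by (auto simp: S_def abs_le_iff minus_le_iff)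
    qed (use w in auto)
    then show "continuous_on S (\<lambda>y i. arcsin (y i) / w)" by (rule continuous_on_coordinatewise_then_product)
  qed simp
  obtain h where h: "h \<in> R" "\<And>y. y \<in> S \<Longrightarrow> \<bar>F y - h y\<bar> < e"
    using Stone_Weierstrass_basic[OF Fc e] by blast
  have snS: "sn x \<in> S" for x by (auto simp: S_def sn_def)
  show ?thesis
  proof (rule bexI[of _ "\<lambda>x. h (sn x)"], intro allI impI conjI)
    show "(\<lambda>x. h (sn x)) \<in> trig_sums d" using h(1) by (simp add: R_def)
    fix x :: "nat \<Rightarrow> real"
    \<comment> \<open>Outside the cube the triangle wave folds \<open>x\<close> back, so
      \<open>F (sn x)\<close> is still a value of \<open>f\<close>. The approximation therefore
      keeps a bound independent of \<open>L\<close>, as the tail estimate requires.\<close>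
    show "\<bar>h (sn x)\<bar> \<le> B + e" using h(2)[OF snS, of x] B[of "\<lambda>i. arcsin (sn x i) / w"] unfolding F_def by linarith
    assume x0: "\<forall>i\<ge>d. x i = 0" and xL: "\<forall>i<d. \<bar>x i\<bar> \<le> L"
    have "arcsin (sn x i) / w = x i" for i
    proof (cases "i < d")
      case True
      have "\<bar>w * x i\<bar> \<le> w * L" using xL True w by (simp add: abs_mult)
      also have "w * L = pi / 2" using L by (simp add: w_def)
      finally have "arcsin (sin (w * x i)) = w * x i" by (intro arcsin_sin) linarith+
      then show ?thesis using True w by (simp add: sn_def)
    qed (simp add: x0 sn_def)
    then have "F (sn x) = f x" by (simp add: F_def)
    then show "\<bar>f x - h (sn x)\<bar> \<le> e" using h(2)[OF snS, of x] by simp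
  qed
qed

lemma iexp_integrable:
  assumes "prob_space M" "Z \<in> borel_measurable M"
  shows "integrable M (\<lambda>\<omega>. iexp (Z \<omega> :: real))"
proof -
  interpret prob_space M by fact
  show ?thesis using assms(2) by (intro integrable_const_bound[of _ 1]) auto
qed

lemma char_conv_cos:
  fixes Zs :: "nat \<Rightarrow> 'a \<Rightarrow> real" and Z :: "'b \<Rightarrow> real"
  assumes M: "prob_space M" and P: "prob_space P"
    and Zs: "\<And>t. Zs t \<in> borel_measurable M" and Z: "Z \<in> borel_measurable P"
    and lim: "(\<lambda>t. \<integral>\<omega>. iexp (Zs t \<omega>) \<partial>M) \<longlonglongrightarrow> (\<integral>\<omega>. iexp (Z \<omega>) \<partial>P)"
  shows "(\<lambda>t. \<integral>\<omega>. a * cos (Zs t \<omega> + b) \<partial>M) \<longlonglongrightarrow> (\<integral>\<omega>. a * cos (Z \<omega> + b) \<partial>P)"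
proof -
  have *: "(\<integral>\<omega>. a * cos (Y \<omega> + b) \<partial>Q) = a * Re (iexp b * (\<integral>\<omega>. iexp (Y \<omega>) \<partial>Q))"
    if Q: "prob_space Q" "Y \<in> borel_measurable Q" for Q :: "'c measure" and Y
  proof -
    have "Re (iexp b * (\<integral>\<omega>. iexp (Y \<omega>) \<partial>Q)) = Re (\<integral>\<omega>. iexp b * iexp (Y \<omega>) \<partial>Q)" by simp
    also have "\<dots> = (\<integral>\<omega>. Re (iexp b * iexp (Y \<omega>)) \<partial>Q)"
      by (intro integral_Re[symmetric] integrable_mult_right iexp_integrable Q)
    also have "(\<lambda>\<omega>. Re (iexp b * iexp (Y \<omega>))) = (\<lambda>\<omega>. cos (Y \<omega> + b))"
      by (simp add: exp_add[symmetric] algebra_simps cis_conv_exp[symmetric] cis_mult del: mult_exp_exp)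
    finally show ?thesis by simp
  qed
  show ?thesis unfolding *[OF M Zs] *[OF P Z] by (intro tendsto_intros lim)
qed

text \<open>The continuity theorem on the line; below it is applied to single coordinates to obtain
  tightness.\<close>

lemma weak_conv_of_iexp:
  fixes Zs :: "nat \<Rightarrow> 'a \<Rightarrow> real" and Z :: "'b \<Rightarrow> real"
  assumes M: "prob_space M" and P: "prob_space P"
    and [measurable]: "\<And>t. Zs t \<in> borel_measurable M" and [measurable]: "Z \<in> borel_measurable P"
    and lim: "\<And>s. (\<lambda>t. \<integral>\<omega>. iexp (s * Zs t \<omega>) \<partial>M) \<longlonglongrightarrow> (\<integral>\<omega>. iexp (s * Z \<omega>) \<partial>P)"
    and h: "\<And>x. isCont h x" "\<And>x. \<bar>h x\<bar> \<le> (B::real)"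
  shows "(\<lambda>t. \<integral>\<omega>. h (Zs t \<omega>) \<partial>M) \<longlonglongrightarrow> (\<integral>\<omega>. h (Z \<omega>) \<partial>P)"
proof -
  interpret M: prob_space M by fact
  interpret P: prob_space P by fact
  have [measurable]: "h \<in> borel_measurable borel"
    using h(1) by (intro borel_measurable_continuous_onI) (simp add: continuous_on_eq_continuous_at)
  have D: "real_distribution (distr M borel (Zs t))" for t by simp
  have D': "real_distribution (distr P borel Z)" by simp
  have "weak_conv_m (\<lambda>t. distr M borel (Zs t)) (distr P borel Z)"
    using D D' by (rule levy_continuity) (use lim in \<open>simp add: char_def integral_distr\<close>)
  with D D' have "(\<lambda>t. integral\<^sup>L (distr M borel (Zs t)) h) \<longlonglongrightarrow> integral\<^sup>L (distr P borel Z) h"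
    by (rule weak_conv_imp_integral_bdd_continuous_conv) (use h in auto)
  then show ?thesis by (simp add: integral_distr)
qed

lemma measurable_coordinate:
  "X \<in> borel_measurable M \<Longrightarrow> (\<lambda>\<omega>. (X \<omega> :: nat \<Rightarrow> real) i) \<in> borel_measurable M"
  by (rule measurable_compose[OF _ borel_measurable_continuous_onI[OF continuous_on_product_coordinates]])

text \<open>On a large cube \<open>f\<close> is close to a trigonometric sum, whose expectations
  converge by \<open>lim\<close>. Off the cube the bounded error is charged to truncations of the
  coordinates, whose expectations converge to small limits.\<close>

lemma levy_continuity_vector:
  fixes Xs :: "nat \<Rightarrow> 'a \<Rightarrow> nat \<Rightarrow> real" and X :: "'b \<Rightarrow> nat \<Rightarrow> real"
  assumes M: "prob_space M" and P: "prob_space P"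
    and Xs[measurable]: "\<And>t. Xs t \<in> borel_measurable M" and X[measurable]: "X \<in> borel_measurable P"
    and Xs0: "\<And>t \<omega>. \<omega> \<in> space M \<Longrightarrow> Xs t \<omega> \<in> vec_space d" and X0: "\<And>\<omega>. \<omega> \<in> space P \<Longrightarrow> X \<omega> \<in> vec_space d"
    and lim: "\<And>u. (\<lambda>t. \<integral>\<omega>. iexp (\<Sum>i<d. u i * Xs t \<omega> i) \<partial>M) \<longlonglongrightarrow> (\<integral>\<omega>. iexp (\<Sum>i<d. u i * X \<omega> i) \<partial>P)"
  shows "conv_distr M Xs P X"
  unfolding conv_distr_def
proof (intro allI impI)
  interpret M: prob_space M by fact
  interpret P: prob_space P by fact
  fix f :: "(nat \<Rightarrow> real) \<Rightarrow> real" assume f: "continuous_on UNIV f" and "bounded (range f)"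
  then obtain B where B: "\<And>x. \<bar>f x\<bar> \<le> B" by (auto simp: bounded_iff)
  then have B0: "B \<ge> 0" by (meson abs_ge_zero order_trans)
  note [measurable] = measurable_coordinate
  have [measurable]: "f \<in> borel_measurable borel" using f by (rule borel_measurable_continuous_onI)
  show "(\<lambda>t. \<integral>\<omega>. f (Xs t \<omega>) \<partial>M) \<longlonglongrightarrow> (\<integral>\<omega>. f (X \<omega>) \<partial>P)"
  proof (rule integral_tendsto_approx)
    show "eventually (\<lambda>t. integrable M (\<lambda>\<omega>. f (Xs t \<omega>))) sequentially"
      by (intro always_eventually allI M.integrable_bounded[of _ B] B) measurable
    show "integrable P (\<lambda>\<omega>. f (X \<omega>))" by (intro P.integrable_bounded[of _ B] B) measurable
    fix e :: real assume e: "e > 0"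
    \<comment> \<open>A bounded continuous function equal to 1 once \<open>\<bar>x\<bar>\<close>
      reaches \<open>k + 1\<close> and tending to 0 pointwise as \<open>k\<close> grows: it pays for
      leaving the cube.\<close>
    define \<psi> where "\<psi> k x = min 1 (\<bar>x\<bar> * inverse (real (Suc k)))" for k and x :: real
    have \<psi>: "\<bar>\<psi> k x\<bar> \<le> 1" "0 \<le> \<psi> k x" "isCont (\<psi> k) x" for k x
      unfolding \<psi>_def by (auto intro!: continuous_intros)
    have [measurable]: "\<psi> k \<in> borel_measurable borel" for k unfolding \<psi>_def by measurable
    \<comment> \<open>Bounds the sum of the absolute values of \<open>f\<close> and of its
      approximation \<open>g\<close>, since \<open>g\<close> is at most \<open>B + e'\<close> with
      \<open>e' \<le> 1\<close>.\<close>
    define C where "C = 2 * B + 1"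
    have "(\<lambda>k. \<Sum>i<d. \<integral>\<omega>. \<psi> k (X \<omega> i) \<partial>P) \<longlonglongrightarrow> (\<Sum>i<d. \<integral>\<omega>. 0 \<partial>P)"
    proof (intro tendsto_sum integral_dominated_convergence[where w="\<lambda>_. 1"])
      show "AE \<omega> in P. (\<lambda>k. \<psi> k (X \<omega> i)) \<longlonglongrightarrow> 0" for i
      proof (rule AE_I2)
        fix \<omega>
        have "(\<lambda>k. min 1 (\<bar>X \<omega> i\<bar> * inverse (real (Suc k)))) \<longlonglongrightarrow> min 1 (\<bar>X \<omega> i\<bar> * 0)"
          by (intro tendsto_intros LIMSEQ_inverse_real_of_nat)
        then show "(\<lambda>k. \<psi> k (X \<omega> i)) \<longlonglongrightarrow> 0" by (simp add: \<psi>_def)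
      qed
    qed (use \<psi> in auto)
    then have "(\<lambda>k. C * (\<Sum>i<d. \<integral>\<omega>. \<psi> k (X \<omega> i) \<partial>P)) \<longlonglongrightarrow> C * 0"
      by (intro tendsto_mult_left) simp
    then have "eventually (\<lambda>k. C * (\<Sum>i<d. \<integral>\<omega>. \<psi> k (X \<omega> i) \<partial>P) < e / 2) sequentially"
      using e by (intro order_tendstoD(2)) auto
    then obtain k where k: "C * (\<Sum>i<d. \<integral>\<omega>. \<psi> k (X \<omega> i) \<partial>P) < e / 2" by (auto simp: eventually_sequentially)
    define e' where "e' = min 1 (e / 2)"
    have e': "e' > 0" "e' \<le> 1" "e' \<le> e / 2" using e by (auto simp: e'_def)
    obtain g where g: "g \<in> trig_sums d" and gb: "\<And>x. x \<in> vec_space d \<Longrightarrow> \<bar>g x\<bar> \<le> B + e'"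
      and gf: "\<And>x. x \<in> vec_space d \<Longrightarrow> (\<forall>i<d. \<bar>x i\<bar> \<le> real (Suc k)) \<Longrightarrow> \<bar>f x - g x\<bar> \<le> e'"
      using trig_sums_dense[OF f B _ e'(1), of "real (Suc k)" d] unfolding vec_space_def by auto
    define w where "w x = e' + C * (\<Sum>i<d. \<psi> k (x i))" for x :: "nat \<Rightarrow> real"
    have sum\<psi>: "0 \<le> (\<Sum>i<d. \<psi> k (x i))" for x :: "nat \<Rightarrow> real" by (intro sum_nonneg \<psi>)
    have C: "C \<ge> 0" using B0 by (simp add: C_def)
    have fw: "\<bar>f x - g x\<bar> \<le> w x" if x: "x \<in> vec_space d" for x
    proof (cases "\<forall>i<d. \<bar>x i\<bar> \<le> real (Suc k)")
      case True
      then show ?thesis using gf[OF x True] mult_nonneg_nonneg[OF C sum\<psi>, of x] by (simp add: w_def)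
    next
      case False
      then obtain i where i: "i < d" "\<bar>x i\<bar> > real (Suc k)" by auto
      have "1 = \<psi> k (x i)" using i(2) by (simp add: \<psi>_def field_simps)
      also have "\<dots> \<le> (\<Sum>i<d. \<psi> k (x i))" using i(1) by (intro member_le_sum \<psi>) auto
      finally have "C * 1 \<le> C * (\<Sum>i<d. \<psi> k (x i))" using C by (rule mult_left_mono)
      moreover have "\<bar>f x - g x\<bar> \<le> e' + C" using gb[OF x] B[of x] e' unfolding C_def by linarith
      ultimately show ?thesis unfolding w_def by linarith
    qed
    have [measurable]: "g \<in> borel_measurable borel"
      using trig_sums_bounded_continuous(2)[OF g] by (rule borel_measurable_continuous_onI)
    obtain Bg where Bg: "\<And>x. \<bar>g x\<bar> \<le> Bg" using trig_sums_bounded_continuous(1)[OF g] by blast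
    have int\<psi>: "integrable M (\<lambda>\<omega>. \<psi> k (Xs t \<omega> i))" "integrable P (\<lambda>\<omega>. \<psi> k (X \<omega> i))" for t i
      by (intro M.integrable_bounded[of _ 1] P.integrable_bounded[of _ 1] \<psi>; measurable)+
    have limg: "(\<lambda>t. \<integral>\<omega>. g (Xs t \<omega>) \<partial>M) \<longlonglongrightarrow> (\<integral>\<omega>. g (X \<omega>) \<partial>P)" using g
    proof induction
      case (trig_cos a u b)
      show ?case by (rule char_conv_cos[OF M P _ _ lim]) measurable
    next
      case (trig_add f g)
      have "integrable M (\<lambda>\<omega>. h (Xs t \<omega>))" "integrable P (\<lambda>\<omega>. h (X \<omega>))" if h: "h \<in> trig_sums d" for h t
      proof -
        obtain Bh where Bh: "\<And>x. \<bar>h x\<bar> \<le> Bh" using trig_sums_bounded_continuous(1)[OF h] by blast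
        have [measurable]: "h \<in> borel_measurable borel"
          using trig_sums_bounded_continuous(2)[OF h] by (rule borel_measurable_continuous_onI)
        show "integrable M (\<lambda>\<omega>. h (Xs t \<omega>))" "integrable P (\<lambda>\<omega>. h (X \<omega>))"
          by (intro M.integrable_bounded[of _ Bh] P.integrable_bounded[of _ Bh] Bh; measurable)+
      qed
      then show ?case using trig_add by (simp add: tendsto_add)
    qed
    have lim\<psi>: "(\<lambda>t. \<integral>\<omega>. \<psi> k (Xs t \<omega> i) \<partial>M) \<longlonglongrightarrow> (\<integral>\<omega>. \<psi> k (X \<omega> i) \<partial>P)" if i: "i < d" for i
    proof (rule weak_conv_of_iexp[OF M P, where B = 1 and h = "\<psi> k"])
      fix s :: real
      have "(\<Sum>j<d. (if j = i then s else 0) * x j) = s * x i" for x :: "nat \<Rightarrow> real"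
        using i by (simp add: if_distrib[where f="\<lambda>z. z * _"] cong: if_cong)
      then show "(\<lambda>t. \<integral>\<omega>. iexp (s * Xs t \<omega> i) \<partial>M) \<longlonglongrightarrow> (\<integral>\<omega>. iexp (s * X \<omega> i) \<partial>P)"
        using lim[of "\<lambda>j. if j = i then s else 0"] by simp
    qed (use \<psi> in auto)
    have intw: "(\<integral>\<omega>. w (Xs t \<omega>) \<partial>M) = e' + C * (\<Sum>i<d. \<integral>\<omega>. \<psi> k (Xs t \<omega> i) \<partial>M)"
      "(\<integral>\<omega>. w (X \<omega>) \<partial>P) = e' + C * (\<Sum>i<d. \<integral>\<omega>. \<psi> k (X \<omega> i) \<partial>P)" for t
      unfolding w_def by (simp_all add: int\<psi> M.prob_space P.prob_space)
    show "\<exists>hs h ws w.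
        eventually (\<lambda>t. integrable M (hs t) \<and> integrable M (ws t) \<and>
            (\<forall>\<omega>\<in>space M. \<bar>f (Xs t \<omega>) - hs t \<omega>\<bar> \<le> ws t \<omega>)) sequentially \<and>
        integrable P h \<and> integrable P w \<and> (\<forall>\<omega>\<in>space P. \<bar>f (X \<omega>) - h \<omega>\<bar> \<le> w \<omega>) \<and>
        (\<lambda>t. integral\<^sup>L M (hs t)) \<longlonglongrightarrow> integral\<^sup>L P h \<and>
        (\<lambda>t. integral\<^sup>L M (ws t)) \<longlonglongrightarrow> integral\<^sup>L P w \<and> integral\<^sup>L P w < e"
    proof (rule exI[of _ "\<lambda>t \<omega>. g (Xs t \<omega>)"], rule exI[of _ "\<lambda>\<omega>. g (X \<omega>)"],
      rule exI[of _ "\<lambda>t \<omega>. w (Xs t \<omega>)"], rule exI[of _ "\<lambda>\<omega>. w (X \<omega>)"], intro conjI ballI fw X0 limg)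
      have "integrable M (\<lambda>\<omega>. g (Xs t \<omega>))" "integrable M (\<lambda>\<omega>. w (Xs t \<omega>))" for t
        by (intro M.integrable_bounded[of _ Bg] Bg; measurable) (simp add: w_def int\<psi>)
      then show "eventually (\<lambda>t. integrable M (\<lambda>\<omega>. g (Xs t \<omega>)) \<and> integrable M (\<lambda>\<omega>. w (Xs t \<omega>)) \<and>
            (\<forall>\<omega>\<in>space M. \<bar>f (Xs t \<omega>) - g (Xs t \<omega>)\<bar> \<le> w (Xs t \<omega>))) sequentially"
        using fw Xs0 by simp
      show "integrable P (\<lambda>\<omega>. g (X \<omega>))" by (intro P.integrable_bounded[of _ Bg] Bg) measurable
      show "integrable P (\<lambda>\<omega>. w (X \<omega>))" by (simp add: w_def int\<psi>)
      show "(\<lambda>t. \<integral>\<omega>. w (Xs t \<omega>) \<partial>M) \<longlonglongrightarrow> (\<integral>\<omega>. w (X \<omega>) \<partial>P)"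
        unfolding intw by (intro tendsto_intros lim\<psi>) auto
      show "(\<integral>\<omega>. w (X \<omega>) \<partial>P) < e" unfolding intw using k e' by linarith
    qed
  qed
qed

section \<open>The two-sample central limit theorem\<close>

definition weighted_mean :: "nat \<Rightarrow> (nat \<Rightarrow> real) \<Rightarrow> (nat \<Rightarrow> real) \<Rightarrow> real" where
  "weighted_mean N r z = (\<Sum>x<N. r x * z x)"

definition weighted_var :: "nat \<Rightarrow> (nat \<Rightarrow> real) \<Rightarrow> (nat \<Rightarrow> real) \<Rightarrow> real" where
  "weighted_var N r z = (\<Sum>x<N. r x * (z x - weighted_mean N r z)\<^sup>2)"

lemma weighted_var_alt:
  assumes "(\<Sum>x<N. r x) = 1"
  shows "weighted_var N r z = (\<Sum>x<N. r x * (z x)\<^sup>2) - (weighted_mean N r z)\<^sup>2"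
proof -
  let ?m = "weighted_mean N r z"
  have "weighted_var N r z = (\<Sum>x<N. r x * (z x)\<^sup>2 - 2 * ?m * (r x * z x) + ?m\<^sup>2 * r x)"
    unfolding weighted_var_def by (intro sum.cong) (auto simp: power2_eq_square algebra_simps)
  also have "\<dots> = (\<Sum>x<N. r x * (z x)\<^sup>2) - 2 * ?m * (\<Sum>x<N. r x * z x) + ?m\<^sup>2 * (\<Sum>x<N. r x)"
    by (simp add: sum.distrib sum_subtractf sum_distrib_left)
  also have "(\<Sum>x<N. r x * z x) = ?m" by (simp add: weighted_mean_def)
  finally show ?thesis using assms by (simp add: power2_eq_square)
qed

lemma weighted_var_nonneg: "(\<And>x. x < N \<Longrightarrow> 0 \<le> r x) \<Longrightarrow> 0 \<le> weighted_var N r z"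
  by (auto simp: weighted_var_def intro!: sum_nonneg)

lemma weighted_var_eq_0:
  assumes "\<And>x. x < N \<Longrightarrow> 0 < r x" "weighted_var N r z = 0" "x < N"
  shows "z x = weighted_mean N r z"
proof -
  have "\<forall>x\<in>{..<N}. r x * (z x - weighted_mean N r z)\<^sup>2 = 0"
    using assms(1,2) unfolding weighted_var_def
    by (subst (asm) sum_nonneg_eq_0_iff) (auto simp: less_imp_le)
  then have "r x * (z x - weighted_mean N r z)\<^sup>2 = 0" using assms(3) by blast
  then show ?thesis using assms(1)[OF assms(3)] by (simp only: mult_eq_0_iff) simp
qed

lemma quad_ot_Sig:
  "(\<Sum>i<d. \<Sum>j<d. u i * ot_Sig r i j * u j) = (\<Sum>i<d. r i * (u i)\<^sup>2) - (\<Sum>i<d. r i * u i)\<^sup>2"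
proof -
  have "u i * ot_Sig r i j * u j = (if i = j then r i * (u i)\<^sup>2 else 0) - (r i * u i) * (r j * u j)" for i j
    by (simp add: ot_Sig_def power2_eq_square algebra_simps)
  then show ?thesis
    by (simp add: sum_subtractf power2_eq_square sum_product)
qed

text \<open>\<open>ot_Sig r\<close> is the covariance of the indicators of the \<open>N\<close>
  outcomes. Extending \<open>u\<close> by 0 turns the quadratic form of a block into a variance
  under the full law; \<open>d = N - 1\<close> covers the reduced row marginal and
  \<open>d = N\<close> the column marginal.\<close>

lemma quad_ot_Sig_var:
  assumes "d \<le> N" "(\<Sum>x<N. r x) = 1"
  shows "(\<Sum>i<d. \<Sum>j<d. u i * ot_Sig r i j * u j) = weighted_var N r (\<lambda>x. if x < d then u x else 0)"
proof -
  have "(\<Sum>x<N. r x * (if x < d then u x else 0)\<^sup>2) = (\<Sum>x<d. r x * (u x)\<^sup>2)"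
    "(\<Sum>x<N. r x * (if x < d then u x else 0)) = (\<Sum>x<d. r x * u x)"
    using assms(1) by (intro sum.mono_neutral_cong_right; auto)+
  then show ?thesis
    unfolding weighted_var_alt[OF assms(2)] weighted_mean_def quad_ot_Sig by simp
qed

section \<open>Characteristic functions of the samples and of the Gaussian limit\<close>

text \<open>Second-order expansion of the exponential: the linear term vanishes by centring, the
  quadratic one gives the variance, and the remainder is a third absolute moment.\<close>

lemma char_quadratic_approx:
  fixes r z :: "nat \<Rightarrow> real"
  assumes r: "\<And>x. x < N \<Longrightarrow> 0 \<le> r x" "(\<Sum>x<N. r x) = 1"
  shows "cmod ((\<Sum>x<N. r x * iexp (a * (z x - weighted_mean N r z))) - of_real (1 - a\<^sup>2 * weighted_var N r z / 2))
      \<le> \<bar>a\<bar> ^ 3 * (\<Sum>x<N. r x * \<bar>z x - weighted_mean N r z\<bar> ^ 3)"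
proof -
  let ?y = "\<lambda>x. z x - weighted_mean N r z"
  have y0: "(\<Sum>x<N. r x * ?y x) = 0"
    using r(2) by (simp add: right_diff_distrib sum_subtractf weighted_mean_def flip: sum_distrib_right)
  let ?p = "\<lambda>x. 1 + \<i> * of_real (a * ?y x) - of_real ((a * ?y x)\<^sup>2 / 2)"
  have tm: "of_real q * (1 + \<i> * of_real (a * y) - of_real ((a * y)\<^sup>2 / 2))
      = of_real q + \<i> * of_real (a * (q * y)) - (of_real (a\<^sup>2 * (q * y\<^sup>2) / 2) :: complex)" for q y :: real
    by (simp add: power_mult_distrib algebra_simps)
  have "(\<Sum>x<N. of_real (r x) * ?p x) = of_real (\<Sum>x<N. r x) + \<i> * of_real (a * (\<Sum>x<N. r x * ?y x))
      - of_real (a\<^sup>2 * (\<Sum>x<N. r x * (?y x)\<^sup>2) / 2)"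
    by (simp only: tm sum.distrib sum_subtractf sum_distrib_left[symmetric] of_real_sum[symmetric]
        sum_divide_distrib[symmetric])
  also have "\<dots> = of_real (1 - a\<^sup>2 * weighted_var N r z / 2)"
    unfolding y0 r(2) weighted_var_def by simp
  finally have P: "of_real (1 - a\<^sup>2 * weighted_var N r z / 2) = (\<Sum>x<N. of_real (r x) * ?p x)" ..
  have le: "cmod (iexp (a * ?y x) - ?p x) \<le> \<bar>a\<bar> ^ 3 * \<bar>?y x\<bar> ^ 3" for x
  proof -
    have "cmod (iexp (a * ?y x) - (\<Sum>k\<le>2. (\<i> * (a * ?y x)) ^ k / fact k)) \<le> \<bar>a * ?y x\<bar> ^ Suc 2 / fact (Suc 2)"
      by (rule iexp_approx1)
    also have "(\<Sum>k\<le>2. (\<i> * (a * ?y x)) ^ k / fact k) = ?p x"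
      by (simp add: numeral_2_eq_2 power2_eq_square power_mult_distrib)
    also have "\<bar>a * ?y x\<bar> ^ Suc 2 / fact (Suc 2) \<le> \<bar>a * ?y x\<bar> ^ 3"
    proof -
      have "Suc 2 = 3" "(fact 3 :: real) = 6" by (simp_all add: fact_numeral)
      then show ?thesis using zero_le_power[of "\<bar>a * ?y x\<bar>" 3] by simp
    qed
    finally show ?thesis by (simp add: abs_mult power_mult_distrib)
  qed
  have "cmod ((\<Sum>x<N. r x * iexp (a * ?y x)) - (\<Sum>x<N. of_real (r x) * ?p x))
     = cmod (\<Sum>x<N. r x * (iexp (a * ?y x) - ?p x))"
    by (simp only: sum_subtractf right_diff_distrib)
  also have "\<dots> \<le> (\<Sum>x<N. cmod (r x * (iexp (a * ?y x) - ?p x)))" by (rule norm_sum)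
  also have "\<dots> \<le> (\<Sum>x<N. r x * (\<bar>a\<bar> ^ 3 * \<bar>?y x\<bar> ^ 3))"
    using r(1) by (intro sum_mono) (auto simp only: norm_mult norm_of_real abs_of_nonneg lessThan_iff intro!: mult_left_mono le)
  finally show ?thesis unfolding P by (simp only: sum_distrib_left mult_ac)
qed

text \<open>The central limit theorem for one sample. The scaling \<open>a\<close> is kept general
  because both samples are scaled by the common factor \<open>ot_scale\<close>; \<open>k\<close>
  becomes \<open>lam\<close> for the first sample and \<open>1 - lam\<close> for the second.\<close>

lemma char_power_tendsto:
  fixes r z :: "nat \<Rightarrow> real" and a :: "nat \<Rightarrow> real" and n :: "nat \<Rightarrow> nat"
  assumes r: "\<And>x. x < N \<Longrightarrow> 0 \<le> r x" "(\<Sum>x<N. r x) = 1"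
    and a: "a \<longlonglongrightarrow> 0" and na: "(\<lambda>t. real (n t) * (a t)\<^sup>2) \<longlonglongrightarrow> k"
  shows "(\<lambda>t. (\<Sum>x<N. r x * iexp (a t * (z x - weighted_mean N r z))) ^ n t)
     \<longlonglongrightarrow> of_real (exp (- (k * weighted_var N r z / 2)))"
proof -
  let ?V = "weighted_var N r z" and ?y = "\<lambda>x. z x - weighted_mean N r z"
  let ?\<phi> = "\<lambda>t. \<Sum>x<N. r x * iexp (a t * ?y x)"
  \<comment> \<open>Unlike the quadratic polynomial, this comparison term never exceeds 1 in
    absolute value. Hence the \<open>n\<close>-th powers differ by at most \<open>n\<close> times
    the difference of the bases.\<close>
  let ?w = "\<lambda>t. of_real (exp (- ((a t)\<^sup>2 * ?V / 2))) :: complex"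
  define C where "C = (\<Sum>x<N. r x * \<bar>?y x\<bar> ^ 3)"
  have V: "?V \<ge> 0" using r(1) by (rule weighted_var_nonneg)
  have e: "\<bar>exp (- x) - (1 - x)\<bar> \<le> x\<^sup>2" if "0 \<le> x" for x :: real
  proof -
    have 1: "1 - x \<le> exp (- x)" using exp_ge_add_one_self[of "- x"] by simp
    have 2: "exp (- x) * (1 + x) \<le> 1"
      using mult_left_mono[OF exp_ge_add_one_self[of x], of "exp (- x)"] by (simp flip: exp_add)
    \<comment> \<open>The product on the right is \<open>1 + x^3\<close>.\<close>
    have "exp (- x) * (1 + x) \<le> (1 - x + x\<^sup>2) * (1 + x)"
      using 2 that by (simp add: power2_eq_square algebra_simps)
        (metis add.commute add_increasing2 mult_nonneg_nonneg order_trans)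
    then have "exp (- x) \<le> 1 - x + x\<^sup>2" using that by simp
    with 1 show ?thesis by simp
  qed
  have bound: "cmod (?\<phi> t ^ n t - ?w t ^ n t) \<le> real (n t) * (a t)\<^sup>2 * (\<bar>a t\<bar> * C + (a t)\<^sup>2 * (?V / 2)\<^sup>2)" for t
  proof -
    have "cmod (?\<phi> t) \<le> (\<Sum>x<N. cmod (r x * iexp (a t * ?y x)))" by (rule norm_sum)
    also have "\<dots> = (\<Sum>x<N. r x)" using r(1) by (intro sum.cong) (auto simp: norm_mult)
    finally have n1: "cmod (?\<phi> t) \<le> 1" using r(2) by simp
    have n2: "cmod (?w t) \<le> 1" using V by simp
    have "cmod (?\<phi> t - ?w t) \<le> cmod (?\<phi> t - of_real (1 - (a t)\<^sup>2 * ?V / 2)) + cmod (of_real (1 - (a t)\<^sup>2 * ?V / 2) - ?w t)"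
      using norm_triangle_ineq[of "?\<phi> t - of_real (1 - (a t)\<^sup>2 * ?V / 2)" "of_real (1 - (a t)\<^sup>2 * ?V / 2) - ?w t"] by simp
    also have "cmod (?\<phi> t - of_real (1 - (a t)\<^sup>2 * ?V / 2)) \<le> \<bar>a t\<bar> ^ 3 * C"
      unfolding C_def by (rule char_quadratic_approx[OF r])
    also have "cmod (of_real (1 - (a t)\<^sup>2 * ?V / 2) - ?w t) \<le> ((a t)\<^sup>2 * ?V / 2)\<^sup>2"
      unfolding of_real_diff[symmetric] norm_of_real
      using e[of "(a t)\<^sup>2 * ?V / 2"] V by (simp only: abs_minus_commute) simp
    finally have "cmod (?\<phi> t - ?w t) \<le> \<bar>a t\<bar> ^ 3 * C + ((a t)\<^sup>2 * ?V / 2)\<^sup>2" by simp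
    then have "real (n t) * cmod (?\<phi> t - ?w t) \<le> real (n t) * (\<bar>a t\<bar> ^ 3 * C + ((a t)\<^sup>2 * ?V / 2)\<^sup>2)"
      by (rule mult_left_mono) simp
    also have "\<bar>a t\<bar> ^ 3 * C + ((a t)\<^sup>2 * ?V / 2)\<^sup>2 = (a t)\<^sup>2 * (\<bar>a t\<bar> * C + (a t)\<^sup>2 * (?V / 2)\<^sup>2)"
      by (simp add: power3_eq_cube power2_eq_square algebra_simps) 
    finally show ?thesis using norm_power_diff[OF n1 n2, of "n t"] by (simp add: mult.assoc)
  qed
  have "(\<lambda>t. real (n t) * (a t)\<^sup>2 * (\<bar>a t\<bar> * C + (a t)\<^sup>2 * (?V / 2)\<^sup>2)) \<longlonglongrightarrow> k * (\<bar>0\<bar> * C + 0\<^sup>2 * (?V / 2)\<^sup>2)"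
    by (intro tendsto_intros a na)
  then have lim0: "(\<lambda>t. real (n t) * (a t)\<^sup>2 * (\<bar>a t\<bar> * C + (a t)\<^sup>2 * (?V / 2)\<^sup>2)) \<longlonglongrightarrow> 0"
    by simp
  have "(\<lambda>t. ?\<phi> t ^ n t - ?w t ^ n t) \<longlonglongrightarrow> 0"
    by (rule Lim_null_comparison[OF always_eventually lim0]) (rule allI, rule bound)
  moreover have "(\<lambda>t. ?w t ^ n t) \<longlonglongrightarrow> of_real (exp (- (k * ?V / 2)))"
  proof -
    have "(\<lambda>t. of_real (exp (- (real (n t) * (a t)\<^sup>2 * ?V / 2))) :: complex) \<longlonglongrightarrow> of_real (exp (- (k * ?V / 2)))"
      by (intro tendsto_intros na) simp
    moreover have "?w t ^ n t = of_real (exp (- (real (n t) * (a t)\<^sup>2 * ?V / 2)))" for t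
      unfolding of_real_power[symmetric] exp_of_nat_mult[symmetric] by (simp add: mult_ac)
    ultimately show ?thesis by (simp only:)
  qed
  ultimately have "(\<lambda>t. (?\<phi> t ^ n t - ?w t ^ n t) + ?w t ^ n t) \<longlonglongrightarrow> 0 + of_real (exp (- (k * ?V / 2)))"
    by (rule tendsto_add)
  then show ?thesis by simp
qed

lemma char_finite_range:
  fixes X :: "'a \<Rightarrow> nat" and f :: "nat \<Rightarrow> complex"
  assumes "prob_space M" and [measurable]: "X \<in> M \<rightarrow>\<^sub>M count_space UNIV" and ran: "\<And>\<omega>. \<omega> \<in> space M \<Longrightarrow> X \<omega> < N"
    and law: "\<And>x. x < N \<Longrightarrow> measure M {\<omega>\<in>space M. X \<omega> = x} = r x"
  shows "(\<integral>\<omega>. f (X \<omega>) \<partial>M) = (\<Sum>x<N. r x * f x)" "integrable M (\<lambda>\<omega>. f (X \<omega>))"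
proof -
  interpret prob_space M by fact
  have eq: "f (X \<omega>) = (\<Sum>x<N. indicator {\<omega>\<in>space M. X \<omega> = x} \<omega> *\<^sub>R f x)" if "\<omega> \<in> space M" for \<omega>
  proof -
    have "(\<Sum>x<N. indicator {\<omega>\<in>space M. X \<omega> = x} \<omega> *\<^sub>R f x) = (\<Sum>x<N. if x = X \<omega> then f x else 0)"
      using that by (intro sum.cong) (auto simp: indicator_def)
    then show ?thesis using ran[OF that] by simp
  qed
  have int: "integrable M (\<lambda>\<omega>. indicator {\<omega>\<in>space M. X \<omega> = x} \<omega> *\<^sub>R f x)" for x
    by (intro integrable_scaleR_left integrable_real_indicator) (auto simp: emeasure_eq_measure)
  show "integrable M (\<lambda>\<omega>. f (X \<omega>))"
    by (rule Bochner_Integration.integrable_cong[OF refl eq, THEN iffD2]) (assumption, intro Bochner_Integration.integrable_sum int)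
  have "(\<integral>\<omega>. f (X \<omega>) \<partial>M) = (\<integral>\<omega>. (\<Sum>x<N. indicator {\<omega>\<in>space M. X \<omega> = x} \<omega> *\<^sub>R f x) \<partial>M)"
    using eq by (intro Bochner_Integration.integral_cong) auto
  also have "\<dots> = (\<Sum>x<N. \<integral>\<omega>. indicator {\<omega>\<in>space M. X \<omega> = x} \<omega> *\<^sub>R f x \<partial>M)"
    by (intro Bochner_Integration.integral_sum int)
  also have "\<dots> = (\<Sum>x<N. r x * f x)"
    using law by (intro sum.cong refl) (simp add: scaleR_conv_of_real)
  finally show "(\<integral>\<omega>. f (X \<omega>) \<partial>M) = (\<Sum>x<N. r x * f x)" .
qed

text \<open>The two samples form a single independent family indexed by a disjoint sum, so the
  expectation has one factor per observation, and equal laws turn the factors into powers.\<close>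

lemma char_two_samples:
  fixes X Y :: "nat \<Rightarrow> 'a \<Rightarrow> nat"
  assumes M: "prob_space M"
    and indep: "prob_space.indep_vars M (\<lambda>_. count_space UNIV) (\<lambda>i. case i of Inl k \<Rightarrow> X k | Inr k \<Rightarrow> Y k) UNIV"
    and X_range: "\<And>k \<omega>. \<omega> \<in> space M \<Longrightarrow> X k \<omega> < N" and Y_range: "\<And>k \<omega>. \<omega> \<in> space M \<Longrightarrow> Y k \<omega> < N"
    and X_law: "\<And>k x. x < N \<Longrightarrow> measure M {\<omega>\<in>space M. X k \<omega> = x} = r x"
    and Y_law: "\<And>k x. x < N \<Longrightarrow> measure M {\<omega>\<in>space M. Y k \<omega> = x} = s x"
  shows "(\<integral>\<omega>. iexp ((\<Sum>k<n. f (X k \<omega>)) + (\<Sum>k<m. g (Y k \<omega>))) \<partial>M)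
     = (\<Sum>x<N. r x * iexp (f x)) ^ n * (\<Sum>x<N. s x * iexp (g x)) ^ m"
proof -
  interpret prob_space M by fact
  let ?J = "{..<n} <+> {..<m}"
  let ?X = "\<lambda>i. case i of Inl k \<Rightarrow> X k | Inr k \<Rightarrow> Y k"
  define h where "h i = (case i of Inl k \<Rightarrow> (\<lambda>x. iexp (f x)) | Inr k \<Rightarrow> (\<lambda>x. iexp (g x)))" for i :: "nat + nat"
  have rv: "?X i \<in> M \<rightarrow>\<^sub>M count_space UNIV" for i using indep unfolding indep_vars_def by blast
  have [measurable]: "X k \<in> M \<rightarrow>\<^sub>M count_space UNIV" "Y k \<in> M \<rightarrow>\<^sub>M count_space UNIV" for k
    using rv[of "Inl k"] rv[of "Inr k"] by simp_all
  have "indep_vars (\<lambda>_. borel) (\<lambda>i \<omega>. h i (?X i \<omega>)) ?J"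
    by (rule indep_vars_compose2[OF indep_vars_subset[OF indep]]) auto
  moreover have "integrable M (\<lambda>\<omega>. h i (?X i \<omega>))" for i
    using char_finite_range(2)[OF M, of "X _" N r] char_finite_range(2)[OF M, of "Y _" N s]
    by (cases i) (auto simp: h_def X_range Y_range X_law Y_law)
  ultimately have "(\<integral>\<omega>. (\<Prod>i\<in>?J. h i (?X i \<omega>)) \<partial>M) = (\<Prod>i\<in>?J. \<integral>\<omega>. h i (?X i \<omega>) \<partial>M)"
    by (intro indep_vars_lebesgue_integral) auto
  also have "\<dots> = (\<Sum>x<N. r x * iexp (f x)) ^ n * (\<Sum>x<N. s x * iexp (g x)) ^ m"
  proof -
    have "(\<integral>\<omega>. iexp (f (X k \<omega>)) \<partial>M) = (\<Sum>x<N. r x * iexp (f x))" for k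
      by (rule char_finite_range(1)[OF M]) (auto simp: X_range X_law)
    moreover have "(\<integral>\<omega>. iexp (g (Y k \<omega>)) \<partial>M) = (\<Sum>x<N. s x * iexp (g x))" for k
      by (rule char_finite_range(1)[OF M]) (auto simp: Y_range Y_law)
    ultimately show ?thesis by (simp add: prod.Plus h_def)
  qed
  also have "(\<lambda>\<omega>. \<Prod>i\<in>?J. h i (?X i \<omega>)) = (\<lambda>\<omega>. iexp ((\<Sum>k<n. f (X k \<omega>)) + (\<Sum>k<m. g (Y k \<omega>))))"
    by (simp add: prod.Plus h_def exp_add distrib_left exp_sum sum_distrib_left)
  finally show ?thesis .
qed

lemma char_centred_gaussian:
  assumes "prob_space P" and Z: "centred_gaussian P d C Z"
    and v: "v = (\<Sum>i<d. \<Sum>j<d. u i * C i j * u j)" "0 \<le> v"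
  shows "(\<integral>\<omega>. iexp (\<Sum>i<d. u i * Z \<omega> i) \<partial>P) = of_real (exp (- (v / 2)))"
proof -
  interpret prob_space P by fact
  note [measurable] = measurable_coordinate
  have [measurable]: "Z \<in> borel_measurable P" using Z by (simp add: centred_gaussian_def)
  let ?L = "\<lambda>\<omega>. \<Sum>i<d. u i * Z \<omega> i"
  show ?thesis
  proof (cases "v = 0")
    case True
    then have "AE \<omega> in P. ?L \<omega> = 0" using Z v(1) by (simp add: centred_gaussian_def Let_def)
    then have "AE \<omega> in P. iexp (?L \<omega>) = 1"
    proof eventually_elim
      case (elim \<omega>)
      then show ?case by (simp only: of_real_0 mult_zero_right exp_zero)
    qed
    then have "(\<integral>\<omega>. iexp (?L \<omega>) \<partial>P) = (\<integral>\<omega>. 1 \<partial>P)" by (intro integral_cong_AE) measurable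
    then show ?thesis using True by (simp add: prob_space)
  next
    case False
    with v have "distributed P lborel ?L (normal_density 0 (sqrt v))"
      using Z by (simp add: centred_gaussian_def Let_def)
    then have D: "distributed P lborel (\<lambda>\<omega>. ?L \<omega> / sqrt v) std_normal_density"
      using normal_standard_normal_convert[of "sqrt v" ?L 0] v False by simp
    have "distr P borel (\<lambda>\<omega>. ?L \<omega> / sqrt v) = std_normal_distribution"
      unfolding distributed_distr_eq_density[OF D, symmetric] by (rule distr_cong) auto
    then have "char (distr P borel (\<lambda>\<omega>. ?L \<omega> / sqrt v)) (sqrt v) = of_real (exp (- ((sqrt v)\<^sup>2) / 2))"
      by (simp add: char_std_normal_distribution)
    moreover have "char (distr P borel (\<lambda>\<omega>. ?L \<omega> / sqrt v)) (sqrt v) = (\<integral>\<omega>. iexp (sqrt v * (?L \<omega> / sqrt v)) \<partial>P)"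
      unfolding char_def by (rule integral_distr) measurable
    moreover have "sqrt v * (y / sqrt v) = y" for y using v False by simp
    ultimately show ?thesis using v(2) by simp
  qed
qed

text \<open>By uniqueness of characteristic functions \<open>L / sqrt v\<close> is standard normal,
  and a law with a density has no atoms.\<close>

lemma AE_neq_0_of_gaussian_char:
  assumes "prob_space P" and [measurable]: "L \<in> borel_measurable P" and v: "v > 0"
    and ch: "\<And>x. (\<integral>\<omega>. iexp (x * L \<omega>) \<partial>P) = of_real (exp (- (x\<^sup>2 * v / 2)))"
  shows "AE \<omega> in P. L \<omega> \<noteq> (0::real)"
proof -
  interpret prob_space P by fact
  let ?D = "distr P borel (\<lambda>\<omega>. L \<omega> / sqrt v)"
  have D: "real_distribution ?D" by simp
  have "char ?D x = char std_normal_distribution x" for x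
  proof -
    have "char ?D x = (\<integral>\<omega>. iexp (x * (L \<omega> / sqrt v)) \<partial>P)"
      unfolding char_def by (rule integral_distr) measurable
    also have "\<dots> = (\<integral>\<omega>. iexp (x / sqrt v * L \<omega>) \<partial>P)" by simp
    also have "\<dots> = of_real (exp (- ((x / sqrt v)\<^sup>2 * v / 2)))" by (rule ch)
    also have "(x / sqrt v)\<^sup>2 * v = x\<^sup>2" using v by (simp add: power_divide)
    finally show ?thesis by (simp add: char_std_normal_distribution)
  qed
  then have eq: "?D = std_normal_distribution"
    by (intro Levy_uniqueness[OF D real_dist_normal_dist]) auto
  have "AE x in lborel. x \<noteq> (0::real)" by (rule AE_lborel_singleton)
  then have "AE x in std_normal_distribution. x \<noteq> 0"
    by (subst AE_density) auto
  then have "AE x in ?D. x \<noteq> 0" unfolding eq .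
  then have "AE \<omega> in P. L \<omega> / sqrt v \<noteq> 0" by (subst (asm) AE_distr_iff) auto
  then show ?thesis by eventually_elim auto
qed

lemma weighted_var_cong:
  "(\<And>x. x < N \<Longrightarrow> z x = z' x) \<Longrightarrow> weighted_var N r z = weighted_var N r z'"
  by (auto simp: weighted_var_def weighted_mean_def intro!: sum.cong)

lemma weighted_var_scale: "weighted_var N r (\<lambda>i. x * z i) = x\<^sup>2 * weighted_var N r z"
proof -
  have "weighted_mean N r (\<lambda>i. x * z i) = x * weighted_mean N r z"
    by (simp add: weighted_mean_def sum_distrib_left mult_ac)
  then have "weighted_var N r (\<lambda>i. x * z i) = (\<Sum>i<N. r i * (x * (z i - weighted_mean N r z))\<^sup>2)"
    by (simp add: weighted_var_def right_diff_distrib)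
  then show ?thesis by (simp add: weighted_var_def power_mult_distrib sum_distrib_left mult_ac)
qed

lemma sum_reduced_index:
  fixes f :: "nat \<Rightarrow> real"
  assumes "N \<ge> 1"
  shows "(\<Sum>a<2 * N - 1. f a) = (\<Sum>a<N - 1. f a) + (\<Sum>b<N. f (N - 1 + b))"
proof -
  have "(\<Sum>a<p + q. f a) = (\<Sum>a<p. f a) + (\<Sum>b<q. f (p + b))" for p q by (induction q) simp_all
  moreover have "2 * N - 1 = N - 1 + N" using assms by simp
  ultimately show ?thesis by simp
qed

section \<open>Fluctuations of the empirical marginals and their Gaussian limit\<close>

lemma ot_empirical_eq: "ot_empirical X n \<omega> x = (\<Sum>k<n. if X k \<omega> = x then 1 else 0) / real n"
proof -
  have "(\<Sum>k<n. if X k \<omega> = x then 1 else 0 :: real) = (\<Sum>k\<in>{k. k < n \<and> X k \<omega> = x}. 1)"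
    by (intro sum.mono_neutral_cong_right) auto
  then show ?thesis by (simp add: ot_empirical_def)
qed

lemma sum_ot_empirical_centred:
  assumes "n \<ge> 1" "\<And>k. X k \<omega> < N"
  shows "(\<Sum>x<N. z x * (ot_empirical X n \<omega> x - r x)) = (\<Sum>k<n. z (X k \<omega>) - weighted_mean N r z) / real n"
proof -
  have "(\<Sum>x<N. z x * ot_empirical X n \<omega> x) = (\<Sum>x<N. \<Sum>k<n. z x * (if X k \<omega> = x then 1 else 0)) / real n"
    by (simp add: ot_empirical_eq sum_divide_distrib sum_distrib_left)
  also have "(\<Sum>x<N. \<Sum>k<n. z x * (if X k \<omega> = x then 1 else 0)) = (\<Sum>k<n. \<Sum>x<N. if x = X k \<omega> then z x else 0)"
    by (subst sum.swap) (intro sum.cong, auto)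
  also have "\<dots> = (\<Sum>k<n. z (X k \<omega>))" using assms(2) by simp
  finally have "(\<Sum>x<N. z x * ot_empirical X n \<omega> x) = (\<Sum>k<n. z (X k \<omega>)) / real n" .
  then show ?thesis
    using assms(1) by (simp add: right_diff_distrib sum_subtractf weighted_mean_def diff_divide_distrib mult.commute)
qed

text \<open>The rescaled fluctuation vector called \<open>G\<^sub>n\<^sub>m\<close> in the
  overview.\<close>

definition ot_dev ::
  "nat \<Rightarrow> (nat \<Rightarrow> real) \<Rightarrow> (nat \<Rightarrow> real) \<Rightarrow> (nat \<Rightarrow> 'a \<Rightarrow> nat) \<Rightarrow> (nat \<Rightarrow> 'a \<Rightarrow> nat) \<Rightarrow> nat \<Rightarrow> nat \<Rightarrow> 'a \<Rightarrow> nat \<Rightarrow> real" where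
  "ot_dev N r s X Y n m \<omega> a =
     ot_scale n m * (ot_marg N (ot_empirical X n \<omega>) (ot_empirical Y m \<omega>) a - ot_marg N r s a)"

text \<open>Cramer-Wold form: a linear functional of the fluctuations is a sum of centred
  contributions of single observations. An observation in the last row has no constraint of its own,
  so \<open>\<xi>\<close> is 0 there.\<close>

lemma sum_ot_dev:
  assumes N: "N \<ge> 1" and nm: "n \<ge> 1" "m \<ge> 1" and X: "\<And>k. X k \<omega> < N" and Y: "\<And>k. Y k \<omega> < N"
  defines "\<xi> \<equiv> \<lambda>u :: nat \<Rightarrow> real. \<lambda>x. if x < N - 1 then u x else 0" and "\<eta> \<equiv> \<lambda>u :: nat \<Rightarrow> real. \<lambda>x. u (N - 1 + x)"
  shows "(\<Sum>a<2 * N - 1. u a * ot_dev N r s X Y n m \<omega> a)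
    = (\<Sum>k<n. ot_scale n m / real n * (\<xi> u (X k \<omega>) - weighted_mean N r (\<xi> u)))
    + (\<Sum>k<m. ot_scale n m / real m * (\<eta> u (Y k \<omega>) - weighted_mean N s (\<eta> u)))"
proof -
  let ?e = "ot_empirical X n \<omega>" and ?f = "ot_empirical Y m \<omega>"
  have "(\<Sum>a<2 * N - 1. u a * ot_dev N r s X Y n m \<omega> a)
      = (\<Sum>a<N - 1. ot_scale n m * (u a * (?e a - r a))) + (\<Sum>b<N. ot_scale n m * (\<eta> u b * (?f b - s b)))"
    unfolding sum_reduced_index[OF N]
    by (intro arg_cong2[where f="(+)"] sum.cong) (auto simp: ot_dev_def ot_marg_def \<eta>_def)
  also have "(\<Sum>a<N - 1. ot_scale n m * (u a * (?e a - r a))) = (\<Sum>x<N. ot_scale n m * (\<xi> u x * (?e x - r x)))"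
    by (intro sum.mono_neutral_cong_left) (auto simp: \<xi>_def)
  finally show ?thesis
    unfolding sum_distrib_left[symmetric] 
      sum_ot_empirical_centred[where X=X and \<omega>=\<omega>, OF nm(1) X]
      sum_ot_empirical_centred[where X=Y and \<omega>=\<omega>, OF nm(2) Y]
    by simp
qed

lemma measurable_ot_dev:
  assumes [measurable]: "\<And>k. X k \<in> M \<rightarrow>\<^sub>M count_space UNIV" "\<And>k. Y k \<in> M \<rightarrow>\<^sub>M count_space UNIV"
  shows "ot_dev N r s X Y n m \<in> borel_measurable M"
proof (rule measurable_coordinatewise_then_product)
  have *: "(\<lambda>\<omega>. ot_empirical Z k \<omega> x) \<in> borel_measurable M"
    if [measurable]: "\<And>k. Z k \<in> M \<rightarrow>\<^sub>M count_space UNIV" for Z :: "nat \<Rightarrow> 'a \<Rightarrow> nat" and k x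
    unfolding ot_empirical_eq by measurable
  show "(\<lambda>\<omega>. ot_dev N r s X Y n m \<omega> a) \<in> borel_measurable M" for a
    unfolding ot_dev_def ot_marg_def using *[of X] *[of Y] assms
    by (cases "a < N - 1"; cases "a < 2 * N - 1") simp_all
qed

lemma measurable_ot_Gvec:
  assumes "G1 \<in> borel_measurable P" "G2 \<in> borel_measurable P"
  shows "ot_Gvec N lam G1 G2 \<in> borel_measurable P"
proof (rule measurable_coordinatewise_then_product)
  show "(\<lambda>\<omega>. ot_Gvec N lam G1 G2 \<omega> a) \<in> borel_measurable P" for a
    unfolding ot_Gvec_def using assms[THEN measurable_coordinate]
    by (cases "a < N - 1"; cases "a < 2 * N - 1") simp_all
qed

lemma char_ot_Gvec:
  assumes N: "N \<ge> 1" and r: "rel_int_simplex N r" and s: "rel_int_simplex N s"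
    and lam: "0 < lam" "lam < 1" and P: "prob_space P"
    and G1: "centred_gaussian P (N - 1) (ot_Sig r) G1" and G2: "centred_gaussian P N (ot_Sig s) G2"
    and G12: "prob_space.indep_var P borel G1 borel G2"
  shows "(\<integral>\<omega>. iexp (\<Sum>a<2 * N - 1. u a * ot_Gvec N lam G1 G2 \<omega> a) \<partial>P)
    = of_real (exp (- ((lam * weighted_var N r (\<lambda>x. if x < N - 1 then u x else 0)
         + (1 - lam) * weighted_var N s (\<lambda>x. u (N - 1 + x))) / 2)))"
proof -
  interpret prob_space P by fact
  let ?u1 = "\<lambda>a. sqrt lam * u a" and ?u2 = "\<lambda>a. sqrt (1 - lam) * u (N - 1 + a)"
  let ?\<xi> = "\<lambda>x. if x < N - 1 then u x else 0" and ?\<eta> = "\<lambda>x. u (N - 1 + x)"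
  let ?L1 = "\<lambda>g. \<Sum>i<N - 1. ?u1 i * g i" and ?L2 = "\<lambda>g. \<Sum>i<N. ?u2 i * g i"
  have r1: "\<And>x. x < N \<Longrightarrow> 0 \<le> r x" "(\<Sum>x<N. r x) = 1" and s1: "\<And>x. x < N \<Longrightarrow> 0 \<le> s x" "(\<Sum>x<N. s x) = 1"
    using r s by (auto simp: rel_int_simplex_def less_imp_le)
  have [measurable]: "G1 \<in> borel_measurable P" "G2 \<in> borel_measurable P"
    using G1 G2 by (simp_all add: centred_gaussian_def)
  note [measurable] = measurable_coordinate
  have split: "(\<Sum>a<2 * N - 1. u a * ot_Gvec N lam G1 G2 \<omega> a) = ?L1 (G1 \<omega>) + ?L2 (G2 \<omega>)" for \<omega>
    unfolding sum_reduced_index[OF N]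
    by (intro arg_cong2[where f="(+)"] sum.cong) (auto simp: ot_Gvec_def)
  have "(\<Sum>i<N - 1. \<Sum>j<N - 1. ?u1 i * ot_Sig r i j * ?u1 j) = weighted_var N r (\<lambda>x. if x < N - 1 then ?u1 x else 0)"
    by (rule quad_ot_Sig_var) (use r1 in auto)
  also have "\<dots> = weighted_var N r (\<lambda>x. sqrt lam * ?\<xi> x)" by (rule weighted_var_cong) simp
  finally have v1: "lam * weighted_var N r ?\<xi> = (\<Sum>i<N - 1. \<Sum>j<N - 1. ?u1 i * ot_Sig r i j * ?u1 j)"
    using lam by (simp add: weighted_var_scale)
  have "(\<Sum>i<N. \<Sum>j<N. ?u2 i * ot_Sig s i j * ?u2 j) = weighted_var N s (\<lambda>x. if x < N then ?u2 x else 0)"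
    by (rule quad_ot_Sig_var) (use s1 in auto)
  also have "\<dots> = weighted_var N s (\<lambda>x. sqrt (1 - lam) * ?\<eta> x)" by (rule weighted_var_cong) simp
  finally have v2: "(1 - lam) * weighted_var N s ?\<eta> = (\<Sum>i<N. \<Sum>j<N. ?u2 i * ot_Sig s i j * ?u2 j)"
    using lam by (simp add: weighted_var_scale)
  have c1: "(\<integral>\<omega>. iexp (?L1 (G1 \<omega>)) \<partial>P) = of_real (exp (- (lam * weighted_var N r ?\<xi> / 2)))"
    by (rule char_centred_gaussian[OF P G1 v1]) (use lam r1 in \<open>auto intro!: mult_nonneg_nonneg weighted_var_nonneg\<close>)
  have c2: "(\<integral>\<omega>. iexp (?L2 (G2 \<omega>)) \<partial>P) = of_real (exp (- ((1 - lam) * weighted_var N s ?\<eta> / 2)))"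
    by (rule char_centred_gaussian[OF P G2 v2]) (use lam s1 in \<open>auto intro!: mult_nonneg_nonneg weighted_var_nonneg\<close>)
  have mL: "(\<lambda>g. iexp (\<Sum>i<k. w i * g i)) \<in> borel_measurable borel" for k and w :: "nat \<Rightarrow> real"
    by (intro borel_measurable_continuous_onI continuous_intros continuous_on_product_coordinates)
  have ind: "indep_var borel (\<lambda>\<omega>. iexp (?L1 (G1 \<omega>))) borel (\<lambda>\<omega>. iexp (?L2 (G2 \<omega>)))"
    using indep_var_compose[OF G12 mL[of ?u1 "N - 1"] mL[of ?u2 N]] by (simp only: comp_def)
  have "(\<integral>\<omega>. iexp (?L1 (G1 \<omega>)) * iexp (?L2 (G2 \<omega>)) \<partial>P) = (\<integral>\<omega>. iexp (?L1 (G1 \<omega>)) \<partial>P) * (\<integral>\<omega>. iexp (?L2 (G2 \<omega>)) \<partial>P)"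
    by (rule indep_var_lebesgue_integral[OF ind]; rule iexp_integrable[OF P]; measurable)
  moreover have "iexp (x + y) = iexp x * iexp y" for x y :: real by (simp add: distrib_left exp_add)
  ultimately have "(\<integral>\<omega>. iexp (?L1 (G1 \<omega>) + ?L2 (G2 \<omega>)) \<partial>P)
    = of_real (exp (- (lam * weighted_var N r ?\<xi> / 2)) * exp (- ((1 - lam) * weighted_var N s ?\<eta> / 2)))"
    unfolding c1 c2 of_real_mult by (simp only:)
  then show ?thesis
    unfolding split exp_add[symmetric] by (simp add: add_divide_distrib)
qed

lemma ot_clt:
  fixes X Y :: "nat \<Rightarrow> 'a \<Rightarrow> nat" and P :: "'b measure"
  assumes N: "N \<ge> 1" and r: "rel_int_simplex N r" and s: "rel_int_simplex N s"
    and M: "prob_space M"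
    and indep: "prob_space.indep_vars M (\<lambda>_. count_space UNIV) (\<lambda>i. case i of Inl k \<Rightarrow> X k | Inr k \<Rightarrow> Y k) UNIV"
    and X_range: "\<And>k \<omega>. \<omega> \<in> space M \<Longrightarrow> X k \<omega> < N" and Y_range: "\<And>k \<omega>. \<omega> \<in> space M \<Longrightarrow> Y k \<omega> < N"
    and X_law: "\<And>k x. x < N \<Longrightarrow> measure M {\<omega>\<in>space M. X k \<omega> = x} = r x"
    and Y_law: "\<And>k x. x < N \<Longrightarrow> measure M {\<omega>\<in>space M. Y k \<omega> = x} = s x"
    and X_meas: "\<And>k. X k \<in> M \<rightarrow>\<^sub>M count_space UNIV" and Y_meas: "\<And>k. Y k \<in> M \<rightarrow>\<^sub>M count_space UNIV"
    and n: "filterlim n at_top sequentially" and m: "filterlim m at_top sequentially"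
    and ratio: "(\<lambda>t. real (m t) / real (n t + m t)) \<longlonglongrightarrow> lam"
    and lam: "0 < lam" "lam < 1" and P: "prob_space P"
    and G1: "centred_gaussian P (N - 1) (ot_Sig r) G1" and G2: "centred_gaussian P N (ot_Sig s) G2"
    and G12: "prob_space.indep_var P borel G1 borel G2"
  shows "conv_distr M (\<lambda>t. ot_dev N r s X Y (n t) (m t)) P (ot_Gvec N lam G1 G2)"
proof (rule levy_continuity_vector[OF M P])
  show "ot_dev N r s X Y (n t) (m t) \<in> borel_measurable M" for t by (rule measurable_ot_dev[OF X_meas Y_meas])
  show "ot_Gvec N lam G1 G2 \<in> borel_measurable P"
    using G1 G2 by (intro measurable_ot_Gvec) (simp_all add: centred_gaussian_def)
  show "ot_dev N r s X Y (n t) (m t) \<omega> \<in> vec_space (2 * N - 1)" for t \<omega>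
    by (auto simp: vec_space_def ot_dev_def ot_marg_def)
  show "ot_Gvec N lam G1 G2 \<omega> \<in> vec_space (2 * N - 1)" for \<omega>
    by (auto simp: vec_space_def ot_Gvec_def)
  fix u :: "nat \<Rightarrow> real"
  let ?\<xi> = "\<lambda>x. if x < N - 1 then u x else 0" and ?\<eta> = "\<lambda>x. u (N - 1 + x)"
  let ?a = "\<lambda>t. ot_scale (n t) (m t) / real (n t)" and ?b = "\<lambda>t. ot_scale (n t) (m t) / real (m t)"
  have r1: "\<And>x. x < N \<Longrightarrow> 0 \<le> r x" "(\<Sum>x<N. r x) = 1" and s1: "\<And>x. x < N \<Longrightarrow> 0 \<le> s x" "(\<Sum>x<N. s x) = 1"
    using r s by (auto simp: rel_int_simplex_def less_imp_le)
  have pos: "eventually (\<lambda>t. n t \<ge> 1 \<and> m t \<ge> 1) sequentially"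
    using n m by (auto simp: filterlim_at_top intro: eventually_conj)
  have n0: "(\<lambda>t. 1 / real (n t)) \<longlonglongrightarrow> 0" and m0: "(\<lambda>t. 1 / real (m t)) \<longlonglongrightarrow> 0"
    using n m by (auto intro!: tendsto_divide_0[OF tendsto_const] filterlim_at_top_imp_at_infinity
        filterlim_compose[OF filterlim_real_sequentially])
  have sq: "(ot_scale k l)\<^sup>2 = real k * real l / (real k + real l)" for k l by (simp add: ot_scale_def)
  \<comment> \<open>The product is exactly \<open>m / (n + m)\<close> once both sample sizes are
    positive; for the second sample it is the complementary ratio
    \<open>n / (n + m)\<close>.\<close>
  have na: "(\<lambda>t. real (n t) * (?a t)\<^sup>2) \<longlonglongrightarrow> lam"
  proof (rule Lim_transform_eventually[OF ratio])
    show "eventually (\<lambda>t. real (m t) / real (n t + m t) = real (n t) * (?a t)\<^sup>2) sequentially"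
      using pos
    proof eventually_elim
      case (elim t)
      have "y / z = x * (x * y / z / x\<^sup>2)" if "x > 0" for x y z :: real
        using that by (simp add: power2_eq_square)
      from this[of "real (n t)" "real (m t)" "real (n t) + real (m t)"] elim
      show ?case by (simp add: power_divide sq)
    qed
  qed
  have "(\<lambda>t. 1 - real (m t) / real (n t + m t)) \<longlonglongrightarrow> 1 - lam" by (intro tendsto_intros ratio)
  then have mb: "(\<lambda>t. real (m t) * (?b t)\<^sup>2) \<longlonglongrightarrow> 1 - lam"
  proof (rule Lim_transform_eventually)
    show "eventually (\<lambda>t. 1 - real (m t) / real (n t + m t) = real (m t) * (?b t)\<^sup>2) sequentially"
      using pos
    proof eventually_elim
      case (elim t)
      have "1 - y / (x + y) = y * (x * y / (x + y) / y\<^sup>2)" if "x > 0" "y > 0" for x y :: real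
      proof -
        have "y * (x * y / (x + y) / y\<^sup>2) = x / (x + y)" using that by (simp add: power2_eq_square)
        then show ?thesis using that by (simp add: field_simps)
      qed
      from this[of "real (n t)" "real (m t)"] elim show ?case by (simp add: power_divide sq)
    qed
  qed
  \<comment> \<open>The scaling factor is recovered as the square root of \<open>1 / k\<close> times
    a convergent sequence.\<close>
  have to0: "(\<lambda>t. ot_scale (n t) (m t) / real (k t)) \<longlonglongrightarrow> 0"
    if k: "(\<lambda>t. 1 / real (k t)) \<longlonglongrightarrow> 0" "(\<lambda>t. real (k t) * (ot_scale (n t) (m t) / real (k t))\<^sup>2) \<longlonglongrightarrow> l"
      "eventually (\<lambda>t. k t \<ge> 1) sequentially" for k :: "nat \<Rightarrow> nat" and l
  proof -
    have "(\<lambda>t. sqrt (1 / real (k t) * (real (k t) * (ot_scale (n t) (m t) / real (k t))\<^sup>2))) \<longlonglongrightarrow> sqrt (0 * l)"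
      by (intro tendsto_intros k)
    moreover have "eventually (\<lambda>t. sqrt (1 / real (k t) * (real (k t) * (ot_scale (n t) (m t) / real (k t))\<^sup>2))
        = ot_scale (n t) (m t) / real (k t)) sequentially"
      using k(3) by eventually_elim (auto simp: real_sqrt_divide ot_scale_def)
    ultimately show ?thesis using Lim_transform_eventually by force
  qed
  have a0: "?a \<longlonglongrightarrow> 0" by (rule to0[OF n0 na]) (use pos in \<open>auto elim: eventually_mono\<close>)
  have b0: "?b \<longlonglongrightarrow> 0" by (rule to0[OF m0 mb]) (use pos in \<open>auto elim: eventually_mono\<close>)
  have "(\<lambda>t. (\<Sum>x<N. r x * iexp (?a t * (?\<xi> x - weighted_mean N r ?\<xi>))) ^ n t
       * (\<Sum>x<N. s x * iexp (?b t * (?\<eta> x - weighted_mean N s ?\<eta>))) ^ m t)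
     \<longlonglongrightarrow> of_real (exp (- (lam * weighted_var N r ?\<xi> / 2))) * of_real (exp (- ((1 - lam) * weighted_var N s ?\<eta> / 2)))"
    by (intro tendsto_mult char_power_tendsto r1 s1 a0 b0 na mb)
  also have "of_real (exp (- (lam * weighted_var N r ?\<xi> / 2))) * of_real (exp (- ((1 - lam) * weighted_var N s ?\<eta> / 2)))
     = (\<integral>\<omega>. iexp (\<Sum>a<2 * N - 1. u a * ot_Gvec N lam G1 G2 \<omega> a) \<partial>P)"
    unfolding char_ot_Gvec[OF N r s lam P G1 G2 G12]
    by (simp only: of_real_mult[symmetric] exp_add[symmetric]) (simp add: add_divide_distrib)
  finally show "(\<lambda>t. \<integral>\<omega>. iexp (\<Sum>a<2 * N - 1. u a * ot_dev N r s X Y (n t) (m t) \<omega> a) \<partial>M)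
     \<longlonglongrightarrow> (\<integral>\<omega>. iexp (\<Sum>a<2 * N - 1. u a * ot_Gvec N lam G1 G2 \<omega> a) \<partial>P)"
  proof (rule Lim_transform_eventually)
    show "eventually (\<lambda>t. (\<Sum>x<N. r x * iexp (?a t * (?\<xi> x - weighted_mean N r ?\<xi>))) ^ n t
       * (\<Sum>x<N. s x * iexp (?b t * (?\<eta> x - weighted_mean N s ?\<eta>))) ^ m t
       = (\<integral>\<omega>. iexp (\<Sum>a<2 * N - 1. u a * ot_dev N r s X Y (n t) (m t) \<omega> a) \<partial>M)) sequentially"
      using pos
    proof eventually_elim
      case (elim t)
      have "(\<integral>\<omega>. iexp (\<Sum>a<2 * N - 1. u a * ot_dev N r s X Y (n t) (m t) \<omega> a) \<partial>M)
        = (\<integral>\<omega>. iexp ((\<Sum>k<n t. ?a t * (?\<xi> (X k \<omega>) - weighted_mean N r ?\<xi>))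
                + (\<Sum>k<m t. ?b t * (?\<eta> (Y k \<omega>) - weighted_mean N s ?\<eta>))) \<partial>M)"
      proof (rule Bochner_Integration.integral_cong[OF refl])
        fix \<omega> assume w: "\<omega> \<in> space M"
        show "iexp (\<Sum>a<2 * N - 1. u a * ot_dev N r s X Y (n t) (m t) \<omega> a)
          = iexp ((\<Sum>k<n t. ?a t * (?\<xi> (X k \<omega>) - weighted_mean N r ?\<xi>))
                + (\<Sum>k<m t. ?b t * (?\<eta> (Y k \<omega>) - weighted_mean N s ?\<eta>)))"
          using sum_ot_dev[OF N, of "n t" "m t" X \<omega> Y u r s] elim X_range[OF w] Y_range[OF w] by (simp only:)
      qed
      also have "\<dots> = (\<Sum>x<N. r x * iexp (?a t * (?\<xi> x - weighted_mean N r ?\<xi>))) ^ n t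
       * (\<Sum>x<N. s x * iexp (?b t * (?\<eta> x - weighted_mean N s ?\<eta>))) ^ m t"
        by (rule char_two_samples[OF M indep X_range Y_range X_law Y_law])
      finally show ?case ..
    qed
  qed
qed

text \<open>Positivity of the variance has to be demanded because the limit vector is degenerate in
  the total-mass direction.\<close>

lemma AE_ot_Gvec_neq_0:
  assumes N: "N \<ge> 1" and r: "rel_int_simplex N r" and s: "rel_int_simplex N s"
    and lam: "0 < lam" "lam < 1" and P: "prob_space P"
    and G1: "centred_gaussian P (N - 1) (ot_Sig r) G1" and G2: "centred_gaussian P N (ot_Sig s) G2"
    and G12: "prob_space.indep_var P borel G1 borel G2"
    and v: "0 < lam * weighted_var N r (\<lambda>x. if x < N - 1 then u x else 0) + (1 - lam) * weighted_var N s (\<lambda>x. u (N - 1 + x))"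
  shows "AE \<omega> in P. (\<Sum>a<2 * N - 1. u a * ot_Gvec N lam G1 G2 \<omega> a) \<noteq> 0"
proof (rule AE_neq_0_of_gaussian_char[OF P _ v])
  note [measurable] = measurable_coordinate
  have [measurable]: "ot_Gvec N lam G1 G2 \<in> borel_measurable P"
    using G1 G2 by (intro measurable_ot_Gvec) (simp_all add: centred_gaussian_def)
  show "(\<lambda>\<omega>. \<Sum>a<2 * N - 1. u a * ot_Gvec N lam G1 G2 \<omega> a) \<in> borel_measurable P" by measurable
  fix x :: real
  let ?V = "weighted_var N r (\<lambda>x. if x < N - 1 then u x else 0)" and ?W = "weighted_var N s (\<lambda>x. u (N - 1 + x))"
  have "weighted_var N r (\<lambda>y. if y < N - 1 then x * u y else 0) = weighted_var N r (\<lambda>y. x * (if y < N - 1 then u y else 0))"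
    by (rule weighted_var_cong) simp
  then have V: "weighted_var N r (\<lambda>y. if y < N - 1 then x * u y else 0) = x\<^sup>2 * ?V" by (simp only: weighted_var_scale)
  have "(\<integral>\<omega>. iexp (x * (\<Sum>a<2 * N - 1. u a * ot_Gvec N lam G1 G2 \<omega> a)) \<partial>P)
      = (\<integral>\<omega>. iexp (\<Sum>a<2 * N - 1. (x * u a) * ot_Gvec N lam G1 G2 \<omega> a) \<partial>P)"
    by (simp only: sum_distrib_left mult.assoc)
  also have "\<dots> = of_real (exp (- ((lam * (x\<^sup>2 * ?V) + (1 - lam) * (x\<^sup>2 * ?W)) / 2)))"
    unfolding char_ot_Gvec[OF N r s lam P G1 G2 G12] V weighted_var_scale ..
  also have "lam * (x\<^sup>2 * ?V) + (1 - lam) * (x\<^sup>2 * ?W) = x\<^sup>2 * (lam * ?V + (1 - lam) * ?W)"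
    by (simp add: algebra_simps)
  finally show "(\<integral>\<omega>. iexp (x * (\<Sum>a<2 * N - 1. u a * ot_Gvec N lam G1 G2 \<omega> a)) \<partial>P)
      = of_real (exp (- (x\<^sup>2 * (lam * ?V + (1 - lam) * ?W) / 2)))" .
qed

section \<open>From the cones to the limit law\<close>

text \<open>The conditions in the limit law say that this set equals \<open>S\<close>, so the
  patterns \<open>S\<close> partition the space and at most one indicator in the sum is
  nonzero.\<close>

definition active_cones :: "nat \<Rightarrow> (nat \<Rightarrow> real) \<Rightarrow> (nat \<Rightarrow> nat set) \<Rightarrow> nat \<Rightarrow> (nat \<Rightarrow> real) \<Rightarrow> nat set" where
  "active_cones N ps Ib K v = {k. k < K \<and> v \<in> ot_Hcone N ps (Ib k)}"

lemma active_cones_eq_iff: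
  assumes "S \<subseteq> {..<K}"
  shows "active_cones N ps Ib K v = S \<longleftrightarrow>
    v \<in> (\<Inter>k\<in>S. ot_Hcone N ps (Ib k)) - (\<Union>k\<in>{..<K} - S. ot_Hcone N ps (Ib k))"
  using assms by (auto simp: active_cones_def)

lemma continuous_basic_sol: "continuous_on UNIV (\<lambda>v. basic_sol N I v i)"
  unfolding basic_sol_def
  by (cases "i \<in> I") (auto intro!: continuous_intros continuous_on_product_coordinates)

text \<open>Off the bounding hyperplanes the finitely many coordinates that define the cones keep
  their signs in a neighbourhood.\<close>

lemma active_cones_locally_constant:
  fixes v0 :: "nat \<Rightarrow> real"
  assumes fin: "\<And>k. k < K \<Longrightarrow> finite (Ib k)"
    and nz: "\<And>k i. k < K \<Longrightarrow> i \<in> Ib k \<Longrightarrow> \<not> ps i > 0 \<Longrightarrow> basic_sol N (Ib k) v0 i \<noteq> 0"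
  shows "eventually (\<lambda>v. active_cones N ps Ib K v = active_cones N ps Ib K v0) (nhds v0)"
proof -
  let ?same = "\<lambda>v k i. (0 \<le> basic_sol N (Ib k) v i) = (0 \<le> basic_sol N (Ib k) v0 i)"
  have "eventually (\<lambda>v. \<forall>k\<in>{..<K}. \<forall>i\<in>Ib k. \<not> ps i > 0 \<longrightarrow> ?same v k i) (nhds v0)"
  proof (intro eventually_ball_finite ballI fin)
    fix k i assume k: "k \<in> {..<K}" and i: "i \<in> Ib k"
    show "eventually (\<lambda>v. \<not> ps i > 0 \<longrightarrow> ?same v k i) (nhds v0)"
    proof (cases "ps i > 0")
      case False
      have "isCont (\<lambda>v. basic_sol N (Ib k) v i) v0"
        using continuous_basic_sol by (auto simp: continuous_on_eq_continuous_at)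
      then have lim: "((\<lambda>v. basic_sol N (Ib k) v i) \<longlongrightarrow> basic_sol N (Ib k) v0 i) (nhds v0)"
        by (simp only: isCont_def tendsto_at_iff_tendsto_nhds[of "\<lambda>v. basic_sol N (Ib k) v i"])
      have "basic_sol N (Ib k) v0 i \<noteq> 0" using nz k i False by auto
      then consider "basic_sol N (Ib k) v0 i > 0" | "basic_sol N (Ib k) v0 i < 0" by linarith
      then show ?thesis
      proof cases
        case 1
        from order_tendstoD(1)[OF lim 1] show ?thesis by eventually_elim (use 1 in auto)
      next
        case 2
        from order_tendstoD(2)[OF lim 2] show ?thesis by eventually_elim (use 2 in auto)
      qed
    qed simp
  qed auto
  then show ?thesis
    by eventually_elim (auto simp: active_cones_def ot_Hcone_def)
qed

text \<open>Here \<open>w\<close> stands for the empirical marginals and \<open>\<sigma>\<close> for the scaling of the fluctuations.\<close>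
lemma feasibility_via_cones:
  assumes bas: "\<And>k. k < Nprime \<Longrightarrow> ot_is_basis N (Ib k)" and KN: "K \<le> Nprime"
    and primal: "\<And>k. k < Nprime \<Longrightarrow> k < K \<longleftrightarrow> (\<forall>i. 0 \<le> basic_sol N (Ib k) v0 i)"
    and ps: "\<And>k. k < K \<Longrightarrow> basic_sol N (Ib k) v0 = ps"
  shows "\<exists>\<delta>>0. \<forall>\<sigma> w. \<sigma> > 0 \<longrightarrow>
      (\<Sum>k<Nprime. \<Sum>i<N^2. \<bar>basic_sol N (Ib k) (\<lambda>a. \<sigma> * (w a - v0 a)) i\<bar>) < \<sigma> * \<delta> \<longrightarrow>
      feas_set N Nprime Ib w = active_cones N ps Ib K (\<lambda>a. \<sigma> * (w a - v0 a))"
proof -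
  \<comment> \<open>Candidates for the gap \<open>\<delta>\<close>: the nonzero absolute coordinates
    of all basic solutions at \<open>v0\<close>. The inserted 1 keeps the minimum defined when there
    are none.\<close>
  define D where "D = insert 1 ((\<lambda>(k, i). \<bar>basic_sol N (Ib k) v0 i\<bar>) ` ({..<Nprime} \<times> {..<N^2}) - {0})"
  have finD: "finite D" by (simp add: D_def)
  have Dpos: "0 < x" if "x \<in> D" for x using that by (auto simp: D_def)
  define \<delta> where "\<delta> = Min D"
  have \<delta>: "\<delta> > 0" unfolding \<delta>_def by (rule Dpos[OF Min_in[OF finD]]) (simp add: D_def)
  have gap: "\<delta> \<le> \<bar>basic_sol N (Ib k) v0 i\<bar>" if "k < Nprime" "i < N^2" "basic_sol N (Ib k) v0 i \<noteq> 0" for k i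
  proof -
    have "\<bar>basic_sol N (Ib k) v0 i\<bar> \<in> (\<lambda>(k, i). \<bar>basic_sol N (Ib k) v0 i\<bar>) ` ({..<Nprime} \<times> {..<N^2})"
      using that(1,2) by (intro image_eqI[of _ _ "(k, i)"]) simp_all
    then show ?thesis unfolding \<delta>_def using that(3) by (intro Min_le[OF finD]) (simp add: D_def)
  qed
  have "feas_set N Nprime Ib w = active_cones N ps Ib K (\<lambda>a. \<sigma> * (w a - v0 a))"
    if \<sigma>: "\<sigma> > 0"
      and small: "(\<Sum>k<Nprime. \<Sum>i<N^2. \<bar>basic_sol N (Ib k) (\<lambda>a. \<sigma> * (w a - v0 a)) i\<bar>) < \<sigma> * \<delta>" for \<sigma> w
  proof -
    let ?b = "\<lambda>k i. basic_sol N (Ib k) v0 i" and ?w = "\<lambda>k i. basic_sol N (Ib k) w i"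
    have dir: "basic_sol N (Ib k) (\<lambda>a. \<sigma> * (w a - v0 a)) i = \<sigma> * (?w k i - ?b k i)" for k i
      by (simp add: basic_sol_scale basic_sol_diff)
    \<comment> \<open>A deviation below the gap cannot change the sign of a coordinate that is
      nonzero at \<open>v0\<close>. Only coordinates vanishing at \<open>v0\<close> depend on the
      direction, and for \<open>k < K\<close> those inside the basis are the ones tested by the
      cone.\<close>
    have close: "\<bar>?w k i - ?b k i\<bar> < \<delta>" if "k < Nprime" "i < N^2" for k i
    proof -
      have "\<bar>\<sigma> * (?w k i - ?b k i)\<bar> \<le> (\<Sum>i<N^2. \<bar>basic_sol N (Ib k) (\<lambda>a. \<sigma> * (w a - v0 a)) i\<bar>)"
        unfolding dir using that by (intro member_le_sum) auto
      also have "\<dots> \<le> (\<Sum>k<Nprime. \<Sum>i<N^2. \<bar>basic_sol N (Ib k) (\<lambda>a. \<sigma> * (w a - v0 a)) i\<bar>)"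
        using that
        by (intro member_le_sum[of k _ "\<lambda>k. \<Sum>i<N^2. \<bar>basic_sol N (Ib k) (\<lambda>a. \<sigma> * (w a - v0 a)) i\<bar>"] sum_nonneg) auto
      also note small
      finally show ?thesis using \<sigma> by (simp add: abs_mult)
    qed
    have idx: "i < N^2" if "k < Nprime" "i \<in> Ib k" for k i
      using ot_is_basisD(2)[OF bas[OF that(1)]] that(2) by auto
    show ?thesis
    proof (intro set_eqI iffI)
      fix k assume "k \<in> feas_set N Nprime Ib w"
      then have k: "k < Nprime" and f: "\<And>i. 0 \<le> ?w k i" by (auto simp: feas_set_def)
      have "0 \<le> ?b k i" for i
      proof (rule ccontr)
        assume neg: "\<not> 0 \<le> ?b k i"
        then have "i \<in> Ib k" using basic_sol_off[of i "Ib k" N v0] by force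
        then have i: "i < N^2" using idx k by blast
        show False using gap[OF k i] close[OF k i] f[of i] neg by linarith
      qed
      then have kK: "k < K" using primal k by blast
      have "0 \<le> basic_sol N (Ib k) (\<lambda>a. \<sigma> * (w a - v0 a)) i" if "i \<in> Ib k" "\<not> ps i > 0" for i
      proof -
        have "?b k i = 0" using that(2) \<open>0 \<le> ?b k i\<close> ps[OF kK] by simp
        then show ?thesis unfolding dir using f[of i] \<sigma> by simp
      qed
      then show "k \<in> active_cones N ps Ib K (\<lambda>a. \<sigma> * (w a - v0 a))"
        using kK by (simp add: active_cones_def ot_Hcone_def)
    next
      fix k assume "k \<in> active_cones N ps Ib K (\<lambda>a. \<sigma> * (w a - v0 a))"
      then have kK: "k < K" and H: "\<And>i. i \<in> Ib k \<Longrightarrow> \<not> ps i > 0 \<Longrightarrow> 0 \<le> \<sigma> * (?w k i - ?b k i)"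
        by (auto simp: active_cones_def ot_Hcone_def dir)
      have k: "k < Nprime" using kK KN by simp
      have "0 \<le> ?w k i" for i
      proof (cases "i \<in> Ib k")
        case True
        then have i: "i < N^2" using idx k by blast
        show ?thesis
        proof (cases "ps i > 0")
          case True
          then show ?thesis using gap[OF k i] close[OF k i] ps[OF kK] by auto
        next
          case False
          have "0 \<le> ?w k i - ?b k i" using H[OF \<open>i \<in> Ib k\<close> False] \<sigma> by (simp add: zero_le_mult_iff)
          moreover have "0 \<le> ?b k i" using primal[OF k] kK by blast
          ultimately show ?thesis by linarith
        qed
      qed (simp add: basic_sol_off)
      then show "k \<in> feas_set N Nprime Ib w" using k by (simp add: feas_set_def)
    qed
  qed
  then show ?thesis using \<delta> by blast
qed

section \<open>Convergence of weighted combinations over random patterns\<close>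

text \<open>Supplies the joint convergence when the weights are deterministic: for the empty
  pattern, and for the weights that select a single basis.\<close>

lemma conv_distr_const_Pair:
  fixes c :: "'c::topological_space" and Xs :: "nat \<Rightarrow> 'a \<Rightarrow> 'd::topological_space"
  assumes "conv_distr M Xs P X"
  shows "conv_distr M (\<lambda>t \<omega>. (c, Xs t \<omega>)) P (\<lambda>\<omega>. (c, X \<omega>))"
  unfolding conv_distr_def
proof (intro allI impI)
  fix h :: "'c \<times> 'd \<Rightarrow> real" assume h: "continuous_on UNIV h" "bounded (range h)"
  have "continuous_on UNIV (\<lambda>v. h (c, v))"
    by (intro continuous_on_compose2[OF h(1)] continuous_intros) auto
  moreover have "bounded (range (\<lambda>v. h (c, v)))" by (rule bounded_subset[OF h(2)]) auto
  ultimately show "(\<lambda>t. \<integral>\<omega>. h (c, Xs t \<omega>) \<partial>M) \<longlonglongrightarrow> (\<integral>\<omega>. h (c, X \<omega>) \<partial>P)"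
    using assms unfolding conv_distr_def by blast
qed

text \<open>A continuous mapping theorem for a limit glued together from the patterns. The formula
  for \<open>Z t\<close> has to hold only off events \<open>A t\<close> of vanishing probability,
  and \<open>joint\<close> is used for each \<open>S\<close> separately.\<close>

lemma conv_distr_mixture:
  fixes dev Z :: "nat \<Rightarrow> 'a \<Rightarrow> nat \<Rightarrow> real" and G :: "'b \<Rightarrow> nat \<Rightarrow> real"
    and \<alpha> :: "nat set \<Rightarrow> nat \<Rightarrow> 'a \<Rightarrow> nat \<Rightarrow> real" and \<alpha>lim :: "nat set \<Rightarrow> 'b \<Rightarrow> nat \<Rightarrow> real"
  assumes M: "prob_space M" and P: "prob_space P"
    and dev: "\<And>t. dev t \<in> borel_measurable M" and G: "G \<in> borel_measurable P"
    and conv: "conv_distr M dev P G"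
    and fin: "\<And>k. k < K \<Longrightarrow> finite (Ib k)"
    and nz: "\<And>k i. k < K \<Longrightarrow> i \<in> Ib k \<Longrightarrow> \<not> ps i > 0 \<Longrightarrow> AE \<omega> in P. basic_sol N (Ib k) (G \<omega>) i \<noteq> 0"
    and \<alpha>: "\<And>S. S \<noteq> {} \<Longrightarrow> S \<subseteq> {..<K} \<Longrightarrow> eventually (\<lambda>t. \<alpha> S t \<in> borel_measurable M) sequentially"
    and \<alpha>lim: "\<And>S. S \<noteq> {} \<Longrightarrow> S \<subseteq> {..<K} \<Longrightarrow> \<alpha>lim S \<in> borel_measurable P"
    and joint: "\<And>S. S \<noteq> {} \<Longrightarrow> S \<subseteq> {..<K} \<Longrightarrow>
        conv_distr M (\<lambda>t \<omega>. (\<alpha> S t \<omega>, dev t \<omega>)) P (\<lambda>\<omega>. (\<alpha>lim S \<omega>, G \<omega>))"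
    and Z: "eventually (\<lambda>t. Z t \<in> borel_measurable M) sequentially"
    and bad: "\<And>t. A t \<in> sets M" "(\<lambda>t. measure M (A t)) \<longlonglongrightarrow> 0"
    and good: "eventually (\<lambda>t. \<forall>\<omega>\<in>space M - A t.
        active_cones N ps Ib K (dev t \<omega>) \<noteq> {} \<and>
        Z t \<omega> = (\<lambda>i. \<Sum>k\<in>active_cones N ps Ib K (dev t \<omega>).
             \<alpha> (active_cones N ps Ib K (dev t \<omega>)) t \<omega> k * basic_sol N (Ib k) (dev t \<omega>) i)) sequentially"
  shows "conv_distr M Z P (\<lambda>\<omega> i. \<Sum>S\<in>{S. S \<noteq> {} \<and> S \<subseteq> {..<K}}.
      (if active_cones N ps Ib K (G \<omega>) = S then (\<Sum>k\<in>S. \<alpha>lim S \<omega> k * basic_sol N (Ib k) (G \<omega>) i) else 0))"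
  unfolding conv_distr_def
proof (intro allI impI)
  interpret M: prob_space M by fact
  interpret P: prob_space P by fact
  fix f :: "(nat \<Rightarrow> real) \<Rightarrow> real" assume f: "continuous_on UNIV f" and "bounded (range f)"
  then obtain B where B: "\<And>x. \<bar>f x\<bar> \<le> B" by (auto simp: bounded_iff)
  then have B0: "B \<ge> 0" by (meson abs_ge_zero order_trans)
  have [measurable]: "f \<in> borel_measurable borel" using f by (rule borel_measurable_continuous_onI)
  let ?act = "active_cones N ps Ib K"
  let ?F = "\<lambda>S x i. \<Sum>k\<in>S. fst x k * basic_sol N (Ib k) (snd x) i"
  have finS: "finite (Pow {..<K})" by simp
  have F: "continuous_on UNIV (\<lambda>x :: (nat \<Rightarrow> real) \<times> (nat \<Rightarrow> real). f (?F S x))" for S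
  proof (rule continuous_on_compose2[OF f])
    show "continuous_on UNIV (?F S)"
      by (intro continuous_on_coordinatewise_then_product continuous_on_sum continuous_on_mult
          continuous_on_compose2[OF continuous_on_product_coordinates continuous_on_fst]
          continuous_on_compose2[OF continuous_basic_sol continuous_on_snd] continuous_on_id) auto
  qed simp
  \<comment> \<open>The share of the test function that belongs to pattern \<open>S\<close>. It
    involves the weights of that pattern only, and the shares add up to the value of
    \<open>f\<close> at the combination for the active pattern.\<close>
  define g where "g S x = (if ?act (snd x) = S then f (?F S x) else 0)"
    for S and x :: "(nat \<Rightarrow> real) \<times> (nat \<Rightarrow> real)"
  have bsol[measurable]: "(\<lambda>v. basic_sol N (Ib k) v i) \<in> borel_measurable borel" for k i
    by (rule borel_measurable_continuous_onI[OF continuous_basic_sol])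
  have act[measurable]: "Measurable.pred borel (\<lambda>v. ?act v = S)" if S: "S \<subseteq> {..<K}" for S
  proof -
    have "?act v = S \<longleftrightarrow> (\<forall>k\<in>{..<K}. (k \<in> S) = (\<forall>i\<in>(if k < K then Ib k else {}). \<not> ps i > 0 \<longrightarrow> 0 \<le> basic_sol N (Ib k) v i))" for v
      using S by (auto simp: active_cones_def ot_Hcone_def)
    moreover have "Measurable.pred borel (\<lambda>v. \<forall>k\<in>{..<K}. (k \<in> S) = (\<forall>i\<in>(if k < K then Ib k else {}). \<not> ps i > 0 \<longrightarrow> 0 \<le> basic_sol N (Ib k) v i))"
      by (intro pred_intros_finite pred_intros_logic) (auto intro: fin, measurable)
    ultimately show ?thesis by simp
  qed
  have g_meas[measurable]: "g S \<in> borel_measurable borel" if S: "S \<subseteq> {..<K}" for S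
  proof -
    have [measurable]: "(\<lambda>x. f (?F S x)) \<in> borel_measurable borel" by (rule borel_measurable_continuous_onI[OF F])
    have [measurable]: "(snd :: (nat \<Rightarrow> real) \<times> (nat \<Rightarrow> real) \<Rightarrow> _) \<in> borel_measurable borel"
      by (intro borel_measurable_continuous_onI continuous_intros)
    have [measurable]: "Measurable.pred borel (\<lambda>x :: (nat \<Rightarrow> real) \<times> (nat \<Rightarrow> real). ?act (snd x) = S)"
      using act[OF S] by measurable
    show ?thesis unfolding g_def by measurable
  qed
  have gB: "\<bar>g S x\<bar> \<le> B" for S x using B B0 by (simp add: g_def)
  define Q where "Q = (SIGMA k:{..<K}. {i \<in> Ib k. \<not> ps i > 0})"
  have finQ: "finite Q" unfolding Q_def using fin by (intro finite_SigmaI) auto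
  \<comment> \<open>Vanishes exactly on the hyperplanes that bound the cones; elsewhere the pattern
    is locally constant and each \<open>g S\<close> is continuous.\<close>
  define q where "q x = (\<Prod>(k, i)\<in>Q. \<bar>basic_sol N (Ib k) (snd x) i\<bar>)" for x :: "(nat \<Rightarrow> real) \<times> (nat \<Rightarrow> real)"
  have q_cont: "continuous_on UNIV q" unfolding q_def case_prod_beta
    by (intro continuous_intros continuous_on_compose2[OF continuous_basic_sol continuous_on_snd] continuous_on_id) auto
  have q_nn: "0 \<le> q x" for x by (auto simp: q_def intro!: prod_nonneg)
  have g_cont: "isCont (g S) x" if "q x > 0" for S x
  proof -
    have nz': "basic_sol N (Ib k) (snd x) i \<noteq> 0" if "k < K" "i \<in> Ib k" "\<not> ps i > 0" for k i
    proof
      assume "basic_sol N (Ib k) (snd x) i = 0"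
      then have "q x = 0" unfolding q_def using that finQ by (intro prod_zero bexI[of _ "(k, i)"]) (auto simp: Q_def)
      then show False using \<open>q x > 0\<close> by simp
    qed
    have "eventually (\<lambda>v. ?act v = ?act (snd x)) (nhds (snd x))"
      by (rule active_cones_locally_constant[OF fin nz'])
    moreover have "filterlim snd (nhds (snd x)) (nhds x)"
      using tendsto_snd[OF tendsto_ident_at, of x UNIV] by (simp add: tendsto_at_iff_tendsto_nhds)
    ultimately have ev: "eventually (\<lambda>y. ?act (snd y) = ?act (snd x)) (nhds x)"
      by (rule eventually_compose_filterlim)
    show ?thesis
    proof (cases "?act (snd x) = S")
      case True
      have "eventually (\<lambda>y. g S y = f (?F S y)) (nhds x)"
        using ev by eventually_elim (simp add: g_def True)
      moreover have "isCont (\<lambda>x. f (?F S x)) x" 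
        using F[of S, unfolded continuous_on_eq_continuous_at[OF open_UNIV]] by (rule bspec) simp
      ultimately show ?thesis by (simp add: isCont_cong)
    next
      case False
      have "eventually (\<lambda>y. g S y = 0) (nhds x)"
        using ev by eventually_elim (simp add: g_def False)
      then show ?thesis by (simp add: isCont_cong)
    qed
  qed
  \<comment> \<open>No weights are given for the empty pattern. A constant completes the family, so
    that the sums over \<open>S\<close> exhaust all patterns; the empty one contributes
    \<open>f\<close> at the zero vector, in agreement with the limit formula outside all
    cones.\<close>
  define \<alpha>' where "\<alpha>' S t \<omega> = (if S = {} then \<lambda>_. 0 else \<alpha> S t \<omega>)" for S t \<omega>
  define \<alpha>lim' where "\<alpha>lim' S \<omega> = (if S = {} then \<lambda>_. 0 else \<alpha>lim S \<omega>)" for S \<omega>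
  have \<alpha>': "eventually (\<lambda>t. \<alpha>' S t \<in> borel_measurable M) sequentially" and \<alpha>lim': "\<alpha>lim' S \<in> borel_measurable P"
    and joint': "conv_distr M (\<lambda>t \<omega>. (\<alpha>' S t \<omega>, dev t \<omega>)) P (\<lambda>\<omega>. (\<alpha>lim' S \<omega>, G \<omega>))"
    if S: "S \<subseteq> {..<K}" for S
  proof -
    have "conv_distr M (\<lambda>t \<omega>. ((\<lambda>_. 0) :: nat \<Rightarrow> real, dev t \<omega>)) P (\<lambda>\<omega>. (\<lambda>_. 0, G \<omega>))"
      using conv by (rule conv_distr_const_Pair)
    then show "conv_distr M (\<lambda>t \<omega>. (\<alpha>' S t \<omega>, dev t \<omega>)) P (\<lambda>\<omega>. (\<alpha>lim' S \<omega>, G \<omega>))"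
      using joint[OF _ S] by (cases "S = {}") (simp_all add: \<alpha>'_def[abs_def] \<alpha>lim'_def[abs_def])
    show "eventually (\<lambda>t. \<alpha>' S t \<in> borel_measurable M) sequentially" "\<alpha>lim' S \<in> borel_measurable P"
      using \<alpha>[OF _ S] \<alpha>lim[OF _ S] by (cases "S = {}"; simp add: \<alpha>'_def[abs_def] \<alpha>lim'_def[abs_def])+
  qed
  have "AE \<omega> in P. \<forall>p\<in>Q. basic_sol N (Ib (fst p)) (G \<omega>) (snd p) \<noteq> 0"
    using nz finQ by (intro AE_finite_allI) (auto simp: Q_def)
  then have q_pos: "AE \<omega> in P. q (\<alpha>lim' S \<omega>, G \<omega>) > 0" for S
    by eventually_elim (auto simp: q_def case_prod_beta intro!: prod_pos)
  have pairM: "eventually (\<lambda>t. (\<lambda>\<omega>. (\<alpha>' S t \<omega>, dev t \<omega>)) \<in> borel_measurable M) sequentially"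
    and pairP: "(\<lambda>\<omega>. (\<alpha>lim' S \<omega>, G \<omega>)) \<in> borel_measurable P" if S: "S \<subseteq> {..<K}" for S
  proof -
    show "eventually (\<lambda>t. (\<lambda>\<omega>. (\<alpha>' S t \<omega>, dev t \<omega>)) \<in> borel_measurable M) sequentially"
      using \<alpha>'[OF S] by eventually_elim (intro borel_measurable_Pair dev)
    show "(\<lambda>\<omega>. (\<alpha>lim' S \<omega>, G \<omega>)) \<in> borel_measurable P" by (intro borel_measurable_Pair \<alpha>lim' S G)
  qed
  have lim1: "(\<lambda>t. \<integral>\<omega>. g S (\<alpha>' S t \<omega>, dev t \<omega>) \<partial>M) \<longlonglongrightarrow> (\<integral>\<omega>. g S (\<alpha>lim' S \<omega>, G \<omega>) \<partial>P)"
    if S: "S \<subseteq> {..<K}" for S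
    by (rule conv_distr_AE_continuous[OF M P joint'[OF S] pairM[OF S] pairP[OF S] g_meas[OF S] gB q_cont q_nn g_cont q_pos])
  define W where "W \<omega> = (\<Sum>S\<in>Pow {..<K}. g S (\<alpha>lim' S \<omega>, G \<omega>))" for \<omega>
  define Wt where "Wt t \<omega> = (\<Sum>S\<in>Pow {..<K}. g S (\<alpha>' S t \<omega>, dev t \<omega>))" for t \<omega>
  have sum_act: "(\<Sum>S\<in>Pow {..<K}. g S (a S, v)) = f (?F (?act v) (a (?act v), v))" for a v
  proof -
    have "(\<Sum>S\<in>Pow {..<K}. g S (a S, v)) = (\<Sum>S\<in>Pow {..<K}. if S = ?act v then f (?F (?act v) (a (?act v), v)) else 0)"
      by (intro sum.cong) (auto simp: g_def)
    moreover have "?act v \<in> Pow {..<K}" by (auto simp: active_cones_def)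
    ultimately show ?thesis by simp
  qed
  have gint_M: "eventually (\<lambda>t. integrable M (\<lambda>\<omega>. g S (\<alpha>' S t \<omega>, dev t \<omega>))) sequentially" if S: "S \<subseteq> {..<K}" for S
    using pairM[OF S]
    by eventually_elim (rule M.integrable_bounded[of _ B, OF measurable_compose[OF _ g_meas[OF S]] gB])
  have gint_P: "integrable P (\<lambda>\<omega>. g S (\<alpha>lim' S \<omega>, G \<omega>))" if S: "S \<subseteq> {..<K}" for S
    by (rule P.integrable_bounded[of _ B, OF measurable_compose[OF pairP[OF S] g_meas[OF S]] gB])
  have gint_M': "eventually (\<lambda>t. \<forall>S\<in>Pow {..<K}. integrable M (\<lambda>\<omega>. g S (\<alpha>' S t \<omega>, dev t \<omega>))) sequentially"
    by (intro eventually_ball_finite ballI gint_M) auto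
  have limW: "(\<lambda>t. \<integral>\<omega>. Wt t \<omega> \<partial>M) \<longlonglongrightarrow> (\<integral>\<omega>. W \<omega> \<partial>P)"
  proof -
    have "(\<lambda>t. \<Sum>S\<in>Pow {..<K}. \<integral>\<omega>. g S (\<alpha>' S t \<omega>, dev t \<omega>) \<partial>M) \<longlonglongrightarrow> (\<Sum>S\<in>Pow {..<K}. \<integral>\<omega>. g S (\<alpha>lim' S \<omega>, G \<omega>) \<partial>P)"
      by (intro tendsto_sum lim1) auto
    also have "(\<Sum>S\<in>Pow {..<K}. \<integral>\<omega>. g S (\<alpha>lim' S \<omega>, G \<omega>) \<partial>P) = (\<integral>\<omega>. W \<omega> \<partial>P)"
      unfolding W_def by (intro Bochner_Integration.integral_sum[symmetric] gint_P) auto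
    finally show ?thesis
    proof (rule Lim_transform_eventually)
      show "eventually (\<lambda>t. (\<Sum>S\<in>Pow {..<K}. \<integral>\<omega>. g S (\<alpha>' S t \<omega>, dev t \<omega>) \<partial>M) = (\<integral>\<omega>. Wt t \<omega> \<partial>M)) sequentially"
        using gint_M' by eventually_elim (simp add: Wt_def Bochner_Integration.integral_sum)
    qed
  qed
  let ?lim = "\<lambda>\<omega> i. \<Sum>S\<in>{S. S \<noteq> {} \<and> S \<subseteq> {..<K}}.
      (if ?act (G \<omega>) = S then (\<Sum>k\<in>S. \<alpha>lim S \<omega> k * basic_sol N (Ib k) (G \<omega>) i) else 0)"
  have W_eq: "f (?lim \<omega>) = W \<omega>" for \<omega>
  proof -
    have "?lim \<omega> = ?F (?act (G \<omega>)) (\<alpha>lim' (?act (G \<omega>)) \<omega>, G \<omega>)"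
    proof
      fix i
      have sub: "?act (G \<omega>) \<subseteq> {..<K}" by (auto simp: active_cones_def)
      have "?lim \<omega> i = (\<Sum>S\<in>{S. S \<noteq> {} \<and> S \<subseteq> {..<K}}. if S = ?act (G \<omega>)
          then (\<Sum>k\<in>?act (G \<omega>). \<alpha>lim (?act (G \<omega>)) \<omega> k * basic_sol N (Ib k) (G \<omega>) i) else 0)"
        by (intro sum.cong) auto
      also have "\<dots> = (if ?act (G \<omega>) \<noteq> {} then \<Sum>k\<in>?act (G \<omega>). \<alpha>lim (?act (G \<omega>)) \<omega> k * basic_sol N (Ib k) (G \<omega>) i else 0)"
        using sub by (simp add: finite_subset[OF _ finS] Pow_def)
      finally show "?lim \<omega> i = ?F (?act (G \<omega>)) (\<alpha>lim' (?act (G \<omega>)) \<omega>, G \<omega>) i"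
        by (cases "?act (G \<omega>) = {}") (simp_all add: \<alpha>lim'_def)
    qed
    then show ?thesis unfolding W_def sum_act by simp
  qed
  have intW: "integrable P W" unfolding W_def by (intro Bochner_Integration.integrable_sum gint_P) auto
  have intWt: "eventually (\<lambda>t. integrable M (Wt t)) sequentially"
    using gint_M' by eventually_elim (auto simp: Wt_def[abs_def])
  have WB: "\<bar>Wt t \<omega>\<bar> \<le> B" for t \<omega> unfolding Wt_def sum_act by (rule B)
  show "(\<lambda>t. \<integral>\<omega>. f (Z t \<omega>) \<partial>M) \<longlonglongrightarrow> (\<integral>\<omega>. f (?lim \<omega>) \<partial>P)"
    unfolding W_eq
  proof (rule integral_tendsto_approx[OF _ intW])
    show fZ: "eventually (\<lambda>t. integrable M (\<lambda>\<omega>. f (Z t \<omega>))) sequentially"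
      using Z by eventually_elim (rule M.integrable_bounded[of _ B], simp_all add: B)
    fix e :: real assume e: "e > 0"
    show "\<exists>hs h ws w.
        eventually (\<lambda>t. integrable M (hs t) \<and> integrable M (ws t) \<and>
            (\<forall>\<omega>\<in>space M. \<bar>f (Z t \<omega>) - hs t \<omega>\<bar> \<le> ws t \<omega>)) sequentially \<and>
        integrable P h \<and> integrable P w \<and> (\<forall>\<omega>\<in>space P. \<bar>W \<omega> - h \<omega>\<bar> \<le> w \<omega>) \<and>
        (\<lambda>t. integral\<^sup>L M (hs t)) \<longlonglongrightarrow> integral\<^sup>L P h \<and>
        (\<lambda>t. integral\<^sup>L M (ws t)) \<longlonglongrightarrow> integral\<^sup>L P w \<and> integral\<^sup>L P w < e"
    \<comment> \<open>There is no error in the limit. Before the limit it lives on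
      \<open>A t\<close>, where both quantities are bounded by \<open>B\<close>.\<close>
    proof (rule exI[of _ Wt], rule exI[of _ W], rule exI[of _ "\<lambda>t \<omega>. 2 * B * indicator (A t) \<omega>"],
        rule exI[of _ "\<lambda>_. 0"], intro conjI limW intW)
      show "eventually (\<lambda>t. integrable M (Wt t) \<and> integrable M (\<lambda>\<omega>. 2 * B * indicator (A t) \<omega>) \<and>
            (\<forall>\<omega>\<in>space M. \<bar>f (Z t \<omega>) - Wt t \<omega>\<bar> \<le> 2 * B * indicator (A t) \<omega>)) sequentially"
        using intWt good
      proof eventually_elim
        case (elim t)
        have "\<bar>f (Z t \<omega>) - Wt t \<omega>\<bar> \<le> 2 * B * indicator (A t) \<omega>" if w: "\<omega> \<in> space M" for \<omega>
        proof (cases "\<omega> \<in> A t")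
          case True
          then show ?thesis using B[of "Z t \<omega>"] WB[of t \<omega>] by simp
        next
          case False
          with elim w have *: "?act (dev t \<omega>) \<noteq> {}" "Z t \<omega> = ?F (?act (dev t \<omega>)) (\<alpha> (?act (dev t \<omega>)) t \<omega>, dev t \<omega>)"
            by auto
          have "f (Z t \<omega>) = Wt t \<omega>" unfolding Wt_def sum_act *(2) using *(1) by (simp add: \<alpha>'_def)
          then show ?thesis using B0 by simp
        qed
        moreover have "integrable M (\<lambda>\<omega>. 2 * B * indicator (A t) \<omega>)"
          using bad(1)[of t] by (intro integrable_mult_right integrable_real_indicator) (auto simp: M.emeasure_eq_measure)
        ultimately show ?case using elim(1) by blast
      qed
      have "(\<lambda>t. 2 * B * measure M (A t)) \<longlonglongrightarrow> 2 * B * 0" by (intro tendsto_intros bad(2))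
      then show "(\<lambda>t. \<integral>\<omega>. 2 * B * indicator (A t) \<omega> \<partial>M) \<longlonglongrightarrow> (\<integral>\<omega>. 0 \<partial>P)"
        using bad(1) by (simp add: sets.Int_space_eq2)
    qed (use e in auto)
  qed
qed

section \<open>The bounding hyperplanes are null sets for the limit\<close>

text \<open>Zero variance would make \<open>u\<close> equal to \<open>\<tau>\<close> times the
  total-mass functional. That functional takes the same value on every column of the basis matrix,
  whereas a row of the inverse is 1 on one column and 0 on the others. The basis would then be
  \<open>{i}\<close>, too small for \<open>N \<ge> 2\<close>.\<close>

lemma basis_row_weighted_var_pos:
  assumes N: "N \<ge> 2" and r: "rel_int_simplex N r" and s: "rel_int_simplex N s" and lam: "0 < lam" "lam < 1"
    and I: "ot_is_basis N I" and i: "i \<in> I"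
  defines "u \<equiv> ot_Binv N I (ot_idx I i)"
  shows "0 < lam * weighted_var N r (\<lambda>x. if x < N - 1 then u x else 0)
    + (1 - lam) * weighted_var N s (\<lambda>x. u (N - 1 + x))"
proof (rule ccontr)
  let ?\<xi> = "\<lambda>x. if x < N - 1 then u x else 0" and ?\<eta> = "\<lambda>x. u (N - 1 + x)"
  note D = ot_is_basisD[OF I]
  assume neg: "\<not> ?thesis"
  have r': "\<And>x. x < N \<Longrightarrow> 0 < r x" and s': "\<And>x. x < N \<Longrightarrow> 0 < s x"
    using r s by (auto simp: rel_int_simplex_def)
  have V: "0 \<le> weighted_var N r ?\<xi>" "0 \<le> weighted_var N s ?\<eta>"
    by (intro weighted_var_nonneg less_imp_le r' s'; assumption)+
  then have "0 \<le> lam * weighted_var N r ?\<xi>" "0 \<le> (1 - lam) * weighted_var N s ?\<eta>" using lam by auto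
  then have "lam * weighted_var N r ?\<xi> = 0" "(1 - lam) * weighted_var N s ?\<eta> = 0" using neg by linarith+
  then have V0: "weighted_var N r ?\<xi> = 0" "weighted_var N s ?\<eta> = 0" using lam by auto
  have const: "?\<xi> x = weighted_mean N r ?\<xi>" "?\<eta> x = weighted_mean N s ?\<eta>" if "x < N" for x
    using weighted_var_eq_0[OF r' V0(1) that] weighted_var_eq_0[OF s' V0(2) that] by simp_all
  define \<tau> where "\<tau> = weighted_mean N s ?\<eta>"
  \<comment> \<open>The extension by 0 at the dropped index \<open>N - 1\<close> forces the constant
    to be 0.\<close>
  have "weighted_mean N r ?\<xi> = 0" using const(1)[of "N - 1"] N by simp
  then have u1: "u a = 0" if "a < N - 1" for a using const(1)[of a] that by simp
  have u2: "u a = \<tau>" if "N - 1 \<le> a" "a < 2 * N - 1" for a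
    using const(2)[of "a - (N - 1)"] that by (simp add: \<tau>_def)
  have delta: "(if i = j then 1 else 0) = \<tau>" if j: "j \<in> I" for j
  proof -
    have jN: "j < N^2" using j D(2) by auto
    have "(if i = j then 1 else 0) = (\<Sum>a<2 * N - 1. u a * Adag_entry N a j)"
      using fun_cong[OF basic_sol_column[OF I j], of i] i by (simp add: basic_sol_def u_def)
    also have "\<dots> = (\<Sum>a<2 * N - 1. \<tau> * (Adag_entry N a j * (if a < N - 1 then 0 else 1)))"
      using u1 u2 by (intro sum.cong) auto
    also have "\<dots> = \<tau>" by (simp only: sum_distrib_left[symmetric] Adag_column_mass[OF jN] mult_1_right)
    finally show ?thesis .
  qed
  have "j = i" if "j \<in> I" for j using delta[OF i] delta[OF that] by (auto split: if_splits)
  then have "I = {i}" using i by blast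
  then have "card I = 1" by simp
  then show False using D(3) N by simp
qed

lemma AE_basic_sol_ot_Gvec_neq_0:
  assumes N: "N \<ge> 1" and r: "rel_int_simplex N r" and s: "rel_int_simplex N s"
    and lam: "0 < lam" "lam < 1" and P: "prob_space P"
    and G1: "centred_gaussian P (N - 1) (ot_Sig r) G1" and G2: "centred_gaussian P N (ot_Sig s) G2"
    and G12: "prob_space.indep_var P borel G1 borel G2"
    and p: "ot_feasible N r s p" and I: "ot_is_basis N I" and i: "i \<in> I" "\<not> p i > 0"
  shows "AE \<omega> in P. basic_sol N I (ot_Gvec N lam G1 G2 \<omega>) i \<noteq> 0"
proof (cases "N = 1")
  case True
  \<comment> \<open>For \<open>N = 1\<close> the Gaussian limit is almost surely 0, but the only
    cell carries the positive mass \<open>s 0\<close>, so there is no bounding hyperplane to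
    consider.\<close>
  have "i = 0" using ot_is_basisD(2)[OF I] i True by auto
  moreover have "p 0 = s 0"
    using p Adag_app_col[of 0 N p] True by (simp add: ot_feasible_def ot_marg_def)
  ultimately show ?thesis using i s True by (simp add: rel_int_simplex_def)
next
  case False
  then have "N \<ge> 2" using N by simp
  from AE_ot_Gvec_neq_0[OF N r s lam P G1 G2 G12 basis_row_weighted_var_pos[OF this r s lam I i(1)]]
  show ?thesis using i(1) by (simp add: basic_sol_def)
qed

lemma ot_scale_at_top:
  assumes n: "filterlim n at_top sequentially"
    and ratio: "(\<lambda>t. real (m t) / real (n t + m t)) \<longlonglongrightarrow> lam" and lam: "0 < lam"
  shows "filterlim (\<lambda>t. ot_scale (n t) (m t)) at_top sequentially"
proof -
  have "filterlim (\<lambda>t. real (m t) / real (n t + m t) * real (n t)) at_top sequentially"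
    by (rule filterlim_tendsto_pos_mult_at_top[OF ratio lam filterlim_compose[OF filterlim_real_sequentially n]])
  then have "filterlim (\<lambda>t. sqrt (real (m t) / real (n t + m t) * real (n t))) at_top sequentially"
    by (rule filterlim_compose[OF sqrt_at_top])
  then show ?thesis by (simp add: ot_scale_def mult.commute)
qed

section \<open>Limit laws for the empirical plans, with general weights and under (A3)\<close>

theorem theorem6p11:
  fixes N :: nat and c r s :: "nat \<Rightarrow> real"
    and M :: "'a measure" and X Y :: "nat \<Rightarrow> 'a \<Rightarrow> nat"
    and pihat :: "nat \<Rightarrow> nat \<Rightarrow> 'a \<Rightarrow> nat \<Rightarrow> real"
    and n m :: "nat \<Rightarrow> nat" and lam :: real
    and P :: "'b measure" and G1 G2 :: "'b \<Rightarrow> nat \<Rightarrow> real"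
    and Nprime K :: nat and Ib :: "nat \<Rightarrow> nat set"
  assumes r: "rel_int_simplex N r" and s: "rel_int_simplex N s"
    and unique: "\<exists>!p. ot_optimal N c r s p"
    and M: "prob_space M"
    and indep: "prob_space.indep_vars M (\<lambda>_. count_space UNIV)
                  (\<lambda>i. case i of Inl k \<Rightarrow> X k | Inr k \<Rightarrow> Y k) UNIV"
    and X_range: "\<forall>k. \<forall>\<omega>\<in>space M. X k \<omega> < N"
    and Y_range: "\<forall>k. \<forall>\<omega>\<in>space M. Y k \<omega> < N"
    and X_law: "\<forall>k a. a < N \<longrightarrow> measure M {\<omega>\<in>space M. X k \<omega> = a} = r a"
    and Y_law: "\<forall>k a. a < N \<longrightarrow> measure M {\<omega>\<in>space M. Y k \<omega> = a} = s a"
    and pihat: "\<forall>n' m'. 1 \<le> n' \<longrightarrow> 1 \<le> m' \<longrightarrow> pihat n' m' \<in> borel_measurable M \<and>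
       (\<forall>\<omega>\<in>space M. ot_optimal N c (ot_empirical X n' \<omega>) (ot_empirical Y m' \<omega>) (pihat n' m' \<omega>))"
    and n: "filterlim n at_top sequentially" and m: "filterlim m at_top sequentially"
    and ratio: "(\<lambda>t. real (m t) / real (n t + m t)) \<longlonglongrightarrow> lam"
    and lam: "0 < lam" "lam < 1"
    and P: "prob_space P"
    and G1: "centred_gaussian P (N - 1) (ot_Sig r) G1"
    and G2: "centred_gaussian P N (ot_Sig s) G2"
    and G12: "prob_space.indep_var P borel G1 borel G2"
    and KN: "K \<le> Nprime"
    and Ib_inj: "inj_on Ib {..<Nprime}"
    and Ib_dual: "Ib ` {..<Nprime} = {I. dual_feasible N c I}"
    and Ib_primal: "\<forall>k<Nprime. (k < K \<longleftrightarrow> (\<forall>i. 0 \<le> basic_sol N (Ib k) (ot_marg N r s) i))"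
  shows
    "(\<forall>(\<alpha> :: nat set \<Rightarrow> nat \<Rightarrow> nat \<Rightarrow> 'a \<Rightarrow> nat \<Rightarrow> real)
        (\<alpha>lim :: nat set \<Rightarrow> 'b \<Rightarrow> nat \<Rightarrow> real).
       (\<forall>S. S \<noteq> {} \<and> S \<subseteq> {..<K} \<longrightarrow>
          (\<forall>n' m'. 1 \<le> n' \<longrightarrow> 1 \<le> m' \<longrightarrow> \<alpha> S n' m' \<in> borel_measurable M \<and>
             (\<forall>\<omega>\<in>space M. simplex_on S (\<alpha> S n' m' \<omega>) \<and>
                (feas_set N Nprime Ib (ot_marg N (ot_empirical X n' \<omega>) (ot_empirical Y m' \<omega>)) = S \<longrightarrow>
                 pihat n' m' \<omega> = (\<lambda>i. \<Sum>k\<in>S. \<alpha> S n' m' \<omega> k *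
                     basic_sol N (Ib k) (ot_marg N (ot_empirical X n' \<omega>) (ot_empirical Y m' \<omega>)) i)))) \<and>
          \<alpha>lim S \<in> borel_measurable P \<and>
          conv_distr M
            (\<lambda>t \<omega>. (\<alpha> S (n t) (m t) \<omega>,
                     \<lambda>a. ot_scale (n t) (m t) *
                        (ot_marg N (ot_empirical X (n t) \<omega>) (ot_empirical Y (m t) \<omega>) a - ot_marg N r s a)))
            P (\<lambda>\<omega>. (\<alpha>lim S \<omega>, ot_Gvec N lam G1 G2 \<omega>)))
       \<longrightarrow>
       conv_distr M (\<lambda>t \<omega> i. ot_scale (n t) (m t) * (pihat (n t) (m t) \<omega> i - pistar N c r s i))
         P (\<lambda>\<omega> i. \<Sum>S\<in>{S. S \<noteq> {} \<and> S \<subseteq> {..<K}}.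
              (if ot_Gvec N lam G1 G2 \<omega> \<in> (\<Inter>k\<in>S. ot_Hcone N (pistar N c r s) (Ib k))
                    - (\<Union>k\<in>{..<K} - S. ot_Hcone N (pistar N c r s) (Ib k))
               then (\<Sum>k\<in>S. \<alpha>lim S \<omega> k * basic_sol N (Ib k) (ot_Gvec N lam G1 G2 \<omega>) i)
               else 0)))
     \<and>
     ((\<forall>j k. j < k \<longrightarrow> k < K \<longrightarrow> dual_sol N c (Ib j) \<noteq> dual_sol N c (Ib k)) \<longrightarrow>
       conv_distr M (\<lambda>t \<omega> i. ot_scale (n t) (m t) * (pihat (n t) (m t) \<omega> i - pistar N c r s i))
         P (\<lambda>\<omega> i. \<Sum>k<K.
              (if ot_Gvec N lam G1 G2 \<omega> \<in> ot_Hcone N (pistar N c r s) (Ib k)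
                    - (\<Union>j<k. ot_Hcone N (pistar N c r s) (Ib j))
               then basic_sol N (Ib k) (ot_Gvec N lam G1 G2 \<omega>) i else 0)))"
proof -
  define v0 where "v0 = ot_marg N r s"
  define ps where "ps = pistar N c r s"
  define dev where "dev t = ot_dev N r s X Y (n t) (m t)" for t
  define G where "G = ot_Gvec N lam G1 G2"
  define Z where "Z t \<omega> i = ot_scale (n t) (m t) * (pihat (n t) (m t) \<omega> i - ps i)" for t \<omega> i
  define w where "w t \<omega> = ot_marg N (ot_empirical X (n t) \<omega>) (ot_empirical Y (m t) \<omega>)" for t \<omega>
  let ?act = "active_cones N ps Ib K"
  have N: "N \<ge> 1" using r by (cases N) (auto simp: rel_int_simplex_def)
  interpret M: prob_space M by (rule M)
  have dev_eq: "dev t \<omega> = (\<lambda>a. ot_scale (n t) (m t) * (w t \<omega> a - v0 a))" for t \<omega>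
    by (simp add: dev_def ot_dev_def fun_eq_iff w_def v0_def)
  have rv: "(case i of Inl k \<Rightarrow> X k | Inr k \<Rightarrow> Y k) \<in> M \<rightarrow>\<^sub>M count_space UNIV" for i
    using indep unfolding M.indep_vars_def by blast
  have X_meas: "X k \<in> M \<rightarrow>\<^sub>M count_space UNIV" and Y_meas: "Y k \<in> M \<rightarrow>\<^sub>M count_space UNIV" for k
    using rv[of "Inl k"] rv[of "Inr k"] by simp_all
  have dev_meas: "dev t \<in> borel_measurable M" for t
    unfolding dev_def by (rule measurable_ot_dev[OF X_meas Y_meas])
  have G_meas: "G \<in> borel_measurable P"
    unfolding G_def using G1 G2 by (intro measurable_ot_Gvec) (simp_all add: centred_gaussian_def)
  have conv: "conv_distr M dev P G"
    unfolding dev_def G_def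
    by (rule ot_clt[OF N r s M indep _ _ _ _ X_meas Y_meas n m ratio lam P G1 G2 G12])
       (use X_range Y_range X_law Y_law in auto)
  have dual: "dual_feasible N c (Ib k)" if "k < Nprime" for k using Ib_dual that by blast
  have bas: "ot_is_basis N (Ib k)" if "k < Nprime" for k using dual[OF that] by (simp add: dual_feasible_def)
  have primal: "k < K \<longleftrightarrow> (\<forall>i. 0 \<le> basic_sol N (Ib k) v0 i)" if "k < Nprime" for k
    using Ib_primal that by (simp add: v0_def)
  have ps_opt: "ot_optimal N c r s ps" unfolding ps_def pistar_def using unique by (rule theI')
  have basic_ps: "basic_sol N (Ib k) v0 = ps" if "k < K" for k
  proof -
    have k: "k < Nprime" using that KN by simp
    have "ot_optimal N c r s (basic_sol N (Ib k) v0)"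
      using dual_feasible_basic_sol_optimal[OF dual[OF k]] primal[OF k] that by (simp add: v0_def)
    then show ?thesis using ps_opt unique by blast
  qed
  have fin: "finite (Ib k)" if "k < K" for k using ot_is_basisD(1)[OF bas] that KN by simp
  have nz: "AE \<omega> in P. basic_sol N (Ib k) (G \<omega>) i \<noteq> 0" if "k < K" "i \<in> Ib k" "\<not> ps i > 0" for k i
    unfolding G_def using that KN ps_opt bas[of k]
    by (intro AE_basic_sol_ot_Gvec_neq_0[OF N r s lam P G1 G2 G12, of ps]) (auto simp: ot_optimal_def)
  have pos: "eventually (\<lambda>t. n t \<ge> 1 \<and> m t \<ge> 1) sequentially"
    using n m by (auto simp: filterlim_at_top intro: eventually_conj)
  have pihat_opt: "ot_optimal N c (ot_empirical X n' \<omega>) (ot_empirical Y m' \<omega>) (pihat n' m' \<omega>)"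
    if "1 \<le> n'" "1 \<le> m'" "\<omega> \<in> space M" for n' m' \<omega> using pihat that by blast
  have Z_meas: "eventually (\<lambda>t. Z t \<in> borel_measurable M) sequentially"
    using pos
  proof eventually_elim
    case (elim t)
    then have [measurable]: "(\<lambda>\<omega>. pihat (n t) (m t) \<omega> i) \<in> borel_measurable M" for i
      using pihat by (intro measurable_coordinate) auto
    show ?case unfolding Z_def by (rule measurable_coordinatewise_then_product) measurable
  qed
  obtain \<delta> where \<delta>: "\<delta> > 0"
    and local: "\<And>\<sigma> w. \<sigma> > 0 \<Longrightarrow>
      (\<Sum>k<Nprime. \<Sum>i<N^2. \<bar>basic_sol N (Ib k) (\<lambda>a. \<sigma> * (w a - v0 a)) i\<bar>) < \<sigma> * \<delta> \<Longrightarrow>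
      feas_set N Nprime Ib w = ?act (\<lambda>a. \<sigma> * (w a - v0 a))"
    using feasibility_via_cones[OF bas KN primal basic_ps] by blast
  define h where "h v = (\<Sum>k<Nprime. \<Sum>i<N^2. \<bar>basic_sol N (Ib k) v i\<bar>)" for v
  have h_cont: "continuous_on UNIV h" unfolding h_def by (intro continuous_intros continuous_basic_sol)
  \<comment> \<open>The event that the fluctuation is too large for \<open>local\<close>. On its
    complement the feasible bases at the empirical marginals are those with active cones.\<close>
  define A where "A t = {\<omega>\<in>space M. ot_scale (n t) (m t) * \<delta> \<le> h (dev t \<omega>)}" for t
  have A: "A t \<in> sets M" for t
  proof -
    have [measurable]: "h \<in> borel_measurable borel" using h_cont by (rule borel_measurable_continuous_onI)
    note dev_meas[measurable]
    show ?thesis unfolding A_def by measurable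
  qed
  have "filterlim (\<lambda>t. ot_scale (n t) (m t) * \<delta>) at_top sequentially"
    using filterlim_tendsto_pos_mult_at_top[OF tendsto_const \<delta> ot_scale_at_top[OF n ratio lam(1)]]
    by (simp add: mult.commute)
  then have A0: "(\<lambda>t. measure M (A t)) \<longlonglongrightarrow> 0"
    unfolding A_def by (rule conv_distr_escape[OF M P conv dev_meas G_meas h_cont])
  have good: "?act (dev t \<omega>) \<noteq> {}" "feas_set N Nprime Ib (w t \<omega>) = ?act (dev t \<omega>)"
    if t: "n t \<ge> 1" "m t \<ge> 1" and \<omega>: "\<omega> \<in> space M - A t" for t \<omega>
  proof -
    have "ot_scale (n t) (m t) > 0" using t by (simp add: ot_scale_def)
    moreover have "h (dev t \<omega>) < ot_scale (n t) (m t) * \<delta>" using \<omega> by (auto simp: A_def)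
    ultimately show eq: "feas_set N Nprime Ib (w t \<omega>) = ?act (dev t \<omega>)"
      unfolding dev_eq h_def by (rule local)
    have opt: "ot_optimal N c (ot_empirical X (n t) \<omega>) (ot_empirical Y (m t) \<omega>) (pihat (n t) (m t) \<omega>)"
      using pihat_opt t \<omega> by blast
    \<comment> \<open>\<open>pihat\<close> is used only as a feasible plan for the empirical
      marginals, which is enough for an optimal basis to exist. As \<open>Ib\<close> lists all dual
      feasible bases, that basis has an index, and the active pattern is nonempty.\<close>
    have "\<exists>I. dual_feasible N c I \<and> (\<forall>k. 0 \<le> basic_sol N I (w t \<omega>) k)"
    proof (rule optimal_basis_exists[OF N])
      show "0 \<le> pihat (n t) (m t) \<omega> k" for k
        using opt by (cases "k < N^2") (auto simp: ot_optimal_def ot_feasible_def vec_space_def)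
    qed (use opt in \<open>auto simp: ot_optimal_def ot_feasible_def vec_space_def w_def\<close>)
    then obtain I where I: "dual_feasible N c I" "\<forall>k. 0 \<le> basic_sol N I (w t \<omega>) k" by blast
    then obtain k where "k < Nprime" "I = Ib k" using Ib_dual by blast
    then have "k \<in> feas_set N Nprime Ib (w t \<omega>)" using I by (simp add: feas_set_def)
    then show "?act (dev t \<omega>) \<noteq> {}" unfolding eq by blast
  qed
  have weighted: "conv_distr M Z P (\<lambda>\<omega> i. \<Sum>S\<in>{S. S \<noteq> {} \<and> S \<subseteq> {..<K}}.
      (if ?act (G \<omega>) = S then (\<Sum>k\<in>S. \<alpha>lim S \<omega> k * basic_sol N (Ib k) (G \<omega>) i) else 0))"
    if *: "\<And>S. S \<noteq> {} \<and> S \<subseteq> {..<K} \<Longrightarrow>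
          (\<forall>n' m'. 1 \<le> n' \<longrightarrow> 1 \<le> m' \<longrightarrow> \<alpha> S n' m' \<in> borel_measurable M \<and>
             (\<forall>\<omega>\<in>space M. simplex_on S (\<alpha> S n' m' \<omega>) \<and>
                (feas_set N Nprime Ib (ot_marg N (ot_empirical X n' \<omega>) (ot_empirical Y m' \<omega>)) = S \<longrightarrow>
                 pihat n' m' \<omega> = (\<lambda>i. \<Sum>k\<in>S. \<alpha> S n' m' \<omega> k *
                     basic_sol N (Ib k) (ot_marg N (ot_empirical X n' \<omega>) (ot_empirical Y m' \<omega>)) i)))) \<and>
          \<alpha>lim S \<in> borel_measurable P \<and>
          conv_distr M (\<lambda>t \<omega>. (\<alpha> S (n t) (m t) \<omega>, dev t \<omega>)) P (\<lambda>\<omega>. (\<alpha>lim S \<omega>, G \<omega>))"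
    for \<alpha> :: "nat set \<Rightarrow> nat \<Rightarrow> nat \<Rightarrow> 'a \<Rightarrow> nat \<Rightarrow> real" and \<alpha>lim :: "nat set \<Rightarrow> 'b \<Rightarrow> nat \<Rightarrow> real"
  proof (rule conv_distr_mixture[OF M P dev_meas G_meas conv fin nz _ _ _ Z_meas A A0,
        where \<alpha> = "\<lambda>S t. \<alpha> S (n t) (m t)"])
    fix S assume S: "S \<noteq> {}" "S \<subseteq> {..<K}"
    show "eventually (\<lambda>t. \<alpha> S (n t) (m t) \<in> borel_measurable M) sequentially"
      using pos by eventually_elim (use *[of S] S in blast)
    show "\<alpha>lim S \<in> borel_measurable P"
      "conv_distr M (\<lambda>t \<omega>. (\<alpha> S (n t) (m t) \<omega>, dev t \<omega>)) P (\<lambda>\<omega>. (\<alpha>lim S \<omega>, G \<omega>))"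
      using *[of S] S by blast+
  next
    show "eventually (\<lambda>t. \<forall>\<omega>\<in>space M - A t. ?act (dev t \<omega>) \<noteq> {} \<and>
        Z t \<omega> = (\<lambda>i. \<Sum>k\<in>?act (dev t \<omega>).
             \<alpha> (?act (dev t \<omega>)) (n t) (m t) \<omega> k * basic_sol N (Ib k) (dev t \<omega>) i)) sequentially"
      using pos
    proof eventually_elim
      case (elim t)
      show ?case
      proof (intro ballI conjI)
        fix \<omega> assume \<omega>: "\<omega> \<in> space M - A t"
        let ?S = "?act (dev t \<omega>)"
        let ?a = "\<alpha> ?S (n t) (m t) \<omega>"
        show ne: "?S \<noteq> {}" using good elim \<omega> by blast
        have sub: "?S \<subseteq> {..<K}" by (auto simp: active_cones_def)
        have "\<forall>\<omega>'\<in>space M. simplex_on ?S (\<alpha> ?S (n t) (m t) \<omega>') \<and>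
                (feas_set N Nprime Ib (w t \<omega>') = ?S \<longrightarrow>
                 pihat (n t) (m t) \<omega>' = (\<lambda>i. \<Sum>k\<in>?S. \<alpha> ?S (n t) (m t) \<omega>' k * basic_sol N (Ib k) (w t \<omega>') i))"
          using *[of ?S] ne sub elim unfolding w_def by blast
        then have simp: "simplex_on ?S ?a"
          and pi: "pihat (n t) (m t) \<omega> = (\<lambda>i. \<Sum>k\<in>?S. ?a k * basic_sol N (Ib k) (w t \<omega>) i)"
          using good(2)[of t \<omega>] elim \<omega> by auto
        show "Z t \<omega> = (\<lambda>i. \<Sum>k\<in>?S. ?a k * basic_sol N (Ib k) (dev t \<omega>) i)"
        proof
          fix i
          \<comment> \<open>Since the weights sum to 1, the common vertex can be subtracted inside
            the combination.\<close>
          have "ps i = (\<Sum>k\<in>?S. ?a k) * ps i" using simp by (simp add: simplex_on_def)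
          also have "\<dots> = (\<Sum>k\<in>?S. ?a k * basic_sol N (Ib k) v0 i)"
            using sub basic_ps by (auto simp: sum_distrib_right intro!: sum.cong)
          finally have "Z t \<omega> i = ot_scale (n t) (m t) * (\<Sum>k\<in>?S. ?a k * (basic_sol N (Ib k) (w t \<omega>) i - basic_sol N (Ib k) v0 i))"
            by (simp add: Z_def pi right_diff_distrib sum_subtractf)
          also have "\<dots> = (\<Sum>k\<in>?S. ?a k * basic_sol N (Ib k) (dev t \<omega>) i)"
            unfolding dev_eq basic_sol_scale basic_sol_diff by (simp add: sum_distrib_left mult.left_commute)
          finally show "Z t \<omega> i = (\<Sum>k\<in>?S. ?a k * basic_sol N (Ib k) (dev t \<omega>) i)" .
        qed
      qed
    qed
  qed
  have part1: "conv_distr M Z P (\<lambda>\<omega> i. \<Sum>S\<in>{S. S \<noteq> {} \<and> S \<subseteq> {..<K}}.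
          (if G \<omega> \<in> (\<Inter>k\<in>S. ot_Hcone N ps (Ib k)) - (\<Union>k\<in>{..<K} - S. ot_Hcone N ps (Ib k))
           then (\<Sum>k\<in>S. \<alpha>lim S \<omega> k * basic_sol N (Ib k) (G \<omega>) i) else 0))"
    if "\<forall>S. S \<noteq> {} \<and> S \<subseteq> {..<K} \<longrightarrow>
          (\<forall>n' m'. 1 \<le> n' \<longrightarrow> 1 \<le> m' \<longrightarrow> \<alpha> S n' m' \<in> borel_measurable M \<and>
             (\<forall>\<omega>\<in>space M. simplex_on S (\<alpha> S n' m' \<omega>) \<and>
                (feas_set N Nprime Ib (ot_marg N (ot_empirical X n' \<omega>) (ot_empirical Y m' \<omega>)) = S \<longrightarrow>
                 pihat n' m' \<omega> = (\<lambda>i. \<Sum>k\<in>S. \<alpha> S n' m' \<omega> k *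
                     basic_sol N (Ib k) (ot_marg N (ot_empirical X n' \<omega>) (ot_empirical Y m' \<omega>)) i)))) \<and>
          \<alpha>lim S \<in> borel_measurable P \<and>
          conv_distr M (\<lambda>t \<omega>. (\<alpha> S (n t) (m t) \<omega>, dev t \<omega>)) P (\<lambda>\<omega>. (\<alpha>lim S \<omega>, G \<omega>))"
    for \<alpha> :: "nat set \<Rightarrow> nat \<Rightarrow> nat \<Rightarrow> 'a \<Rightarrow> nat \<Rightarrow> real" and \<alpha>lim :: "nat set \<Rightarrow> 'b \<Rightarrow> nat \<Rightarrow> real"
  proof -
    have "(\<Sum>S\<in>{S. S \<noteq> {} \<and> S \<subseteq> {..<K}}.
          (if G \<omega> \<in> (\<Inter>k\<in>S. ot_Hcone N ps (Ib k)) - (\<Union>k\<in>{..<K} - S. ot_Hcone N ps (Ib k))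
           then (\<Sum>k\<in>S. \<alpha>lim S \<omega> k * basic_sol N (Ib k) (G \<omega>) i) else 0))
      = (\<Sum>S\<in>{S. S \<noteq> {} \<and> S \<subseteq> {..<K}}.
          (if ?act (G \<omega>) = S then (\<Sum>k\<in>S. \<alpha>lim S \<omega> k * basic_sol N (Ib k) (G \<omega>) i) else 0))" for \<omega> i
      by (intro sum.cong refl if_cong) (simp_all only: mem_Collect_eq active_cones_eq_iff)
    then show ?thesis using weighted[of \<alpha> \<alpha>lim] that by (simp only:) blast
  qed
  have part2: "conv_distr M Z P (\<lambda>\<omega> i. \<Sum>k<K.
              (if G \<omega> \<in> ot_Hcone N ps (Ib k) - (\<Union>j<k. ot_Hcone N ps (Ib j))
               then basic_sol N (Ib k) (G \<omega>) i else 0))"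
    if A3: "\<forall>j k. j < k \<longrightarrow> k < K \<longrightarrow> dual_sol N c (Ib j) \<noteq> dual_sol N c (Ib k)"
  proof -
    \<comment> \<open>Selecting the least feasible index is what produces the pieces of the second
      limit, each cone with the earlier ones removed.\<close>
    define e :: "nat set \<Rightarrow> nat \<Rightarrow> real" where "e S k = (if k = Min S then 1 else 0)" for S k
    have e_sum: "(\<Sum>k\<in>S. e S k * b k) = b (Min S)" if "S \<noteq> {}" "S \<subseteq> {..<K}" for S and b :: "nat \<Rightarrow> real"
    proof -
      have S: "finite S" "Min S \<in> S" using that finite_subset[of S "{..<K}"] by auto
      have "(\<Sum>k\<in>S. e S k * b k) = (\<Sum>k\<in>S. if k = Min S then b (Min S) else 0)"
        by (intro sum.cong) (auto simp: e_def)
      then show ?thesis using S by simp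
    qed
    have strict: "(\<Sum>a<2 * N - 1. Adag_entry N a j * dual_sol N c (Ib k) a) < c j"
      if k: "k < K" and j: "j < N^2" "j \<notin> Ib k" for k j
    proof (rule dual_strict_of_unique_dual_sol[OF _ _ _ j, where v = v0])
      have kN: "k < Nprime" using k KN by simp
      show "dual_feasible N c (Ib k)" "\<And>i. 0 \<le> basic_sol N (Ib k) v0 i" using dual primal kN k by blast+
      fix J assume J: "dual_feasible N c J" "\<And>i. 0 \<le> basic_sol N J v0 i" "dual_sol N c J = dual_sol N c (Ib k)"
      then obtain l where l: "l < Nprime" "J = Ib l" using Ib_dual by blast
      \<comment> \<open>Feasibility at \<open>v0\<close> puts the competing basis among the first
        \<open>K\<close>, the range in which (A3) separates dual solutions.\<close>
      then have "l < K" using J(2) primal by blast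
      then have "l = k" using A3 J(3) l(2) k by (metis linorder_neqE_nat)
      then show "J = Ib k" using l by simp
    qed
    have "conv_distr M Z P (\<lambda>\<omega> i. \<Sum>S\<in>{S. S \<noteq> {} \<and> S \<subseteq> {..<K}}.
      (if ?act (G \<omega>) = S then (\<Sum>k\<in>S. e S k * basic_sol N (Ib k) (G \<omega>) i) else 0))"
    proof (rule weighted[of "\<lambda>S _ _ _. e S" "\<lambda>S _. e S"], intro conjI allI impI ballI)
      fix S assume S: "S \<noteq> {} \<and> S \<subseteq> {..<K}"
      then have MinS: "Min S \<in> S" using finite_subset[of S "{..<K}"] by auto
      show "simplex_on S (e S)"
        using e_sum[of S "\<lambda>_. 1"] S MinS by (auto simp: simplex_on_def e_def)
      show "conv_distr M (\<lambda>t \<omega>. (e S, dev t \<omega>)) P (\<lambda>\<omega>. (e S, G \<omega>))"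
        using conv by (rule conv_distr_const_Pair)
      fix n' m' :: nat and \<omega> assume nm: "1 \<le> n'" "1 \<le> m'" and \<omega>: "\<omega> \<in> space M"
      let ?w = "ot_marg N (ot_empirical X n' \<omega>) (ot_empirical Y m' \<omega>)"
      assume "feas_set N Nprime Ib ?w = S"
      then have "\<And>i. 0 \<le> basic_sol N (Ib (Min S)) ?w i" using MinS by (auto simp: feas_set_def)
      moreover have "Min S < K" using MinS S by auto
      ultimately have "pihat n' m' \<omega> = basic_sol N (Ib (Min S)) ?w"
        using KN pihat_opt[OF nm \<omega>] strict
        by (intro optimal_eq_basic_sol[OF dual]) auto
      then show "pihat n' m' \<omega> = (\<lambda>i. \<Sum>k\<in>S. e S k * basic_sol N (Ib k) ?w i)"
        using S by (simp add: e_sum)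
    qed auto
    moreover have "(\<Sum>S\<in>{S. S \<noteq> {} \<and> S \<subseteq> {..<K}}.
      (if ?act v = S then (\<Sum>k\<in>S. e S k * b k) else 0))
      = (\<Sum>k<K. if v \<in> ot_Hcone N ps (Ib k) - (\<Union>j<k. ot_Hcone N ps (Ib j)) then b k else 0)"
      for v and b :: "nat \<Rightarrow> real"
    proof -
      have sub: "?act v \<subseteq> {..<K}" by (auto simp: active_cones_def)
      then have finA: "finite (?act v)" by (rule finite_subset) simp
      have "(\<Sum>S\<in>{S. S \<noteq> {} \<and> S \<subseteq> {..<K}}. (if ?act v = S then (\<Sum>k\<in>S. e S k * b k) else 0))
        = (\<Sum>S\<in>{S. S \<noteq> {} \<and> S \<subseteq> {..<K}}. (if S = ?act v then b (Min (?act v)) else 0))"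
      proof (rule sum.cong[OF refl])
        fix S assume "S \<in> {S. S \<noteq> {} \<and> S \<subseteq> {..<K}}"
        then show "(if ?act v = S then (\<Sum>k\<in>S. e S k * b k) else 0) = (if S = ?act v then b (Min (?act v)) else 0)"
          using e_sum[of S b] by (cases "?act v = S") auto
      qed
      also have "\<dots> = (if ?act v \<noteq> {} then b (Min (?act v)) else 0)"
        using sub by (subst sum.delta) auto
      also have "\<dots> = (\<Sum>k<K. if ?act v \<noteq> {} \<and> k = Min (?act v) then b k else 0)"
      proof (cases "?act v = {}")
        case False
        then have "Min (?act v) < K" using Min_in[OF finA] sub by auto
        then show ?thesis using False by simp
      qed simp
      also have "\<dots> = (\<Sum>k<K. if v \<in> ot_Hcone N ps (Ib k) - (\<Union>j<k. ot_Hcone N ps (Ib j)) then b k else 0)"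
      proof (intro sum.cong refl if_cong)
        fix k assume k: "k \<in> {..<K}"
        \<comment> \<open>Being the least active index means lying in this cone and in no earlier
          one, which frees the condition from \<open>Min\<close> and its default on the empty
          set.\<close>
        have "(?act v \<noteq> {} \<and> k = Min (?act v)) \<longleftrightarrow> (k \<in> ?act v \<and> (\<forall>j\<in>?act v. k \<le> j))"
          using finA by (metis Min_eqI Min_in Min_le empty_iff)
        also have "\<dots> \<longleftrightarrow> v \<in> ot_Hcone N ps (Ib k) - (\<Union>j<k. ot_Hcone N ps (Ib j))"
          using k by (auto simp: active_cones_def) (meson leD order.strict_trans)
        finally show "(?act v \<noteq> {} \<and> k = Min (?act v)) = (v \<in> ot_Hcone N ps (Ib k) - (\<Union>j<k. ot_Hcone N ps (Ib j)))" .
      qed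
      finally show ?thesis .
    qed
    ultimately show ?thesis by (simp only:)
  qed
  show ?thesis
    using part1 part2 unfolding dev_eq Z_def[abs_def] G_def ps_def w_def v0_def by blast
qed

thm_deps theorem6p11

end
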